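(* The Shabat polynomials of the two trees with passport $[3,2^2,1^3;2^5;10]$ are (up to equivalence) $Q_1(P(x))$ and $Q_2(R(x))$, one for each tree, where $$Q_1(x)=x\left(x-\frac{64}{9}\right),\quad P(x)=x^3\left(x^2+\frac{5x}{3}+\frac{40}{9}\right),\quad Q_2(x)=x\left(x-\frac49\right),\quad R(x)=x^3\left(x-\frac53\right)^2.$$
   Context: A Shabat polynomial is a complex polynomial with at most two finite critical values $c_1,c_2$. Its tree is the bicolored plane tree $P^{-1}([c_1,c_2])$, with black vertices the points of $P^{-1}(c_1)$, white vertices the points of $P^{-1}(c_2)$, edges the connected components of the preimage of the open segment $(c_1,c_2)$, and vertex degree equal to the multiplicity of the corresponding root of $P-c_1$ or $P-c_2$. Two Shabat polynomials $P,Q$ (with ordered critical values $c_{1,1},c_{1,2}$ and $c_{2,1},c_{2,2}$) are equivalent if $Q(x)=AP(ax+b)+B$ with $A,a\ne 0$ and $c_{2,j}=Ac_{1,j}+B$ for $j=1,2$; bicolored plane trees (up to color- and orientation-preserving isomorphism) correspond bijectively to Shabat polynomials up to equivalence. The passport $[\alpha;\beta;n]$ of a tree with $n$ edges records the partition $\alpha\vdash n$ of black vertex degrees and $\beta\vdash n$ of white vertex degrees ($k^m$ means $k$ repeated $m$ times). There are exactly two trees with passport $[3,2^2,1^3;2^5;10]$. In the claim, $c_1=0$ for both compositions. *)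

theory Defs
  imports
    "HOL-Analysis.Analysis"
    "HOL-Computational_Algebra.Computational_Algebra"
    "HOL-Combinatorics.Orbits"
begin

section \<open>Bicolored plane trees\<close>

text \<open>
  A plane graph is recorded by its vertices, its edges with their two ends, and its rotation
  system: \<open>rot G v e\<close> is the edge that follows \<open>e\<close> in counterclockwise order around the vertex \<open>v\<close>.
  Multiple edges are representable. Only the values of \<open>rot G v\<close> on edges at \<open>v\<close> matter.
\<close>

record ('v, 'e) bicolored_plane_graph =
  black :: "'v set"
  white :: "'v set"
  edges :: "'e set"
  black_end :: "'e \<Rightarrow> 'v"
  white_end :: "'e \<Rightarrow> 'v"
  rot :: "'v \<Rightarrow> 'e \<Rightarrow> 'e"

definition vertices :: "('v, 'e) bicolored_plane_graph \<Rightarrow> 'v set" where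
  "vertices G = black G \<union> white G"

definition edges_at :: "('v, 'e) bicolored_plane_graph \<Rightarrow> 'v \<Rightarrow> 'e set" where
  "edges_at G v = {e \<in> edges G. black_end G e = v \<or> white_end G e = v}"

definition vertex_degree :: "('v, 'e) bicolored_plane_graph \<Rightarrow> 'v \<Rightarrow> nat" where
  "vertex_degree G v = card (edges_at G v)"

definition adjacency :: "('v, 'e) bicolored_plane_graph \<Rightarrow> ('v \<times> 'v) set" where
  "adjacency G = {(u, v). \<exists>e \<in> edges G. {u, v} = {black_end G e, white_end G e}}"

definition connected_graph :: "('v, 'e) bicolored_plane_graph \<Rightarrow> bool" where
  "connected_graph G \<longleftrightarrow>
     vertices G \<noteq> {} \<and> (\<forall>u \<in> vertices G. \<forall>v \<in> vertices G. (u, v) \<in> (adjacency G)\<^sup>*)"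

text \<open>Two parallel edges form a cycle of length 2; loops are excluded by the coloring.\<close>

definition is_cycle :: "('v, 'e) bicolored_plane_graph \<Rightarrow> 'v list \<Rightarrow> 'e list \<Rightarrow> bool" where
  "is_cycle G vs es \<longleftrightarrow>
     2 \<le> length es \<and> length vs = length es \<and> distinct vs \<and> distinct es \<and> set es \<subseteq> edges G \<and>
     (\<forall>i < length es. {black_end G (es ! i), white_end G (es ! i)} =
                      {vs ! i, vs ! (Suc i mod length es)})"

text \<open>
  The rotation at each vertex is a single cyclic permutation of the edges at that vertex. No
  planarity condition is needed: every rotation system on a tree is realized in the oriented
  plane. The tree with a single vertex and no edge is not included, since
  \<^const>\<open>cyclic_on\<close> requires a nonempty set.
\<close>

definition bicolored_plane_tree :: "('v, 'e) bicolored_plane_graph \<Rightarrow> bool" where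
  "bicolored_plane_tree G \<longleftrightarrow>
     finite (black G) \<and> finite (white G) \<and> finite (edges G) \<and> black G \<inter> white G = {} \<and>
     (\<forall>e \<in> edges G. black_end G e \<in> black G \<and> white_end G e \<in> white G) \<and>
     (\<forall>v \<in> vertices G. cyclic_on (rot G v) (edges_at G v)) \<and>
     connected_graph G \<and> (\<nexists>vs es. is_cycle G vs es)"

text \<open>Isomorphisms preserve colors, and, by commuting with the rotations, the orientation.\<close>

definition plane_isomorphic ::
  "('v, 'e) bicolored_plane_graph \<Rightarrow> ('w, 'f) bicolored_plane_graph \<Rightarrow> bool" where
  "plane_isomorphic G H \<longleftrightarrow>
     (\<exists>\<phi> \<psi>. bij_betw \<phi> (black G) (black H) \<and> bij_betw \<phi> (white G) (white H) \<and>
       bij_betw \<psi> (edges G) (edges H) \<and>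
       (\<forall>e \<in> edges G. black_end H (\<psi> e) = \<phi> (black_end G e) \<and>
                       white_end H (\<psi> e) = \<phi> (white_end G e)) \<and>
       (\<forall>v \<in> vertices G. \<forall>e \<in> edges_at G v. \<psi> (rot G v e) = rot H (\<phi> v) (\<psi> e)))"

definition passport :: "('v, 'e) bicolored_plane_graph \<Rightarrow> nat multiset \<times> nat multiset \<times> nat" where
  "passport G =
     (image_mset (vertex_degree G) (mset_set (black G)),
      image_mset (vertex_degree G) (mset_set (white G)),
      card (edges G))"


section \<open>Shabat polynomials\<close>

text \<open>The pair \<open>(c1, c2)\<close> is ordered: it determines which vertices are black and which are white.\<close>

definition is_shabat :: "complex poly \<Rightarrow> complex \<Rightarrow> complex \<Rightarrow> bool" where
  "is_shabat f c1 c2 \<longleftrightarrow>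
     degree f > 0 \<and> c1 \<noteq> c2 \<and> (\<forall>z. poly (pderiv f) z = 0 \<longrightarrow> poly f z \<in> {c1, c2})"

definition shabat_equivalent ::
  "complex poly \<times> complex \<times> complex \<Rightarrow> complex poly \<times> complex \<times> complex \<Rightarrow> bool" where
  "shabat_equivalent = (\<lambda>(f, c11, c12) (g, c21, c22).
     \<exists>A B a b. A \<noteq> 0 \<and> a \<noteq> 0 \<and> (\<forall>x. poly g x = A * poly f (a * x + b) + B) \<and>
       c21 = A * c11 + B \<and> c22 = A * c12 + B)"


subsection \<open>The tree of a Shabat polynomial\<close>

definition shabat_edges :: "complex poly \<Rightarrow> complex \<Rightarrow> complex \<Rightarrow> complex set set" where
  "shabat_edges f c1 c2 = components {z. poly f z \<in> open_segment c1 c2}"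

text \<open>The unit tangent vector with which the edge \<open>e\<close> leaves its end \<open>v\<close>.\<close>

definition direction :: "complex \<Rightarrow> complex set \<Rightarrow> complex" where
  "direction v e = Lim (at v within e) (\<lambda>z. sgn (z - v))"

text \<open>
  The counterclockwise angle at \<open>v\<close> from \<open>e\<close> to \<open>e'\<close>. From an edge back to itself it is a full
  turn, so that the next edge around a vertex of degree 1 is the edge itself.
\<close>

definition turn :: "complex \<Rightarrow> complex set \<Rightarrow> complex set \<Rightarrow> real" where
  "turn v e e' = (if e' = e then 2 * pi else Arg2pi (direction v e' / direction v e))"

text \<open>
  A vertex \<open>v\<close> is an end of the edge \<open>e\<close> iff it lies in the closure of \<open>e\<close>. For a Shabat
  polynomial \<open>f\<close> every edge has exactly one end over \<open>c1\<close> and one over \<open>c2\<close>, and the edges at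
  \<open>v\<close> leave in distinct directions; their number is the multiplicity of \<open>v\<close> as a root of
  \<open>f - c1\<close> or \<open>f - c2\<close>.
\<close>

definition shabat_tree ::
  "complex poly \<Rightarrow> complex \<Rightarrow> complex \<Rightarrow> (complex, complex set) bicolored_plane_graph" where
  "shabat_tree f c1 c2 =
     \<lparr> black = {z. poly f z = c1},
       white = {z. poly f z = c2},
       edges = shabat_edges f c1 c2,
       black_end = (\<lambda>e. THE v. poly f v = c1 \<and> v \<in> closure e),
       white_end = (\<lambda>e. THE v. poly f v = c2 \<and> v \<in> closure e),
       rot = (\<lambda>v e. arg_min_on (turn v e) {e' \<in> shabat_edges f c1 c2. v \<in> closure e'}) \<rparr>"

definition is_shabat_polynomial_of ::
  "('v, 'e) bicolored_plane_graph \<Rightarrow> complex poly \<Rightarrow> complex \<Rightarrow> complex \<Rightarrow> bool" where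
  "is_shabat_polynomial_of T f c1 c2 \<longleftrightarrow>
     is_shabat f c1 c2 \<and> plane_isomorphic (shabat_tree f c1 c2) T"

end

(*
  Over the complement of {0, 1} a polynomial g whose critical values lie in {0, 1} is a covering
  map, so the edges of its tree are the lifts of the open segment (0, 1), one for each point over
  1/2. Near a root v of order m, g is the m-th power of a local coordinate; hence m lifts end at
  v, with the directions of the m-th roots of unity, and counting roots shows that there are no
  others. The tree is connected because the plane without the vertices is: the sheets over the
  doubly slit plane belonging to one component of the tree have a relatively closed union, and two
  sheets that meet across a slit have a common vertex.

  When all white vertices have degree 2, the tree is a pairing of the edges at the black vertices,
  and connectedness alone leaves two pairings. Algebraically, f = w + C S^2 with S' = 5 (x - a)^2
  (x - p) (x - q), where a is the triple root of f - b and p, q are the double ones. Either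
  S p = S q = - S a, which leads to Q1 (P x), or exactly one of S p, S q equals S a, which leads
  to Q2 (R x). Finally S changes sign between the two black neighbours of a white vertex, which
  tells the two trees apart.
*)

theory Submission
  imports Defs "HOL-Complex_Analysis.Complex_Analysis"
begin

section \<open>Covering properties of polynomials\<close>

text \<open>The tree is defined through components, closures, limits of directions and minimal
  angles, which cannot simply be evaluated for a concrete polynomial. So neither composition has its
  tree drawn: the local structure is read off from multiplicities, and each composition is placed by
  excluding one of the two candidate trees. The orientation leaves no further choice, because each
  candidate has two equal legs at its trivalent vertex, and exchanging them reverses the cyclic
  order there.

  Origin of the constants: after moving \<open>a\<close> to 0 and rescaling, \<open>P\<close> and
  \<open>R\<close> are the primitives, vanishing at 0, of \<open>5 t^2 (t^2 + 4/3 t + 8/3)\<close>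
  and \<open>5 t^2 (t - 5/3) (t - 1)\<close>. Their critical values are 0 and 64/9, respectively 0
  and 4/9. \<open>Q1\<close> and \<open>Q2\<close> vanish exactly at these, and their own critical
  points are the midpoints 32/9 and 2/9, whence the white values -1024/81 and -4/81.\<close>

lemma sum_order_eq_degree:
  fixes p :: "complex poly"
  assumes "p \<noteq> 0"
  shows "(\<Sum>z | poly p z = 0. order z p) = degree p"
proof -
  have "degree p = degree (smult (lead_coeff p) (\<Prod>z|poly p z = 0. [:-z, 1:] ^ order z p))"
    by (simp add: complex_poly_decompose)
  also have "\<dots> = (\<Sum>z | poly p z = 0. order z p)"
    using assms by (simp add: degree_prod_eq_sum_degree degree_power_eq)
  finally show ?thesis by simp
qed

text \<open>Outside \<open>C\<close> no root of \<open>g - [:w:]\<close> is a root of its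
  derivative, so all roots are simple and counting with multiplicity counts points.\<close>

lemma card_regular_fibre:
  fixes g :: "complex poly"
  assumes "degree g > 0" and crit: "\<And>z. poly (pderiv g) z = 0 \<Longrightarrow> poly g z \<in> C" and "w \<notin> C"
  shows "card {z. poly g z = w} = degree g"
proof -
  let ?p = "g - [:w:]"
  have d: "degree ?p = degree g"
    using assms(1) degree_add_eq_left[of "- [:w:]" g] by (simp only: diff_conv_add_uminus) simp
  then have "?p \<noteq> 0" using assms(1) degree_0 by (metis less_irrefl)
  moreover have "rsquarefree ?p"
    unfolding rsquarefree_roots using crit \<open>w \<notin> C\<close> by (auto simp: pderiv_diff)
  ultimately have "(\<Sum>z | poly ?p z = 0. order z ?p) = (\<Sum>z | poly ?p z = 0. 1)"
    by (intro sum.cong) (auto dest!: rsquarefree_root_order)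
  then have "card {z. poly ?p z = 0} = degree ?p"
    using sum_order_eq_degree[OF \<open>?p \<noteq> 0\<close>] by simp
  then show ?thesis by (simp add: d)
qed

text \<open>Local inverses exist at the points over \<open>x\<close> because the derivative does not
  vanish there. That their ranges exhaust the preimage is a count: every fibre outside
  \<open>C\<close> has \<open>degree g\<close> points, and each of the \<open>degree g\<close>
  disjoint discs already supplies one. The count takes the place of an argument by
  properness.\<close>

lemma poly_covering_space:
  fixes g :: "complex poly"
  assumes deg: "degree g > 0" and crit: "\<And>z. poly (pderiv g) z = 0 \<Longrightarrow> poly g z \<in> C"
    and "closed C"
  shows "covering_space {z. poly g z \<notin> C} (poly g) (- C)"
proof -
  let ?X = "{z. poly g z \<notin> C}"
  have evenly: "\<exists>T. x \<in> T \<and> openin (top_of_set (- C)) T \<and>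
      (\<exists>v. \<Union>v = ?X \<inter> poly g -` T \<and>
        (\<forall>u\<in>v. openin (top_of_set ?X) u) \<and> pairwise disjnt v \<and>
        (\<forall>u\<in>v. \<exists>q. homeomorphism u T (poly g) q))" if "x \<in> - C" for x
  proof -
    define F where "F = {z. poly g z = x}"
    have cardF: "card F = degree g"
      using card_regular_fibre[OF deg crit, of x] that unfolding F_def by auto
    then have finF: "finite F"
      using deg by (intro card_ge_0_finite) simp
    have "\<exists>r>0. inj_on (poly g) (ball z r)" if "z \<in> F" for z
    proof -
      have "deriv (poly g) z \<noteq> 0"
        using crit[of z] that \<open>x \<in> - C\<close> by (auto simp: DERIV_imp_deriv[OF poly_DERIV] F_def)
      moreover have "poly g holomorphic_on UNIV" by (intro holomorphic_intros)
      ultimately show ?thesis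
        using has_complex_derivative_locally_invertible[of "poly g" UNIV z] by (metis UNIV_I open_UNIV)
    qed
    then obtain r where r: "\<And>z. z \<in> F \<Longrightarrow> r z > 0 \<and> inj_on (poly g) (ball z (r z))"
      by metis
    obtain d where d: "\<And>z. d z > 0" "\<And>y z. y \<in> F \<Longrightarrow> y \<noteq> z \<Longrightarrow> d z \<le> dist z y"
      using finite_set_avoid[OF finF] by metis
    define B where "B z = ball z (min (r z) (d z / 2))" for z
    have inB: "z \<in> B z" if "z \<in> F" for z using r[OF that] d(1)[of z] by (simp add: B_def)
    have inj: "inj_on (poly g) (B z)" if "z \<in> F" for z
      using r[OF that] unfolding B_def by (meson inj_on_subset min.cobounded1 subset_ball)
    have disj: "B z \<inter> B y = {}" if "z \<in> F" "y \<in> F" "z \<noteq> y" for z y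
    proof -
      have "d z / 2 + d y / 2 \<le> dist z y"
        using d(2)[OF that(1), of y] d(2)[OF that(2), of z] that by (simp add: dist_commute)
      then show ?thesis unfolding B_def by (intro disjoint_ballI) auto
    qed
    have opB: "open (poly g ` B z)" if "z \<in> F" for z
      using inj[OF that] unfolding B_def by (intro open_mapping_thm3) (auto intro!: holomorphic_intros)
    \<comment> \<open>A common domain for the finitely many local inverses; \<open>u z\<close> is
      the part of its preimage in the disc around \<open>z\<close>.\<close>
    define T where "T = (\<Inter>z\<in>F. poly g ` B z) - C"
    define u where "u z = B z \<inter> poly g -` T" for z
    have T: "open T" "x \<in> T" "T \<subseteq> - C"
      using opB finF \<open>closed C\<close> \<open>x \<in> - C\<close> inB unfolding T_def F_def by (fastforce intro!: open_Diff)+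
    have opu: "open (u z)" for z
      unfolding u_def B_def by (intro open_Int open_ball open_vimage T continuous_intros)
    have "\<Union>(u ` F) = ?X \<inter> poly g -` T"
    proof (intro equalityI subsetI)
      fix y assume y: "y \<in> ?X \<inter> poly g -` T"
      let ?G = "{z. poly g z = poly g y}"
      have "poly g y \<in> poly g ` B z" if "z \<in> F" for z
        using y that unfolding T_def by blast
      then have "\<forall>z\<in>F. \<exists>p. p \<in> B z \<and> poly g p = poly g y"
        by (metis imageE)
      then obtain p where p: "\<And>z. z \<in> F \<Longrightarrow> p z \<in> B z \<and> poly g (p z) = poly g y" by metis
      have "inj_on p F"
      proof (rule inj_onI, rule ccontr)
        fix a b assume "a \<in> F" "b \<in> F" "p a = p b" "a \<noteq> b"
        then show False using p[of a] p[of b] disj[of a b] by auto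
      qed
      moreover have "card ?G = card F"
        using y cardF card_regular_fibre[OF deg crit, of "poly g y"] by auto
      moreover have "p ` F \<subseteq> ?G" using p by auto
      moreover have "finite ?G" using \<open>card ?G = card F\<close> cardF deg by (intro card_ge_0_finite) simp
      ultimately have "p ` F = ?G" using card_image[of p F] card_subset_eq[of ?G "p ` F"] by simp
      then obtain z where z: "z \<in> F" "y = p z" by blast
      then have "y \<in> u z" using p[OF z(1)] y by (simp add: u_def)
      then show "y \<in> \<Union>(u ` F)" using z(1) by blast
    qed (use T in \<open>auto simp: u_def\<close>)
    moreover have "openin (top_of_set ?X) (u z)" for z
      using T opu[of z] by (intro open_subset) (auto simp: u_def)
    moreover have "pairwise disjnt (u ` F)"
      using disj by (auto simp: pairwise_def disjnt_def u_def)
    moreover have "\<exists>q. homeomorphism (u z) T (poly g) q" if z: "z \<in> F" for z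
    proof -
      obtain q where q: "q holomorphic_on poly g ` B z" "\<And>y. y \<in> B z \<Longrightarrow> q (poly g y) = y"
      proof (rule holomorphic_has_inverse[of "poly g" "B z"])
        show "poly g holomorphic_on B z" by (intro holomorphic_intros)
        show "open (B z)" by (simp add: B_def)
      qed (use inj[OF z] in blast)+
      have TB: "T \<subseteq> poly g ` B z" using z unfolding T_def by blast
      have "homeomorphism (u z) T (poly g) q"
      proof (rule homeomorphismI)
        show "continuous_on T q"
          using q(1) TB continuous_on_subset holomorphic_on_imp_continuous_on by blast
        show "q ` T \<subseteq> u z" using TB q(2) unfolding u_def by fastforce
        show "\<And>y. y \<in> T \<Longrightarrow> poly g (q y) = y" using TB q(2) by fastforce
      qed (use q(2) in \<open>auto simp: u_def intro!: continuous_intros\<close>)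
      then show ?thesis by blast
    qed
    ultimately have "\<exists>v. \<Union>v = ?X \<inter> poly g -` T \<and> (\<forall>u\<in>v. openin (top_of_set ?X) u) \<and>
        pairwise disjnt v \<and> (\<forall>u\<in>v. \<exists>q. homeomorphism u T (poly g) q)"
      by (intro exI[of _ "u ` F"]) simp
    moreover have "openin (top_of_set (- C)) T" using T by (intro open_subset)
    ultimately show ?thesis using T(2) by blast
  qed
  have "poly g ` ?X = - C"
  proof (intro equalityI subsetI)
    fix w assume "w \<in> - C"
    then have "card {z. poly g z = w} \<noteq> 0"
      using card_regular_fibre[OF deg crit, of w] deg by simp
    then obtain z where "poly g z = w" by (metis (mono_tags) card_eq_0_iff empty_Collect_eq)
    then show "w \<in> poly g ` ?X" using \<open>w \<in> - C\<close> by auto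
  qed auto
  then show ?thesis
    unfolding covering_space_def using evenly by (auto intro!: continuous_intros)
qed

text \<open>The other pieces are finitely many relatively closed sets, so each piece is also
  relatively open; a connected clopen set is a component.\<close>

lemma components_finite_partition:
  assumes "finite P" "\<Union>P = A" "pairwise disjnt P"
    and P: "\<And>p. p \<in> P \<Longrightarrow> p \<noteq> {} \<and> connected p \<and> closedin (top_of_set A) p"
  shows "components A = P"
proof -
  have 1: "p \<in> components A" if "p \<in> P" for p
  proof -
    have "p = A - \<Union>(P - {p})"
      using assms(2,3) that by (fastforce simp: pairwise_def disjnt_def)
    moreover have "closedin (top_of_set A) (\<Union>(P - {p}))"
      using assms(1) P by (intro closedin_Union) auto
    ultimately have op: "openin (top_of_set A) p"
      by (metis openin_diff openin_topspace topspace_euclidean_subtopology)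
    have "D = p" if "D \<noteq> {}" "p \<subseteq> D" "D \<subseteq> A" "connected D" for D
    proof -
      have "openin (top_of_set D) p" "closedin (top_of_set D) p"
        using op P[OF \<open>p \<in> P\<close>] that
        by (auto intro: openin_subset_trans closedin_subset_trans)
      then show ?thesis using \<open>connected D\<close> P[OF \<open>p \<in> P\<close>] by (metis connected_clopen)
    qed
    then show ?thesis
      using P[OF that] assms(2) that by (auto simp: in_components_maximal)
  qed
  moreover have "c \<in> P" if c: "c \<in> components A" for c
  proof -
    obtain y where "y \<in> c" "y \<in> A"
      using in_components_nonempty[OF c] in_components_subset[OF c] by blast
    then obtain p where "p \<in> P" "y \<in> p" using assms(2) by blast
    then show ?thesis using 1[of p] c \<open>y \<in> c\<close> components_eq by (metis IntI empty_iff)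
  qed
  ultimately show ?thesis by blast
qed

section \<open>The doubly slit plane and small discs around its tips 0 and 1\<close>

text \<open>The plane cut along two real rays. It is simply connected, so inverse branches of the
  polynomial exist on all of it, and it meets the real axis exactly in the open segment from 0 to 1,
  so each branch carries one edge.\<close>

definition slit :: "complex set" where
  "slit = - (complex_of_real ` ({..0} \<union> {1..}))"

lemma slit_iff: "w \<in> slit \<longleftrightarrow> Im w \<noteq> 0 \<or> 0 < Re w \<and> Re w < 1"
  by (auto simp: slit_def complex_eq_iff image_iff not_le)

lemma open_slit: "open slit"
proof -
  have "closed (complex_of_real ` ({..0} \<union> {1..}))"
    by (intro closed_injective_linear_image closed_Un closed_atMost closed_atLeast)
      (auto simp: linear_of_real inj_of_real)
  then show ?thesis unfolding slit_def by (rule open_Compl)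
qed

lemma simply_connected_slit: "simply_connected slit"
  unfolding slit_def by (intro simply_connected_doubly_slotted_complex_plane) simp

lemma connected_slit: "connected slit"
  using simply_connected_slit simply_connected_imp_connected by blast

lemma open_segment_01_iff:
  "w \<in> open_segment (0::complex) 1 \<longleftrightarrow> Im w = 0 \<and> 0 < Re w \<and> Re w < 1"
  by (auto simp: in_segment complex_eq_iff)

text \<open>The remaining set is star-shaped about the real point \<open>p\<close>: a segment from
  \<open>p\<close> to a nonreal point meets the real axis only in \<open>p\<close>, and a segment
  along the axis that enters the ray does not leave it again.\<close>

lemma connected_convex_minus_ray:
  assumes "convex K" "complex_of_real p \<in> K"
  shows "p > a \<Longrightarrow> connected (K - complex_of_real ` {..a})"
    and "p < a \<Longrightarrow> connected (K - complex_of_real ` {a..})"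
proof -
  have K: "closed_segment (of_real p) w \<subseteq> K" if "w \<in> K" for w
    using assms that convex_contains_segment by blast
  have 1: "connected (K - {w. Im w = 0 \<and> Q (Re w)})"
    if Q: "\<And>r t. Q ((1 - t) * p + t * r) \<Longrightarrow> 0 \<le> t \<Longrightarrow> t \<le> 1 \<Longrightarrow> Q r" and "\<not> Q p" for Q
  proof (rule starlike_imp_connected, unfold starlike_def, intro bexI ballI)
    fix w assume w: "w \<in> K - {w. Im w = 0 \<and> Q (Re w)}"
    show "closed_segment (complex_of_real p) w \<subseteq> K - {w. Im w = 0 \<and> Q (Re w)}"
    proof
      fix y assume y: "y \<in> closed_segment (complex_of_real p) w"
      then obtain t where t: "0 \<le> t" "t \<le> 1" "y = (1 - t) *\<^sub>R complex_of_real p + t *\<^sub>R w"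
        by (auto simp: in_segment)
      have "\<not> (Im y = 0 \<and> Q (Re y))"
      proof
        assume *: "Im y = 0 \<and> Q (Re y)"
        then have "t = 0 \<or> Im w = 0" using t by simp
        moreover have "Q (Re w)" using * t Q[of t "Re w"] by simp
        moreover have "t \<noteq> 0" using * t \<open>\<not> Q p\<close> by auto
        ultimately show False using w by blast
      qed
      then show "y \<in> K - {w. Im w = 0 \<and> Q (Re w)}" using K y w by blast
    qed
  qed (use assms \<open>\<not> Q p\<close> in auto)
  have im: "complex_of_real ` {..a} = {w. Im w = 0 \<and> Re w \<le> a}"
    "complex_of_real ` {a..} = {w. Im w = 0 \<and> Re w \<ge> a}"
    by (auto simp: image_iff complex_eq_iff)
  show "connected (K - complex_of_real ` {..a})" if "p > a"
    unfolding im
  proof (rule 1)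
    fix r t :: real assume *: "(1 - t) * p + t * r \<le> a" "0 \<le> t" "t \<le> 1"
    have "(1 - t) * p + t * r \<ge> (1 - t) * a + t * r" using that * by (intro add_right_mono mult_left_mono) auto
    then have "t * r \<le> t * a" using * by (simp add: algebra_simps)
    then show "r \<le> a" using * that by (cases "t = 0") auto
  qed (use that in auto)
  show "connected (K - complex_of_real ` {a..})" if "p < a"
    unfolding im
  proof (rule 1)
    fix r t :: real assume *: "(1 - t) * p + t * r \<ge> a" "0 \<le> t" "t \<le> 1"
    have "(1 - t) * p + t * r \<le> (1 - t) * a + t * r" using that * by (intro add_right_mono mult_left_mono) auto
    then have "t * r \<ge> t * a" using * by (simp add: algebra_simps)
    then show "r \<ge> a" using * that by (cases "t = 0") auto
  qed (use that in auto)
qed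

text \<open>A disc of radius at most 1 around one tip does not reach the other ray, so a single ray
  is removed from a convex set.\<close>

lemma connected_slit_ball:
  assumes "0 < e" "e \<le> 1"
  shows "connected (slit \<inter> ball 0 e)" "connected (slit \<inter> ball 1 e)"
    and "slit \<inter> ball 0 e \<noteq> {}" "slit \<inter> ball 1 e \<noteq> {}"
proof -
  have "ball 0 e - complex_of_real ` {..0} = slit \<inter> ball 0 e"
  proof -
    show ?thesis
      using assms by (auto simp: slit_def dist_norm image_iff)
  qed
  moreover have "connected (ball 0 e - complex_of_real ` {..0})"
    using assms by (intro connected_convex_minus_ray(1)[of _ "e/2"]) (auto simp: dist_norm)
  ultimately show "connected (slit \<inter> ball 0 e)" by simp
  have "ball 1 e - complex_of_real ` {1..} = slit \<inter> ball 1 e"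
  proof -
    have "0 < x" if "cmod (1 - complex_of_real x) < e" for x
      using that assms complex_Re_le_cmod[of "1 - complex_of_real x"] by simp
    then show ?thesis
      by (fastforce simp: slit_def dist_norm image_iff)
  qed
  moreover have "connected (ball 1 e - complex_of_real ` {1..})"
    using assms by (intro connected_convex_minus_ray(2)[of _ "1-e/2"]) (auto simp: dist_norm cmod_eq_Re)
  ultimately show "connected (slit \<inter> ball 1 e)" by simp
  have "of_real (e/2) \<in> slit \<inter> ball 0 e" "of_real (1-e/2) \<in> slit \<inter> ball 1 e"
    using assms by (auto simp: slit_iff dist_norm cmod_eq_Re)
  then show "slit \<inter> ball 0 e \<noteq> {}" "slit \<inter> ball 1 e \<noteq> {}" by blast+
qed

section \<open>Limits of inverse branches at a boundary value\<close>

text \<open>Outside the \<open>\<delta>\<close>-discs around the fibre the values keep a positive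
  distance from \<open>c\<close>: by compactness within a large disc, by growth at infinity beyond
  it.\<close>

lemma poly_preimage_near_fibre:
  fixes g :: "complex poly"
  assumes "degree g > 0" "\<delta> > 0"
  shows "\<exists>\<epsilon>>0. \<forall>y. dist c (poly g y) < \<epsilon> \<longrightarrow> (\<exists>v. poly g v = c \<and> dist v y < \<delta>)"
proof -
  let ?N = "\<Union>v\<in>{v. poly g v = c}. ball v \<delta>"
  have "filterlim (poly g) at_infinity at_infinity"
    using assms(1) by (rule filterlim_poly_at_infinity)
  then have "eventually (\<lambda>y. cmod (poly g y) \<ge> cmod c + 1) at_infinity"
    using filterlim_at_infinity[of 0 "poly g"] zero_less_one
    by (metis add_nonneg_pos norm_ge_zero order_refl)
  then obtain M where M: "\<And>y. cmod y \<ge> M \<Longrightarrow> cmod (poly g y) \<ge> cmod c + 1"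
    by (auto simp: eventually_at_infinity)
  have "compact (cball 0 M - ?N)" by (intro compact_diff compact_cball) auto
  then have "compact (poly g ` (cball 0 M - ?N))"
    by (intro compact_continuous_image continuous_intros)
  moreover have "c \<notin> poly g ` (cball 0 M - ?N)" using assms(2) by auto
  ultimately obtain d where d: "d > 0" "\<And>w. w \<in> poly g ` (cball 0 M - ?N) \<Longrightarrow> d \<le> dist c w"
    using separate_point_closed[OF compact_imp_closed] by metis
  have "\<exists>v. poly g v = c \<and> dist v y < \<delta>" if "dist c (poly g y) < min d 1" for y
  proof -
    have "cmod (poly g y) < cmod c + 1"
      using that norm_triangle_ineq2[of "poly g y" c] by (simp add: dist_norm norm_minus_commute)
    then have "y \<in> cball 0 M" using M[of y] by force
    moreover have "poly g y \<notin> poly g ` (cball 0 M - ?N)" using d(2)[of "poly g y"] that by force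
    ultimately show ?thesis by (auto simp: image_iff)
  qed
  then show ?thesis using d(1) by (intro exI[of _ "min d 1"]) auto
qed

text \<open>Near \<open>c\<close> the values of \<open>l\<close> lie in small disjoint discs around
  the finitely many points over \<open>c\<close>. The part of \<open>D\<close> near \<open>c\<close>
  is connected, so these values cannot pass from one disc to another; they single out one point
  \<open>v\<close>, and shrinking the discs gives convergence to it.\<close>

lemma lift_has_limit:
  fixes g :: "complex poly"
  assumes deg: "degree g > 0" and cont: "continuous_on D l"
    and lift: "\<And>w. w \<in> D \<Longrightarrow> poly g (l w) = w"
    and conn: "\<And>e. 0 < e \<Longrightarrow> e \<le> 1 \<Longrightarrow> connected (D \<inter> ball c e)"
    and ne: "\<And>e. 0 < e \<Longrightarrow> e \<le> 1 \<Longrightarrow> D \<inter> ball c e \<noteq> {}"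
  shows "\<exists>v. poly g v = c \<and> (l \<longlongrightarrow> v) (at c within D)"
proof -
  define V where "V = {v. poly g v = c}"
  have "g - [:c:] \<noteq> 0" using deg by (metis degree_pCons_0 eq_iff_diff_eq_0 less_irrefl)
  then have finV: "finite V"
    using poly_roots_finite[of "g - [:c:]"] unfolding V_def by simp
  obtain d where d: "d > 0" "\<And>y z. y \<in> V \<Longrightarrow> z \<in> V \<Longrightarrow> y \<noteq> z \<Longrightarrow> d \<le> dist y z"
  proof -
    have "uniform_discrete V" using finV uniform_discrete_finite_iff by blast
    then show ?thesis using that unfolding uniform_discrete_def by (metis linorder_not_le)
  qed
  have disj: "ball y (d/2) \<inter> ball z (d/2) = {}" if "y \<in> V" "z \<in> V" "y \<noteq> z" for y z
    using d(2)[OF that] by (intro disjoint_ballI) auto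
  have ex: "\<exists>\<epsilon>. 0 < \<epsilon> \<and> \<epsilon> \<le> 1 \<and> (\<forall>y. dist c (poly g y) < \<epsilon> \<longrightarrow> (\<exists>v\<in>V. y \<in> ball v \<delta>))"
    if \<delta>: "\<delta> > 0" for \<delta>
  proof -
    obtain \<epsilon> where "\<epsilon> > 0" "\<forall>y. dist c (poly g y) < \<epsilon> \<longrightarrow> (\<exists>v. poly g v = c \<and> dist v y < \<delta>)"
      using poly_preimage_near_fibre[OF deg \<delta>, of c] by blast
    then show ?thesis by (intro exI[of _ "min \<epsilon> 1"]) (auto simp: V_def)
  qed
  obtain \<epsilon> where \<epsilon>: "0 < \<epsilon>" "\<epsilon> \<le> 1" "\<And>y. dist c (poly g y) < \<epsilon> \<Longrightarrow> \<exists>v\<in>V. y \<in> ball v (d/2)"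
    using ex[of "d/2"] d(1) by auto
  let ?S = "l ` (D \<inter> ball c \<epsilon>)"
  have S: "connected ?S" "?S \<noteq> {}"
    using conn[OF \<epsilon>(1,2)] ne[OF \<epsilon>(1,2)] cont
    by (auto intro!: connected_continuous_image intro: continuous_on_subset)
  have Sub: "\<exists>v\<in>V. y \<in> ball v (d/2)" if "y \<in> ?S" for y
    using that \<epsilon>(3)[of y] lift by auto
  then obtain v y0 where v: "v \<in> V" "y0 \<in> ?S" "y0 \<in> ball v (d/2)" using S(2) by blast
  have inv: "?S \<subseteq> ball v (d/2)"
  proof (rule ccontr)
    assume "\<not> ?S \<subseteq> ball v (d/2)"
    then have "(\<Union>u\<in>V - {v}. ball u (d/2)) \<inter> ?S \<noteq> {}" using Sub by fastforce
    moreover have "ball v (d/2) \<inter> ?S \<noteq> {}" using v by blast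
    moreover have "ball v (d/2) \<inter> (\<Union>u\<in>V - {v}. ball u (d/2)) = {}" using disj v(1) by blast
    moreover have "?S \<subseteq> ball v (d/2) \<union> (\<Union>u\<in>V - {v}. ball u (d/2))" using Sub by blast
    ultimately show False
      using S(1) connectedD[of ?S "ball v (d/2)" "\<Union>u\<in>V - {v}. ball u (d/2)"] by auto
  qed
  have "(l \<longlongrightarrow> v) (at c within D)"
    unfolding tendsto_iff eventually_at
  proof (intro allI impI)
    fix \<delta> :: real assume "\<delta> > 0"
    then obtain \<epsilon>' where \<epsilon>': "0 < \<epsilon>'" "\<And>y. dist c (poly g y) < \<epsilon>' \<Longrightarrow> \<exists>v\<in>V. y \<in> ball v (min \<delta> (d/2))"
      using ex[of "min \<delta> (d/2)"] d(1) by auto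
    have "dist (l w) v < \<delta>" if "w \<in> D" "dist w c < min \<epsilon> \<epsilon>'" for w
    proof -
      obtain u where u: "u \<in> V" "l w \<in> ball u (min \<delta> (d/2))"
        using \<epsilon>'(2)[of "l w"] lift[of w] \<open>w \<in> D\<close> \<open>dist w c < min \<epsilon> \<epsilon>'\<close>
        by (auto simp: dist_commute)
      have "w \<in> D \<inter> ball c \<epsilon>" using that by (simp add: dist_commute)
      then have "l w \<in> ball v (d/2)" using inv by blast
      then have "ball u (d/2) \<inter> ball v (d/2) \<noteq> {}" using u(2) by auto
      then have "u = v" using disj[OF u(1) v(1)] by blast
      then show ?thesis using u(2) by (simp add: dist_commute)
    qed
    then show "\<exists>d>0. \<forall>x\<in>D. x \<noteq> c \<and> dist x c < d \<longrightarrow> dist (l x) v < \<delta>"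
      using \<epsilon>(1) \<epsilon>'(1) by (intro exI[of _ "min \<epsilon> \<epsilon>'"]) auto
  qed
  then show ?thesis using v(1) V_def by blast
qed

section \<open>Sheets over the slit plane and the edges they carry\<close>

text \<open>An affine change of the values brings every Shabat polynomial to this form and keeps
  edges and multiplicities, so the analysis is carried out once, for the values 0 and 1.\<close>

locale belyi_poly =
  fixes g :: "complex poly"
  assumes deg: "degree g > 0"
    and crit: "poly (pderiv g) z = 0 \<Longrightarrow> poly g z \<in> {0, 1}"
begin

lemma covering: "covering_space {z. poly g z \<notin> {0, 1}} (poly g) (- {0, 1})"
  by (intro poly_covering_space deg crit) auto

lemma lift_exists:
  assumes "open D" "simply_connected D" "D \<subseteq> - {0, 1}" "poly g z \<in> D"
  obtains l where "continuous_on D l" "\<And>w. w \<in> D \<Longrightarrow> poly g (l w) = w" "l (poly g z) = z"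
proof -
  have "z \<in> {z. poly g z \<notin> {0, 1}}" using assms by auto
  then obtain l where "continuous_on D l" "l (poly g z) = z" "\<And>w. w \<in> D \<Longrightarrow> poly g (l w) = id w"
    using covering_space_lift_strong[OF covering, of z "poly g z" D id] assms
      open_imp_locally_path_connected[OF \<open>open D\<close>] by (auto simp: Pi_def subset_iff)
  then show ?thesis using that by simp
qed

lemma lift_unique:
  assumes "connected D" "D \<subseteq> - {0, 1}" "continuous_on D f"
    and "continuous_on D l" "\<And>w. w \<in> D \<Longrightarrow> poly g (l w) = w"
    and "continuous_on D l'" "\<And>w. w \<in> D \<Longrightarrow> poly g (l' w) = w"
    and "a \<in> D" "l a = l' a" "w \<in> D"
  shows "l w = l' w"
  by (rule covering_space_lift_unique[OF covering, where f = id and T = D and a = a])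
    (use assms in \<open>auto simp: subset_iff\<close>)

text \<open>The base point 1/2 lies on the segment, so every sheet and every edge contains exactly
  one of these points, which serves as its index.\<close>

definition fibre :: "complex set" where
  "fibre = {z. poly g z = 1/2}"

lemma card_fibre: "card fibre = degree g" "finite fibre"
proof -
  show "card fibre = degree g"
    unfolding fibre_def using card_regular_fibre[OF deg crit, of "1/2"] by simp
  then show "finite fibre" using deg by (intro card_ge_0_finite) simp
qed

text \<open>The inverse branch of \<open>g\<close> through \<open>z\<close>. Lifts that agree at one
  point of \<open>slit\<close> agree on all of it, so the choice is determined there.\<close>

definition sheet :: "complex \<Rightarrow> complex \<Rightarrow> complex" where
  "sheet z = (SOME l. continuous_on slit l \<and> (\<forall>w\<in>slit. poly g (l w) = w) \<and> l (1/2) = z)"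

lemma slit_simps: "slit \<subseteq> - {0, 1}" "1/2 \<in> slit" "open_segment 0 1 \<subseteq> slit"
  by (auto simp: slit_iff open_segment_01_iff)

lemma sheet:
  assumes "z \<in> fibre"
  shows "continuous_on slit (sheet z)" "w \<in> slit \<Longrightarrow> poly g (sheet z w) = w" "sheet z (1/2) = z"
proof -
  have z: "poly g z = 1/2" using assms by (simp add: fibre_def)
  obtain l where "continuous_on slit l" "\<And>w. w \<in> slit \<Longrightarrow> poly g (l w) = w" "l (poly g z) = z"
    using lift_exists[OF open_slit simply_connected_slit slit_simps(1), of z] z slit_simps(2)
    by metis
  then have "\<exists>l. continuous_on slit l \<and> (\<forall>w\<in>slit. poly g (l w) = w) \<and> l (1/2) = z"
    using z by (intro exI[of _ l]) auto
  from someI_ex[OF this, folded sheet_def]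
  show "continuous_on slit (sheet z)" "w \<in> slit \<Longrightarrow> poly g (sheet z w) = w" "sheet z (1/2) = z"
    by auto
qed

lemma sheet_eqD:
  assumes "z \<in> fibre" "z' \<in> fibre" "w \<in> slit" "sheet z w = sheet z' w"
  shows "z = z'"
  using lift_unique[OF connected_slit slit_simps(1) continuous_on_id, of "sheet z" "sheet z'" w "1/2"]
    sheet assms slit_simps(2) by metis

lemma sheet_cover:
  assumes "poly g y \<in> slit"
  shows "\<exists>z\<in>fibre. y = sheet z (poly g y)"
proof -
  obtain l where l: "continuous_on slit l" "\<And>w. w \<in> slit \<Longrightarrow> poly g (l w) = w" "l (poly g y) = y"
    using lift_exists[OF open_slit simply_connected_slit slit_simps(1) assms] by metis
  have z: "l (1/2) \<in> fibre" using l(2)[OF slit_simps(2)] by (simp add: fibre_def)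
  have "l (poly g y) = sheet (l (1/2)) (poly g y)"
    by (rule lift_unique[OF connected_slit slit_simps(1) continuous_on_id, where a = "1/2"])
      (use l sheet[OF z] slit_simps assms in auto)
  then show ?thesis using z l(3) by metis
qed

lemma lift_eq_sheet:
  assumes "D \<subseteq> slit" "connected D" "D \<noteq> {}" "continuous_on D l" "\<And>w. w \<in> D \<Longrightarrow> poly g (l w) = w"
  shows "\<exists>z\<in>fibre. \<forall>w\<in>D. l w = sheet z w"
proof -
  obtain a where a: "a \<in> D" using assms by blast
  then obtain z where z: "z \<in> fibre" "l a = sheet z a"
    using sheet_cover[of "l a"] assms by auto
  have "l w = sheet z w" if "w \<in> D" for w
    by (rule lift_unique[OF \<open>connected D\<close> _ continuous_on_id, where a = a])
      (use assms a z that slit_simps sheet[OF z(1)] in \<open>auto intro: continuous_on_subset\<close>)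
  then show ?thesis using z(1) by blast
qed

definition edge :: "complex \<Rightarrow> complex set" where
  "edge z = sheet z ` open_segment 0 1"

lemma edge_eq:
  assumes "z \<in> fibre"
  shows "edge z = {y. poly g y \<in> open_segment 0 1 \<and> sheet z (poly g y) = y}"
  using sheet(2)[OF assms] slit_simps(3) unfolding edge_def by (force simp: subset_iff)

lemma edge_disjoint: "z \<in> fibre \<Longrightarrow> z' \<in> fibre \<Longrightarrow> y \<in> edge z \<Longrightarrow> y \<in> edge z' \<Longrightarrow> z = z'"
  using sheet_eqD[of z z' "poly g y"] slit_simps(3) by (auto simp: edge_eq)

lemma fibre_in_edge: "z \<in> fibre \<Longrightarrow> z \<in> edge z"
proof -
  assume z: "z \<in> fibre"
  then have "poly g z = 1/2" by (simp add: fibre_def)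
  then have "poly g z \<in> open_segment 0 1" "sheet z (poly g z) = z"
    using sheet(3)[OF z] by (simp_all only: open_segment_01_iff) simp_all
  then show "z \<in> edge z" using z by (simp add: edge_eq)
qed

lemma inj_on_edge: "inj_on edge fibre"
  using edge_disjoint fibre_in_edge by (metis inj_onI)

text \<open>Inside the preimage of the segment, the edge through \<open>z\<close> is the zero set of
  \<open>sheet z (g y) - y\<close>. This makes it relatively closed, so the finitely many edges are
  the components.\<close>

lemma shabat_edges_eq: "shabat_edges g 0 1 = edge ` fibre"
  unfolding shabat_edges_def
proof (rule components_finite_partition)
  let ?A = "{z. poly g z \<in> open_segment 0 1}"
  show "finite (edge ` fibre)" using card_fibre by simp
  show "\<Union> (edge ` fibre) = ?A"
    using sheet_cover slit_simps(3) by (auto simp: edge_eq) (metis subsetD)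
  show "pairwise disjnt (edge ` fibre)"
    using edge_disjoint by (auto simp: pairwise_def disjnt_def)
  fix p assume "p \<in> edge ` fibre"
  then obtain z where z: "z \<in> fibre" "p = edge z" by blast
  have "connected p"
    unfolding z edge_def using sheet(1)[OF z(1)] slit_simps(3)
    by (intro connected_continuous_image) (auto intro: continuous_on_subset convex_connected)
  moreover have "closedin (top_of_set ?A) p"
  proof -
    have "continuous_on ?A (\<lambda>y. sheet z (poly g y) - y)"
      using slit_simps(3)
      by (intro continuous_intros continuous_on_compose2[OF sheet(1)[OF z(1)]]) auto
    then have "closedin (top_of_set ?A) {y \<in> ?A. sheet z (poly g y) - y = 0}"
      by (rule continuous_closedin_preimage_constant)
    moreover have "{y \<in> ?A. sheet z (poly g y) - y = 0} = p" using z by (auto simp: edge_eq)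
    ultimately show ?thesis by simp
  qed
  ultimately show "p \<noteq> {} \<and> connected p \<and> closedin (top_of_set ?A) p"
    using fibre_in_edge z by blast
qed

lemma card_shabat_edges: "card (shabat_edges g 0 1) = degree g"
  by (simp add: shabat_edges_eq card_image[OF inj_on_edge] card_fibre)

lemma sheet_limit_ex:
  assumes "z \<in> fibre"
  shows "\<exists>v. poly g v = 0 \<and> (sheet z \<longlongrightarrow> v) (at 0 within slit)"
    and "\<exists>v. poly g v = 1 \<and> (sheet z \<longlongrightarrow> v) (at 1 within slit)"
  using lift_has_limit[OF deg sheet(1,2)[OF assms], of 0] lift_has_limit[OF deg sheet(1,2)[OF assms], of 1]
    connected_slit_ball by auto

lemma at_within_segment_nontrivial: "at 0 within open_segment (0::complex) 1 \<noteq> bot"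
    "at 1 within open_segment (0::complex) 1 \<noteq> bot"
proof -
  have "open_segment (0::complex) 1 - {0} = open_segment 0 1" "open_segment (0::complex) 1 - {1} = open_segment 0 1"
    by (auto simp: open_segment_def)
  then show "at 0 within open_segment (0::complex) 1 \<noteq> bot" "at 1 within open_segment (0::complex) 1 \<noteq> bot"
    by (simp_all add: trivial_limit_within islimpt_in_closure)
qed

text \<open>The limit is taken within all of \<open>slit\<close>, not only along the segment: sheets
  that are glued across a cut are compared by approaching the tip from a half plane.\<close>

definition black_of :: "complex \<Rightarrow> complex" where
  "black_of z = Lim (at 0 within slit) (sheet z)"

definition white_of :: "complex \<Rightarrow> complex" where
  "white_of z = Lim (at 1 within slit) (sheet z)"

lemma at_within_slit_nontrivial: "at (0::complex) within slit \<noteq> bot" "at (1::complex) within slit \<noteq> bot"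
  using at_within_segment_nontrivial at_le[OF slit_simps(3)] by (metis bot.extremum_uniqueI)+

lemma black_of:
  assumes "z \<in> fibre"
  shows "poly g (black_of z) = 0" "(sheet z \<longlongrightarrow> black_of z) (at 0 within slit)"
  using sheet_limit_ex(1)[OF assms] tendsto_Lim[OF at_within_slit_nontrivial(1)]
  unfolding black_of_def by metis+

lemma white_of:
  assumes "z \<in> fibre"
  shows "poly g (white_of z) = 1" "(sheet z \<longlongrightarrow> white_of z) (at 1 within slit)"
  using sheet_limit_ex(2)[OF assms] tendsto_Lim[OF at_within_slit_nontrivial(2)]
  unfolding white_of_def by metis+

text \<open>A sequence on the edge that tends to \<open>v\<close> has values of \<open>g\<close>
  tending to 0 or 1, and \<open>sheet z\<close> maps these values back to the sequence; so its limit
  is the limit of the sheet.\<close>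

lemma closure_edge_iff:
  assumes z: "z \<in> fibre"
  shows "poly g v = 0 \<Longrightarrow> v \<in> closure (edge z) \<longleftrightarrow> v = black_of z"
    and "poly g v = 1 \<Longrightarrow> v \<in> closure (edge z) \<longleftrightarrow> v = white_of z"
proof -
  have *: "v \<in> closure (edge z) \<longleftrightarrow> v = u"
    if lim: "(sheet z \<longlongrightarrow> u) (at c within slit)" and v: "poly g v = c"
      and c: "at c within open_segment 0 1 \<noteq> bot" "c \<notin> slit" for u c
  proof
    have lim': "(sheet z \<longlongrightarrow> u) (at c within open_segment 0 1)"
      using lim slit_simps(3) by (rule tendsto_within_subset)
    show "v \<in> closure (edge z)" if "v = u"
    proof -
      have "eventually (\<lambda>w. sheet z w \<in> closure (edge z)) (at c within open_segment 0 1)"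
        unfolding edge_def eventually_at_filter
        by (rule always_eventually) (use closure_subset in fastforce)
      then show ?thesis
        using Lim_in_closed_set[OF closed_closure _ c(1) lim'] that by blast
    qed
    assume "v \<in> closure (edge z)"
    then obtain y where y: "\<And>n. y n \<in> edge z" "y \<longlonglongrightarrow> v" unfolding closure_sequential by blast
    have gy: "(\<lambda>n. poly g (y n)) \<longlonglongrightarrow> c" using tendsto_poly[OF y(2), of g] v by simp
    have "filterlim (\<lambda>n. poly g (y n)) (at c within slit) sequentially"
      using gy y(1) z slit_simps(3) c(2) unfolding filterlim_at
      by (auto simp: edge_eq intro!: always_eventually)
    then have "(\<lambda>n. sheet z (poly g (y n))) \<longlonglongrightarrow> u"
      using lim filterlim_compose by blast
    moreover have "sheet z (poly g (y n)) = y n" for n using y(1) z by (auto simp: edge_eq)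
    ultimately show "v = u" using y(2) LIMSEQ_unique by simp
  qed
  have "0 \<notin> slit" "1 \<notin> slit" using slit_simps(1) by auto
  then show "poly g v = 0 \<Longrightarrow> v \<in> closure (edge z) \<longleftrightarrow> v = black_of z"
    and "poly g v = 1 \<Longrightarrow> v \<in> closure (edge z) \<longleftrightarrow> v = white_of z"
    using *[OF black_of(2)[OF z]] *[OF white_of(2)[OF z]] at_within_segment_nontrivial by blast+
qed

end

section \<open>Local form of a polynomial at a root, and the star of edges there\<close>

text \<open>Write \<open>p = (w - v)^m k\<close> with \<open>k\<close> nonzero at \<open>v\<close>.
  An \<open>m\<close>-th root \<open>h\<close> of \<open>k\<close> near \<open>v\<close> gives the
  coordinate \<open>\<phi> w = (w - v) h w\<close> whose \<open>m\<close>-th power is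
  \<open>p\<close>, and \<open>\<psi>\<close> is its inverse. The derivative \<open>a\<close> is
  recorded because its argument fixes the directions of the edges.\<close>

lemma poly_local_root:
  fixes p :: "complex poly"
  assumes "p \<noteq> 0" "poly p v = 0"
  defines "m \<equiv> order v p"
  obtains r \<psi> a where "r > 0" "continuous_on (ball 0 r) \<psi>" "inj_on \<psi> (ball 0 r)" "\<psi> 0 = v"
    "\<And>y. y \<in> ball 0 r \<Longrightarrow> poly p (\<psi> y) = y ^ m"
    "(\<psi> has_field_derivative a) (at 0)" "a \<noteq> 0"
proof -
  have m: "m > 0" using assms by (simp add: m_def order_gt_0_iff)
  obtain k where k: "p = [:-v, 1:] ^ m * k" "\<not> [:-v, 1:] dvd k"
    using order_decomp[OF \<open>p \<noteq> 0\<close>, of v] unfolding m_def by blast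
  then have kv: "poly k v \<noteq> 0" by (simp add: poly_eq_0_iff_dvd)
  have "isCont (poly k) v" by simp
  then obtain \<rho> where \<rho>: "\<rho> > 0" "\<And>w. dist w v < \<rho> \<Longrightarrow> dist (poly k w) (poly k v) < cmod (poly k v)"
    using kv unfolding continuous_at_eps_delta by (metis zero_less_norm_iff)
  \<comment> \<open>Near \<open>v\<close> the ratio lies within distance 1 of 1, hence in the right
    half plane, clear of the branch cut of \<open>Ln\<close>.\<close>
  have nonneg: "poly k w / poly k v \<notin> \<real>\<^sub>\<le>\<^sub>0" if "w \<in> ball v \<rho>" for w
  proof -
    have "cmod (poly k w / poly k v - 1) = dist (poly k w) (poly k v) / cmod (poly k v)"
      using kv by (simp add: dist_norm divide_simps flip: norm_divide)
    also have "\<dots> < 1" using \<rho>(2)[of w] that kv by (simp add: dist_commute)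
    finally have "cmod (1 - poly k w / poly k v) < 1" by (simp add: norm_minus_commute)
    then have "Re (poly k w / poly k v) > 0"
      using complex_Re_le_cmod[of "1 - poly k w / poly k v"] by simp
    then show ?thesis by (auto simp: complex_nonpos_Reals_iff)
  qed
  \<comment> \<open>The root of the constant \<open>poly k v\<close> is split off, since that value
    itself may lie on the branch cut.\<close>
  define h where "h w = exp (Ln (poly k v) / of_nat m) * exp (Ln (poly k w / poly k v) / of_nat m)" for w
  have hol: "h holomorphic_on ball v \<rho>"
    unfolding h_def using kv m nonneg by (intro holomorphic_intros) auto
  have hm: "h w ^ m = poly k w" if "w \<in> ball v \<rho>" for w
  proof -
    have "poly k w \<noteq> 0" using nonneg[OF that] by auto
    then show ?thesis
      using m kv unfolding h_def power_mult_distrib exp_of_nat_mult[symmetric] by simp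
  qed
  define \<phi> where "\<phi> w = (w - v) * h w" for w
  have \<phi>hol: "\<phi> holomorphic_on ball v \<rho>"
    unfolding \<phi>_def by (intro holomorphic_intros hol)
  have \<phi>m: "\<phi> w ^ m = poly p w" if "w \<in> ball v \<rho>" for w
    using hm[OF that] unfolding \<phi>_def by (subst k) (simp add: power_mult_distrib poly_power)
  have "(h has_field_derivative deriv h v) (at v)"
    using hol \<rho>(1) holomorphic_derivI by (metis centre_in_ball open_ball)
  then have "(\<phi> has_field_derivative h v) (at v)"
    unfolding \<phi>_def by (auto intro!: derivative_eq_intros)
  moreover have "h v \<noteq> 0" by (simp add: h_def)
  ultimately have "deriv \<phi> v \<noteq> 0" by (simp add: DERIV_imp_deriv)
  then obtain r1 where r1: "r1 > 0" "ball v r1 \<subseteq> ball v \<rho>" "open (\<phi> ` ball v r1)" "inj_on \<phi> (ball v r1)"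
    using has_complex_derivative_locally_invertible[OF \<phi>hol] \<rho>(1) by (metis centre_in_ball open_ball)
  obtain q where q: "q holomorphic_on \<phi> ` ball v r1" "\<And>z. z \<in> ball v r1 \<Longrightarrow> deriv \<phi> z * deriv q (\<phi> z) = 1"
    "\<And>z. z \<in> ball v r1 \<Longrightarrow> q (\<phi> z) = z"
    using holomorphic_has_inverse[OF holomorphic_on_subset[OF \<phi>hol r1(2)] open_ball r1(4)] by metis
  have \<phi>v: "\<phi> v = 0" by (simp add: \<phi>_def)
  have vin: "v \<in> ball v r1" using r1(1) by simp
  then obtain r where r: "r > 0" "ball 0 r \<subseteq> \<phi> ` ball v r1"
    using r1(3) \<phi>v by (metis imageI open_contains_ball)
  show thesis
  proof (rule that[of r q "deriv q 0"])
    show "continuous_on (ball 0 r) q"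
      using q(1) r(2) by (meson continuous_on_subset holomorphic_on_imp_continuous_on)
    show "inj_on q (ball 0 r)"
    proof (rule inj_onI)
      fix x y assume xy: "x \<in> ball 0 r" "y \<in> ball 0 r" "q x = q y"
      then obtain x' y' where "x = \<phi> x'" "y = \<phi> y'" "x' \<in> ball v r1" "y' \<in> ball v r1"
        using r(2) by blast
      then show "x = y" using q(3) xy(3) by auto
    qed
    show "q 0 = v" using q(3)[OF vin] \<phi>v by simp
    show "deriv q 0 \<noteq> 0" using q(2)[OF vin] \<phi>v by auto
    have "0 \<in> \<phi> ` ball v r1" using r by auto
    then show "(q has_field_derivative deriv q 0) (at 0)"
      using q(1) r1(3) holomorphic_derivI by blast
    show "poly p (q y) = y ^ m" if "y \<in> ball 0 r" for y
    proof -
      obtain y' where "y = \<phi> y'" "y' \<in> ball v r1" using r(2) \<open>y \<in> ball 0 r\<close> by blast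
      then show ?thesis using q(3)[of y'] \<phi>m[of y'] r1(2) by auto
    qed
  qed (use r in auto)
qed

definition root_of_unity :: "nat \<Rightarrow> nat \<Rightarrow> complex" where
  "root_of_unity m j = cis (2 * pi * j / m)"

lemma root_of_unity_power: "m > 0 \<Longrightarrow> root_of_unity m j ^ m = 1"
proof -
  assume "m > 0"
  then have "root_of_unity m j ^ m = cis (2 * pi * j)"
    by (simp add: root_of_unity_def Complex.DeMoivre)
  also have "\<dots> = 1" using cis_multiple_2pi[of "real j"] by simp
  finally show ?thesis .
qed

lemma Arg2pi_cis: "0 \<le> t \<Longrightarrow> t < 2 * pi \<Longrightarrow> Arg2pi (cis t) = t"
  using Arg2pi_unique[of 1 t "cis t"] by (simp add: cis_conv_exp)

lemma root_of_unity_mod: "m > 0 \<Longrightarrow> root_of_unity m (j mod m) = root_of_unity m j"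
proof -
  assume "m > 0"
  have "root_of_unity m j = cis (2 * pi * (j mod m) / m + 2 * pi * (j div m))"
  proof -
    have "real j = real (m * (j div m) + j mod m)" by simp
    then have "2 * pi * j / m = 2 * pi * (j mod m) / m + 2 * pi * (j div m)"
      using \<open>m > 0\<close> by (simp only: of_nat_add of_nat_mult) (simp add: field_simps)
    then show ?thesis by (simp add: root_of_unity_def)
  qed
  also have "\<dots> = root_of_unity m (j mod m)"
    using cis_multiple_2pi[of "real (j div m)"] by (simp add: root_of_unity_def flip: cis_mult)
  finally show ?thesis by simp
qed

lemma inj_on_root_of_unity: "inj_on (root_of_unity m) {..<m}"
proof (rule inj_onI)
  fix i j assume ij: "i \<in> {..<m}" "j \<in> {..<m}" "root_of_unity m i = root_of_unity m j"
  have "Arg2pi (root_of_unity m k) = 2 * pi * k / m" if "k < m" for k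
    unfolding root_of_unity_def using that by (intro Arg2pi_cis) (simp_all add: divide_simps)
  then have "2 * pi * i / m = 2 * pi * j / m" using ij by (metis lessThan_iff)
  then show "i = j" using ij by simp
qed

text \<open>The edge \<open>i\<close> places after \<open>e j\<close> is reached by the angle
  \<open>2 * pi * i / m\<close>, for \<open>i\<close> from 1 to \<open>m\<close>. The value
  \<open>i = m\<close> is \<open>e j\<close> itself, to which \<open>turn\<close> assigns a full
  turn, so the minimum is at \<open>i = 1\<close> even when the vertex has degree 1.\<close>

lemma arg_min_turn:
  assumes inj: "inj_on e {..<m}" and u: "u \<noteq> 0"
    and dir: "\<And>j. j < m \<Longrightarrow> direction v (e j) = u * root_of_unity m j"
    and j: "j < m"
  shows "arg_min_on (turn v (e j)) (e ` {..<m}) = e (Suc j mod m)"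
proof -
  have m: "m > 0" using j by simp
  have t: "turn v (e j) (e ((j + i) mod m)) = 2 * pi * i / m" if "1 \<le> i" "i \<le> m" for i
  proof (cases "i = m")
    case True
    then show ?thesis using j m by (simp add: turn_def)
  next
    case False
    then have i: "i < m" using that by simp
    have ne: "(j + i) mod m \<noteq> j"
    proof
      assume *: "(j + i) mod m = j"
      show False
      proof (cases "j + i < m")
        case False
        then have "(j + i) mod m = j + i - m" using i j by (simp add: le_mod_geq)
        then show False using * i False by simp
      qed (use * that in simp)
    qed
    then have "e ((j + i) mod m) \<noteq> e j"
      using inj j m by (metis inj_on_eq_iff lessThan_iff mod_less_divisor)
    then have "turn v (e j) (e ((j + i) mod m)) = Arg2pi (root_of_unity m (j + i) / root_of_unity m j)"
      using u m j dir by (simp add: turn_def root_of_unity_mod)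
    also have "root_of_unity m (j + i) / root_of_unity m j = cis (2 * pi * i / m)"
      by (simp add: root_of_unity_def cis_divide distrib_left add_divide_distrib)
    also have "Arg2pi \<dots> = 2 * pi * i / m"
      using i by (intro Arg2pi_cis) (simp_all add: divide_simps)
    finally show ?thesis .
  qed
  have ex: "\<exists>i. 1 \<le> i \<and> i \<le> m \<and> k = (j + i) mod m" if "k < m" for k
  proof (cases "j < k")
    case True
    then show ?thesis using that by (intro exI[of _ "k - j"]) (simp, arith)
  next
    case False
    then show ?thesis using that j by (intro exI[of _ "k + m - j"]) (simp, arith)
  qed
  let ?t = "turn v (e j)" and ?E = "e ` {..<m}"
  have next_in: "e (Suc j mod m) \<in> ?E" using m by simp
  have t1: "?t (e (Suc j mod m)) = 2 * pi / m" using t[of 1] m by simp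
  have le: "2 * pi / m \<le> ?t y \<and> (?t y = 2 * pi / m \<longrightarrow> y = e (Suc j mod m))" if "y \<in> ?E" for y
  proof -
    obtain k where "k < m" and yk: "y = e k" using \<open>y \<in> ?E\<close> by blast
    obtain i where i: "1 \<le> i" "i \<le> m" "k = (j + i) mod m" using ex[OF \<open>k < m\<close>] by blast
    have ty: "?t y = 2 * pi * i / m" unfolding yk i(3) by (rule t[OF i(1,2)])
    have "2 * pi * 1 / m \<le> 2 * pi * i / m"
      using i(1) by (intro divide_right_mono mult_left_mono) auto
    moreover have "y = e (Suc j mod m)" if "2 * pi * i / m = 2 * pi / m"
    proof -
      have "i = 1" using that m by (simp add: field_simps)
      then show ?thesis unfolding yk i(3) by simp
    qed
    ultimately show ?thesis unfolding ty by simp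
  qed
  \<comment> \<open>\<open>arg_min_on\<close> chooses among all minimal edges, so uniqueness of the
    minimum is what determines its value.\<close>
  have iff: "is_arg_min ?t (\<lambda>x. x \<in> ?E) x \<longleftrightarrow> x = e (Suc j mod m)" for x
  proof
    assume "is_arg_min ?t (\<lambda>x. x \<in> ?E) x"
    then have x: "x \<in> ?E" "\<not> ?t (e (Suc j mod m)) < ?t x"
      using next_in unfolding is_arg_min_def by blast+
    then have "?t x = 2 * pi / m" using le[OF x(1)] t1 by linarith
    then show "x = e (Suc j mod m)" using le[OF x(1)] by blast
  next
    assume x: "x = e (Suc j mod m)"
    show "is_arg_min ?t (\<lambda>x. x \<in> ?E) x"
      unfolding is_arg_min_def x t1 using next_in le by (meson linorder_not_le)
  qed
  show ?thesis unfolding arg_min_on_def arg_min_def iff by simp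
qed

lemma cyclic_on_index:
  assumes "m > 0" "\<And>j. j < m \<Longrightarrow> f (e j) = e (Suc j mod m)"
  shows "cyclic_on f (e ` {..<m})"
proof -
  have p: "(f ^^ i) (e 0) = e (i mod m)" for i
    using assms by (induction i) (simp_all add: mod_Suc_eq)
  have "e ` {..<m} = orbit f (e 0)"
    unfolding orbit_altdef p
  proof (intro equalityI subsetI)
    fix x assume "x \<in> e ` {..<m}"
    then obtain k where "k < m" "x = e k" by blast
    \<comment> \<open>An \<open>orbit\<close> consists of positive iterates, so \<open>m\<close> is
      added to the index to cover \<open>k = 0\<close>.\<close>
    then have "x = e ((k + m) mod m) \<and> 0 < k + m" using assms(1) by simp
    then show "x \<in> {e (n mod m) |n. 0 < n}" by blast
  qed (use assms(1) in auto)
  then show ?thesis unfolding cyclic_on_def using assms(1) by (metis imageI lessThan_iff)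
qed

context belyi_poly
begin

lemma g_nonzero: "g \<noteq> 0"
  using deg by auto

text \<open>In the coordinate where \<open>g\<close> is the \<open>m\<close>-th power, an initial
  piece of the segment lifts to \<open>m\<close> rays, one for each root of unity. Each ray is
  mapped by \<open>\<psi>\<close> onto a lift of that piece, hence onto part of a sheet. The common
  factor \<open>u\<close> is \<open>sgn a\<close>, the direction in which the inverse coordinate
  turns the rays.\<close>

lemma star_at_black:
  assumes v: "poly g v = 0"
  defines "m \<equiv> order v g"
  shows "\<exists>b u. inj_on b {..<m} \<and> u \<noteq> 0 \<and>
    (\<forall>j<m. b j \<in> fibre \<and> black_of (b j) = v \<and> direction v (edge (b j)) = u * root_of_unity m j)"
proof -
  have m: "m > 0" using g_nonzero v by (simp add: m_def order_gt_0_iff)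
  obtain r \<psi> a where \<psi>: "r > 0" "continuous_on (ball 0 r) \<psi>" "inj_on \<psi> (ball 0 r)" "\<psi> 0 = v"
    "\<And>y. y \<in> ball 0 r \<Longrightarrow> poly g (\<psi> y) = y ^ m"
    "(\<psi> has_field_derivative a) (at 0)" "a \<noteq> 0"
    using poly_local_root[OF g_nonzero v] unfolding m_def by metis
  \<comment> \<open>Keeps the \<open>m\<close>-th root of the value below \<open>r\<close>, where
    \<open>\<psi>\<close> is available, and the piece inside the segment.\<close>
  define \<rho> where "\<rho> = min 1 (r ^ m)"
  have \<rho>: "0 < \<rho>" "\<rho> \<le> 1" using \<psi>(1) by (auto simp: \<rho>_def)
  define D where "D = complex_of_real ` {0<..<\<rho>}"
  define y where "y j w = complex_of_real (root m (Re w)) * root_of_unity m j" for j w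
  have D: "D \<subseteq> open_segment 0 1" "D \<subseteq> slit" "connected D" "D \<noteq> {}"
  proof -
    show "D \<subseteq> open_segment 0 1" using \<rho> by (auto simp: D_def open_segment_01_iff)
    then show "D \<subseteq> slit" using slit_simps(3) by blast
    show "connected D" unfolding D_def by (intro connected_continuous_image continuous_intros) simp
    show "D \<noteq> {}" using \<rho>(1) by (simp add: D_def)
  qed
  have y: "y j w \<in> ball 0 r" "y j w \<noteq> 0" "y j w ^ m = w" "sgn (y j w) = root_of_unity m j"
    if w: "w \<in> D" for j w
  proof -
    obtain t where t: "0 < t" "t < \<rho>" "w = of_real t" using w by (auto simp: D_def)
    have "root m t < root m (r ^ m)" using t m by (simp add: \<rho>_def)
    then have "root m t < r" using m \<psi>(1) by (simp add: real_root_power_cancel)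
    moreover have pos: "root m t > 0" using t m by simp
    ultimately show "y j w \<in> ball 0 r" using t by (simp add: y_def norm_mult root_of_unity_def)
    show "y j w \<noteq> 0" "sgn (y j w) = root_of_unity m j"
      using pos t by (simp_all add: y_def root_of_unity_def sgn_mult sgn_of_real)
    show "y j w ^ m = w" using t m
      by (simp add: y_def power_mult_distrib root_of_unity_power flip: of_real_power)
  qed
  have conty: "continuous_on D (y j)" for j unfolding y_def by (intro continuous_intros)
  have "\<exists>z\<in>fibre. \<forall>w\<in>D. \<psi> (y j w) = sheet z w" for j
  proof (rule lift_eq_sheet[OF D(2,3,4)])
    show "continuous_on D (\<lambda>w. \<psi> (y j w))"
      using y(1) by (intro continuous_on_compose2[OF \<psi>(2) conty]) auto
  qed (use y \<psi>(5) in simp)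
  then obtain b where b: "\<And>j. b j \<in> fibre" "\<And>j w. w \<in> D \<Longrightarrow> \<psi> (y j w) = sheet (b j) w" by metis
  have "inj_on b {..<m}"
  proof (rule inj_onI)
    fix i j assume ij: "i \<in> {..<m}" "j \<in> {..<m}" "b i = b j"
    obtain w where w: "w \<in> D" using D(4) by blast
    have "y i w = y j w" using b(2)[OF w] ij \<psi>(3) y(1)[OF w] by (metis inj_on_eq_iff)
    then have "root_of_unity m i = root_of_unity m j" using y(4)[OF w] by metis
    then show "i = j" using inj_on_root_of_unity ij by (metis inj_onD)
  qed
  moreover have ev: "eventually (\<lambda>w. w \<in> D) (at 0 within open_segment (0::complex) 1)"
    unfolding eventually_at using \<rho>
    by (intro exI[of _ \<rho>]) (auto simp: D_def open_segment_01_iff image_iff complex_eq_iff cmod_eq_Re dist_norm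
        intro!: exI[of _ "Re _"])
  have limy: "filterlim (y j) (at 0) (at 0 within open_segment (0::complex) 1)" for j
  proof (rule filterlim_atI)
    have "(y j \<longlongrightarrow> y j 0) (at 0 within open_segment 0 1)"
      unfolding y_def by (intro tendsto_intros)
    then show "(y j \<longlongrightarrow> 0) (at 0 within open_segment 0 1)" by (simp add: y_def)
    show "\<forall>\<^sub>F w in at 0 within open_segment 0 1. y j w \<noteq> 0"
      using ev by eventually_elim (rule y(2))
  qed
  have black: "black_of (b j) = v" for j
  proof -
    have "(\<psi> \<longlongrightarrow> v) (at 0)" using DERIV_isCont[OF \<psi>(6)] \<psi>(4) by (simp add: isCont_def)
    then have "((\<lambda>w. \<psi> (y j w)) \<longlongrightarrow> v) (at 0 within open_segment 0 1)"
      using limy filterlim_compose by blast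
    then have "(sheet (b j) \<longlongrightarrow> v) (at 0 within open_segment 0 1)"
      by (rule Lim_transform_eventually) (use ev in \<open>eventually_elim, simp add: b(2)\<close>)
    moreover have "(sheet (b j) \<longlongrightarrow> black_of (b j)) (at 0 within open_segment 0 1)"
      using black_of(2)[OF b(1)] slit_simps(3) by (rule tendsto_within_subset)
    ultimately show ?thesis using tendsto_unique at_within_segment_nontrivial(1) by metis
  qed
  moreover have "direction v (edge (b j)) = sgn a * root_of_unity m j" for j
  proof -
    let ?e = "edge (b j)"
    have "((\<lambda>y. (\<psi> y - v) / y) \<longlongrightarrow> a) (at 0)"
      using \<psi>(4,6) by (simp add: has_field_derivative_iff)
    then have "((\<lambda>w. (\<psi> (y j w) - v) / y j w) \<longlongrightarrow> a) (at 0 within open_segment 0 1)"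
      using limy filterlim_compose by blast
    then have "((\<lambda>w. sgn ((\<psi> (y j w) - v) / y j w) * root_of_unity m j) \<longlongrightarrow> sgn a * root_of_unity m j)
        (at 0 within open_segment 0 1)"
      by (intro tendsto_intros \<psi>(7))
    then have lim: "((\<lambda>w. sgn (sheet (b j) w - v)) \<longlongrightarrow> sgn a * root_of_unity m j) (at 0 within open_segment 0 1)"
    proof (rule Lim_transform_eventually)
      show "\<forall>\<^sub>F w in at 0 within open_segment 0 1.
          sgn ((\<psi> (y j w) - v) / y j w) * root_of_unity m j = sgn (sheet (b j) w - v)"
        using ev
      proof eventually_elim
        case (elim w)
        have "(\<psi> (y j w) - v) / y j w * y j w = sheet (b j) w - v"
          using y(2)[OF elim] b(2)[OF elim] by simp
        then show ?case using y(4)[OF elim] by (metis sgn_mult)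
      qed
    qed
    \<comment> \<open>The substitution \<open>w = g x\<close> turns the limit along the segment at 0
      into the limit along the edge at \<open>v\<close> by which \<open>direction\<close> is
      defined.\<close>
    have "filterlim (poly g) (at 0 within open_segment 0 1) (at v within ?e)"
      unfolding filterlim_at
    proof
      show "\<forall>\<^sub>F x in at v within ?e. poly g x \<in> open_segment 0 1 \<and> poly g x \<noteq> 0"
        unfolding eventually_at_filter
        by (rule always_eventually) (use b(1) in \<open>auto simp: edge_eq open_segment_01_iff\<close>)
      have "(poly g \<longlongrightarrow> poly g v) (at v within ?e)" by (intro tendsto_intros)
      then show "(poly g \<longlongrightarrow> 0) (at v within ?e)" using v by simp
    qed
    then have "((\<lambda>x. sgn (sheet (b j) (poly g x) - v)) \<longlongrightarrow> sgn a * root_of_unity m j) (at v within ?e)"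
      using lim filterlim_compose by fastforce
    then have *: "((\<lambda>x. sgn (x - v)) \<longlongrightarrow> sgn a * root_of_unity m j) (at v within ?e)"
      by (rule Lim_transform_eventually)
        (use b(1) in \<open>auto simp: eventually_at_filter edge_eq\<close>)
    have "v \<notin> ?e" using v b(1) by (auto simp: edge_eq open_segment_01_iff)
    moreover have "v \<in> closure ?e" using closure_edge_iff(1)[OF b(1) v] black by simp
    ultimately have "at v within ?e \<noteq> bot"
      by (simp add: trivial_limit_within islimpt_in_closure)
    then show ?thesis unfolding direction_def using tendsto_Lim[OF _ *] by blast
  qed
  moreover have "sgn a \<noteq> 0" using \<psi>(7) by (simp add: sgn_zero_iff)
  ultimately show ?thesis using b(1) by blast
qed

text \<open>The star gives each \<open>v\<close> at least \<open>order v g\<close> edges. Orders and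
  numbers of edges have the same sum \<open>degree g\<close>, since each edge has one black end, so
  equality holds at every vertex and the star is the full set \<open>E\<close>.\<close>

lemma black_edges:
  assumes v: "poly g v = 0"
  defines "E \<equiv> {e \<in> shabat_edges g 0 1. v \<in> closure e}"
  shows "card E = order v g" "cyclic_on (\<lambda>e. arg_min_on (turn v e) E) E"
proof -
  let ?V = "{v. poly g v = 0}"
  let ?Z = "\<lambda>v. {z \<in> fibre. black_of z = v}"
  have finV: "finite ?V" using poly_roots_finite[OF g_nonzero] .
  have le: "order v g \<le> card (?Z v)" if v': "poly g v = 0" for v
  proof -
    obtain b where b: "inj_on b {..<order v g}" "\<forall>j<order v g. b j \<in> fibre \<and> black_of (b j) = v"
      using star_at_black[OF v'] by blast
    have "card (b ` {..<order v g}) \<le> card (?Z v)"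
      using b card_fibre(2) by (intro card_mono) auto
    then show ?thesis using card_image[OF b(1)] by simp
  qed
  have "(\<Sum>v\<in>?V. card (?Z v)) = card (\<Union>v\<in>?V. ?Z v)"
    using finV card_fibre(2) by (intro card_UN_disjoint[symmetric]) auto
  also have "(\<Union>v\<in>?V. ?Z v) = fibre" using black_of(1) by auto
  finally have "(\<Sum>v\<in>?V. order v g) = (\<Sum>v\<in>?V. card (?Z v))"
    using sum_order_eq_degree[OF g_nonzero] card_fibre(1) by simp
  then have cardZ: "order v g = card (?Z v)"
    using sum_mono_inv[of "\<lambda>v. order v g" ?V "\<lambda>v. card (?Z v)" v] le finV v by simp
  have E: "E = edge ` ?Z v"
    unfolding E_def shabat_edges_eq using closure_edge_iff(1)[OF _ v] by auto
  have injZ: "inj_on edge (?Z v)" using inj_on_edge by (rule inj_on_subset) auto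
  show "card E = order v g" unfolding E card_image[OF injZ] cardZ ..
  define m where "m = order v g"
  have m: "m > 0" using g_nonzero v by (simp add: m_def order_gt_0_iff)
  obtain b u where b: "inj_on b {..<m}" "u \<noteq> 0"
    "\<And>j. j < m \<Longrightarrow> b j \<in> fibre \<and> black_of (b j) = v \<and> direction v (edge (b j)) = u * root_of_unity m j"
    using star_at_black[OF v] unfolding m_def by blast
  have "b ` {..<m} = ?Z v"
  proof (rule card_subset_eq)
    show "card (b ` {..<m}) = card (?Z v)" using card_image[OF b(1)] cardZ by (simp add: m_def)
  qed (use b card_fibre(2) in auto)
  then have E': "E = (\<lambda>j. edge (b j)) ` {..<m}" unfolding E by (metis image_image)
  have "inj_on (\<lambda>j. edge (b j)) {..<m}"
    using b(1,3) inj_on_edge by (auto simp: inj_on_def)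
  then have "arg_min_on (turn v (edge (b j))) E = edge (b (Suc j mod m))" if "j < m" for j
    unfolding E' using arg_min_turn[of "\<lambda>j. edge (b j)" m u v j] b that by auto
  then show "cyclic_on (\<lambda>e. arg_min_on (turn v e) E) E"
    using cyclic_on_index[OF m, of "\<lambda>e. arg_min_on (turn v e) E" "\<lambda>j. edge (b j)"] unfolding E'[symmetric] by simp
qed

end

text \<open>Passing to \<open>1 - g\<close> exchanges the two colors and keeps the edges as sets, so
  the facts at white vertices follow from those at black ones.\<close>

lemma belyi_poly_swap: "belyi_poly g \<Longrightarrow> belyi_poly ([:1:] - g)"
proof -
  assume g: "belyi_poly g"
  have "degree ([:1:] + - g) = degree g"
    using belyi_poly.deg[OF g] degree_add_eq_right[of "[:1:]" "- g"] by simp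
  then have "degree ([:1:] - g) = degree g" by (simp only: diff_conv_add_uminus)
  moreover have "poly ([:1:] - g) z \<in> {0, 1}" if "poly (pderiv ([:1:] - g)) z = 0" for z
  proof -
    have "poly (pderiv g) z = 0" using that by (simp add: pderiv_diff)
    then show ?thesis using belyi_poly.crit[OF g, of z] by auto
  qed
  ultimately show ?thesis using belyi_poly.deg[OF g] by unfold_locales simp_all
qed

lemma shabat_edges_swap: "shabat_edges ([:1:] - g) 0 1 = shabat_edges g 0 1"
proof -
  have "{z. poly ([:1:] - g) z \<in> open_segment 0 1} = {z. poly g z \<in> open_segment 0 1}"
    by (auto simp: open_segment_01_iff)
  then show ?thesis by (simp only: shabat_edges_def)
qed

context belyi_poly
begin

lemma white_edges:
  assumes v: "poly g v = 1"
  defines "E \<equiv> {e \<in> shabat_edges g 0 1. v \<in> closure e}"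
  shows "card E = order v (g - [:1:])" "cyclic_on (\<lambda>e. arg_min_on (turn v e) E) E"
proof -
  have "belyi_poly ([:1:] - g)" using belyi_poly_swap belyi_poly_axioms .
  from belyi_poly.black_edges[OF this, of v, unfolded shabat_edges_swap]
  have "card E = order v ([:1:] - g)" "cyclic_on (\<lambda>e. arg_min_on (turn v e) E) E"
    using v unfolding E_def by simp_all
  moreover have "order v ([:1:] - g) = order v (g - [:1:])"
    using order_uminus[of v "g - [:1:]"] by simp
  ultimately show "card E = order v (g - [:1:])" "cyclic_on (\<lambda>e. arg_min_on (turn v e) E) E" by simp_all
qed

section \<open>Ends of edges, sheets meeting across a cut, and connectedness\<close>

lemma edge_ends:
  assumes "e \<in> shabat_edges g 0 1"
  shows "\<exists>!v. poly g v = 0 \<and> v \<in> closure e" "\<exists>!v. poly g v = 1 \<and> v \<in> closure e"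
proof -
  obtain z where z: "z \<in> fibre" "e = edge z" using assms by (auto simp: shabat_edges_eq)
  show "\<exists>!v. poly g v = 0 \<and> v \<in> closure e"
    using closure_edge_iff(1)[OF z(1)] black_of(1)[OF z(1)] z(2) by (intro ex1I[of _ "black_of z"]) auto
  show "\<exists>!v. poly g v = 1 \<and> v \<in> closure e"
    using closure_edge_iff(2)[OF z(1)] white_of(1)[OF z(1)] z(2) by (intro ex1I[of _ "white_of z"]) auto
qed

lemma lift_open_image:
  assumes "open D" "continuous_on D l" "\<And>w. w \<in> D \<Longrightarrow> poly g (l w) = w"
  shows "open (l ` D)"
proof (rule invariance_of_domain)
  show "inj_on l D" by (rule inj_on_inverseI) (rule assms(3))
qed (use assms in auto)

text \<open>Intended for \<open>D\<close> the plane without the segment and one of the two cuts. A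
  lift over \<open>D\<close> restricts to one sheet over each half plane; it has a limit at the tip
  \<open>c\<close>, so the two sheets share their end over \<open>c\<close>. The image of
  \<open>D\<close> under the lift is the neighbourhood \<open>N\<close> of \<open>y\<close>.\<close>

lemma sheets_across:
  assumes D: "open D" "simply_connected D" "D \<subseteq> - {0, 1}" "poly g y \<in> D"
    and half: "{w. Im w > 0} \<subseteq> D" "{w. Im w < 0} \<subseteq> D" "D \<inter> slit \<subseteq> {w. Im w \<noteq> 0}"
    and real: "Im (poly g y) = 0"
    and c: "\<And>e. 0 < e \<Longrightarrow> connected (D \<inter> ball (of_real c) e)" "c \<in> {0, 1}"
  shows "\<exists>z\<in>fibre. \<exists>z'\<in>fibre. \<exists>N. open N \<and> y \<in> N \<and> y \<in> closure (sheet z ` slit) \<and>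
    (\<forall>x\<in>N. poly g x \<in> slit \<longrightarrow> x \<in> sheet z ` slit \<or> x \<in> sheet z' ` slit) \<and>
    (black_of z = black_of z' \<or> white_of z = white_of z')"
proof -
  let ?c = "complex_of_real c"
  let ?P = "{w. Im w > 0}" and ?M = "{w. Im w < 0}"
  obtain l where l: "continuous_on D l" "\<And>w. w \<in> D \<Longrightarrow> poly g (l w) = w" "l (poly g y) = y"
    using lift_exists[OF D] by metis
  have sl: "?P \<subseteq> slit" "?M \<subseteq> slit" by (auto simp: slit_iff)
  have conn: "connected ?P" "connected ?M"
    by (simp_all add: convex_connected convex_halfspace_Im_gt convex_halfspace_Im_lt)
  have "\<i> \<in> ?P" "- \<i> \<in> ?M" by simp_all
  then have ne: "?P \<noteq> {}" "?M \<noteq> {}" by blast+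
  have "\<exists>z\<in>fibre. \<forall>w\<in>?P. l w = sheet z w"
    by (rule lift_eq_sheet[OF sl(1) conn(1) ne(1)])
      (rule continuous_on_subset[OF l(1) half(1)], rule l(2)[OF subsetD[OF half(1)]])
  then obtain z where z: "z \<in> fibre" "\<And>w. w \<in> ?P \<Longrightarrow> l w = sheet z w" by blast
  have "\<exists>z\<in>fibre. \<forall>w\<in>?M. l w = sheet z w"
    by (rule lift_eq_sheet[OF sl(2) conn(2) ne(2)])
      (rule continuous_on_subset[OF l(1) half(2)], rule l(2)[OF subsetD[OF half(2)]])
  then obtain z' where z': "z' \<in> fibre" "\<And>w. w \<in> ?M \<Longrightarrow> l w = sheet z' w" by blast
  have near: "?c + \<i> * of_real (e/2) \<in> ?P \<inter> ball ?c e" "?c - \<i> * of_real (e/2) \<in> ?M \<inter> ball ?c e"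
    if "0 < e" for e
    using that by (simp_all add: dist_norm norm_mult)
  have Dne: "D \<inter> ball ?c e \<noteq> {}" if "0 < e" for e
    using near(1)[OF that] half(1) by blast
  have "\<exists>v. poly g v = ?c \<and> (l \<longlongrightarrow> v) (at ?c within D)"
    by (rule lift_has_limit[OF deg l(1,2)]) (use c(1) Dne in simp_all)
  then obtain v where v: "(l \<longlongrightarrow> v) (at ?c within D)" by blast
  have "?c islimpt ?P"
    unfolding islimpt_approachable
  proof (intro allI impI)
    fix e :: real assume "0 < e"
    then show "\<exists>x'\<in>?P. x' \<noteq> ?c \<and> dist x' ?c < e"
      by (intro bexI[of _ "?c + \<i> * of_real (e/2)"]) (simp_all add: dist_norm norm_mult)
  qed
  then have nontrivP: "at ?c within ?P \<noteq> bot" by (simp add: trivial_limit_within)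
  have "?c islimpt ?M"
    unfolding islimpt_approachable
  proof (intro allI impI)
    fix e :: real assume "0 < e"
    then show "\<exists>x'\<in>?M. x' \<noteq> ?c \<and> dist x' ?c < e"
      by (intro bexI[of _ "?c - \<i> * of_real (e/2)"]) (simp_all add: dist_norm norm_mult)
  qed
  then have nontrivM: "at ?c within ?M \<noteq> bot" by (simp add: trivial_limit_within)
  have uz: "u = v" if "(sheet z \<longlongrightarrow> u) (at ?c within slit)" for u
  proof -
    have "(sheet z \<longlongrightarrow> u) (at ?c within ?P)" using that sl(1) by (rule tendsto_within_subset)
    moreover have "(l \<longlongrightarrow> v) (at ?c within ?P)" using v half(1) by (rule tendsto_within_subset)
    then have "(sheet z \<longlongrightarrow> v) (at ?c within ?P)"
      by (rule Lim_transform_eventually) (use z(2) in \<open>auto simp: eventually_at_filter\<close>)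
    ultimately show ?thesis using tendsto_unique[OF nontrivP] by blast
  qed
  have uz': "u = v" if "(sheet z' \<longlongrightarrow> u) (at ?c within slit)" for u
  proof -
    have "(sheet z' \<longlongrightarrow> u) (at ?c within ?M)" using that sl(2) by (rule tendsto_within_subset)
    moreover have "(l \<longlongrightarrow> v) (at ?c within ?M)" using v half(2) by (rule tendsto_within_subset)
    then have "(sheet z' \<longlongrightarrow> v) (at ?c within ?M)"
      by (rule Lim_transform_eventually) (use z'(2) in \<open>auto simp: eventually_at_filter\<close>)
    ultimately show ?thesis using tendsto_unique[OF nontrivM] by blast
  qed
  have ends: "black_of z = black_of z' \<or> white_of z = white_of z'"
  proof (cases "c = 0")
    case True
    then show ?thesis
      using uz[of "black_of z"] uz'[of "black_of z'"] black_of(2)[OF z(1)] black_of(2)[OF z'(1)] by simp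
  next
    case False
    then have "c = 1" using c(2) by simp
    then show ?thesis
      using uz[of "white_of z"] uz'[of "white_of z'"] white_of(2)[OF z(1)] white_of(2)[OF z'(1)] by simp
  qed
  have N: "open (l ` D)" by (rule lift_open_image[OF D(1) l(1,2)])
  have yN: "y \<in> l ` D" using D(4) l(3) by (metis imageI)
  have cover: "x \<in> sheet z ` slit \<or> x \<in> sheet z' ` slit" if x: "x \<in> l ` D" "poly g x \<in> slit" for x
  proof -
    obtain w where w: "w \<in> D" "x = l w" using x(1) by blast
    then have "w \<in> slit" using l(2)[OF w(1)] x(2) by simp
    then have "w \<in> ?P \<or> w \<in> ?M" using w(1) half(3) by force
    then have "x = sheet z w \<or> x = sheet z' w" using z(2)[of w] z'(2)[of w] w(2) by metis
    then show ?thesis using \<open>w \<in> slit\<close> by blast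
  qed
  \<comment> \<open>The value is approached vertically from the upper half plane, where the lift is
    the sheet of \<open>z\<close>.\<close>
  have "y \<in> closure (sheet z ` slit)"
  proof -
    have "isCont l (poly g y)" using continuous_on_eq_continuous_at[OF D(1)] l(1) D(4) by blast
    moreover have "(\<lambda>n. poly g y + \<i> * of_real (inverse (real (Suc n)))) \<longlonglongrightarrow> poly g y + \<i> * of_real 0"
      by (rule tendsto_add[OF tendsto_const tendsto_mult[OF tendsto_const tendsto_of_real[OF LIMSEQ_inverse_real_of_nat]]])
    then have "(\<lambda>n. poly g y + \<i> * of_real (inverse (real (Suc n)))) \<longlonglongrightarrow> poly g y" by simp
    ultimately have "(\<lambda>n. l (poly g y + \<i> * of_real (inverse (real (Suc n))))) \<longlonglongrightarrow> l (poly g y)"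
      by (rule isCont_tendsto_compose)
    moreover have "l (poly g y + \<i> * of_real (inverse (real (Suc n)))) \<in> sheet z ` slit" for n
    proof -
      have inP: "poly g y + \<i> * of_real (inverse (real (Suc n))) \<in> ?P" by (simp add: real)
      show ?thesis unfolding z(2)[OF inP] by (rule imageI[OF subsetD[OF sl(1) inP]])
    qed
    ultimately show ?thesis
      unfolding l(3) closure_sequential
      by (intro exI[of _ "\<lambda>n. l (poly g y + \<i> * of_real (inverse (real (Suc n))))"]) simp
  qed
  note cl = this
  show ?thesis
    by (intro bexI[OF _ z(1)] bexI[OF _ z'(1)] exI[of _ "l ` D"] conjI N yN cl ends ballI impI cover)
qed

text \<open>Over \<open>slit\<close> a single sheet is already a neighbourhood and serves as both
  \<open>z\<close> and \<open>z'\<close>. Over a cut, the other cut and the segment are removed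
  instead, which leaves a slotted plane in which the cut under \<open>y\<close> can be
  crossed.\<close>

lemma sheets_near:
  assumes "poly g y \<notin> {0, 1}"
  shows "\<exists>z\<in>fibre. \<exists>z'\<in>fibre. \<exists>N. open N \<and> y \<in> N \<and> y \<in> closure (sheet z ` slit) \<and>
    (\<forall>x\<in>N. poly g x \<in> slit \<longrightarrow> x \<in> sheet z ` slit \<or> x \<in> sheet z' ` slit) \<and>
    (black_of z = black_of z' \<or> white_of z = white_of z')"
proof (cases "poly g y \<in> slit")
  case True
  then obtain z where z: "z \<in> fibre" "y = sheet z (poly g y)" using sheet_cover by blast
  have y: "y \<in> sheet z ` slit" using z(2) True by (rule image_eqI)
  have op: "open (sheet z ` slit)" by (rule lift_open_image[OF open_slit sheet(1,2)[OF z(1)]])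
  show ?thesis
    by (intro bexI[OF _ z(1)] exI[of _ "sheet z ` slit"] conjI disjI1 ballI impI op y refl
        subsetD[OF closure_subset y])
next
  case False
  then have real: "Im (poly g y) = 0" "Re (poly g y) < 0 \<or> Re (poly g y) > 1"
    using assms by (auto simp: slit_iff complex_eq_iff)
  have im: "complex_of_real ` {..a} = {w. Im w = 0 \<and> Re w \<le> a}"
    "complex_of_real ` {a..} = {w. Im w = 0 \<and> Re w \<ge> a}" for a
    by (auto simp: image_iff complex_eq_iff)
  show ?thesis
  proof (cases "Re (poly g y) < 0")
    case True
    let ?D = "- (complex_of_real ` {0..})"
    have D: "?D = {w. Im w \<noteq> 0 \<or> Re w < 0}" unfolding im by auto
    show ?thesis
    proof (rule sheets_across[of ?D _ 0])
      show "connected (?D \<inter> ball (of_real 0) e)" if "0 < e" for e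
        using connected_convex_minus_ray(2)[of "ball 0 e" "-e/2" 0] that by (simp add: Int_commute Diff_eq)
      show "open ?D"
        by (intro open_Compl closed_injective_linear_image) (auto simp: linear_of_real inj_of_real)
      show "simply_connected ?D" by (rule simply_connected_slotted_complex_plane_right)
    qed (use True real in \<open>auto simp: D slit_iff complex_eq_iff\<close>)
  next
    case False
    let ?D = "- (complex_of_real ` {..1})"
    have D: "?D = {w. Im w \<noteq> 0 \<or> Re w > 1}" unfolding im by auto
    show ?thesis
    proof (rule sheets_across[of ?D _ 1])
      show "connected (?D \<inter> ball (of_real 1) e)" if "0 < e" for e
        using connected_convex_minus_ray(1)[of "ball 1 e" "1+e/2" 1] that
        by (simp add: Int_commute Diff_eq dist_norm)
      show "open ?D"
        by (intro open_Compl closed_injective_linear_image) (auto simp: linear_of_real inj_of_real)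
      show "simply_connected ?D" by (rule simply_connected_slotted_complex_plane_left)
    qed (use False real in \<open>auto simp: D slit_iff complex_eq_iff\<close>)
  qed
qed

lemma fibre_connected:
  assumes S: "S \<subseteq> fibre" "S \<noteq> {}"
    and closed: "\<And>z z'. z \<in> S \<Longrightarrow> z' \<in> fibre \<Longrightarrow> black_of z = black_of z' \<or> white_of z = white_of z' \<Longrightarrow> z' \<in> S"
  shows "S = fibre"
proof (rule ccontr)
  assume "S \<noteq> fibre"
  define X where "X = {y. poly g y \<notin> {0, 1}}"
  define Y where "Y T = closure (\<Union>z\<in>T. sheet z ` slit)" for T
  have "finite {y. poly g y = c}" for c
  proof -
    have "g - [:c:] \<noteq> 0" using deg by (metis degree_pCons_0 eq_iff_diff_eq_0 less_irrefl)
    then show ?thesis using poly_roots_finite[of "g - [:c:]"] by simp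
  qed
  then have "finite ({y. poly g y = 0} \<union> {y. poly g y = 1})" by blast
  then have "connected (UNIV - ({y. poly g y = 0} \<union> {y. poly g y = 1}))"
    by (intro connected_open_delete_finite) auto
  moreover have "UNIV - ({y. poly g y = 0} \<union> {y. poly g y = 1}) = X" by (auto simp: X_def)
  ultimately have conn: "connected X" by simp
  have inter: "z \<in> T" if h: "z \<in> fibre" "T \<subseteq> fibre" "z' \<in> T" "x \<in> sheet z ` slit" "x \<in> sheet z' ` slit" for T z z' x
  proof -
    have z': "z' \<in> fibre" using h by blast
    obtain w w' where w: "w \<in> slit" "w' \<in> slit" "x = sheet z w" "x = sheet z' w'" using h(4,5) by blast
    then have "w = w'" using sheet(2)[OF h(1) w(1)] sheet(2)[OF z' w(2)] by simp
    then have "z = z'" using sheet_eqD[OF h(1) z' w(1)] w by simp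
    then show ?thesis using h(3) by simp
  qed
  \<comment> \<open>The two sheets near \<open>y\<close> have a common end, so \<open>S\<close>
    contains both of their indices or neither. One index thus decides both memberships, and the two
    closed sets cover \<open>X\<close> without meeting in it.\<close>
  have near: "\<exists>z\<in>fibre. (z \<in> S \<longleftrightarrow> y \<in> Y S) \<and> (z \<in> fibre - S \<longleftrightarrow> y \<in> Y (fibre - S))" if y: "y \<in> X" for y
  proof -
    obtain z z' N where *: "z \<in> fibre" "z' \<in> fibre" "open N" "y \<in> N" "y \<in> closure (sheet z ` slit)"
      "\<forall>x\<in>N. poly g x \<in> slit \<longrightarrow> x \<in> sheet z ` slit \<or> x \<in> sheet z' ` slit"
      "black_of z = black_of z' \<or> white_of z = white_of z'"
      using sheets_near[of y] y unfolding X_def by blast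
    have zz': "z \<in> S \<longleftrightarrow> z' \<in> S" using *(1,2,7) closed by metis
    have "z \<in> T \<or> z' \<in> T" if T: "T \<subseteq> fibre" "y \<in> Y T" for T
    proof -
      obtain x where x: "x \<in> N" "x \<in> (\<Union>z\<in>T. sheet z ` slit)"
        using T(2) *(3,4) unfolding Y_def by (metis (no_types, lifting) closure_iff_nhds_not_empty disjoint_iff order_refl)
      then obtain t where t: "t \<in> T" "x \<in> sheet t ` slit" by blast
      then have "poly g x \<in> slit" using sheet(2) T(1) by auto
      then have "x \<in> sheet z ` slit \<or> x \<in> sheet z' ` slit" using *(6) x(1) by blast
      then show ?thesis using inter[OF _ T(1) t(1) _ t(2)] *(1,2) by blast
    qed
    note out = this
    have inn: "y \<in> Y T" if "z \<in> T" for T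
      using *(5) closure_mono[of "sheet z ` slit" "\<Union>z\<in>T. sheet z ` slit"] that unfolding Y_def by blast
    have "z \<in> S \<longleftrightarrow> y \<in> Y S" using out[OF S(1)] inn[of S] zz' by blast
    moreover have "z \<in> fibre - S \<longleftrightarrow> y \<in> Y (fibre - S)"
      using out[of "fibre - S"] inn[of "fibre - S"] zz' *(1,2) by blast
    ultimately show ?thesis using *(1) by blast
  qed
  have cover: "X \<subseteq> Y S \<union> Y (fibre - S)" using near by blast
  have disj: "Y S \<inter> Y (fibre - S) \<inter> X = {}" using near by blast
  have mem: "z \<in> Y T \<inter> X" if "z \<in> T" "T \<subseteq> fibre" for z T
  proof -
    have z: "z \<in> fibre" using that by blast
    then have "z = sheet z (1/2)" using sheet(3) by simp
    then have "z \<in> sheet z ` slit" using slit_simps(2) by (rule image_eqI)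
    then have "z \<in> (\<Union>z\<in>T. sheet z ` slit)" using that by blast
    then have "z \<in> Y T" unfolding Y_def using closure_subset by (rule subsetD[rotated])
    moreover have "poly g z = 1/2" using z by (simp add: fibre_def)
    then have "z \<in> X" unfolding X_def mem_Collect_eq by (simp only:) simp
    ultimately show ?thesis by blast
  qed
  have "Y S \<inter> X \<noteq> {}" using mem S by blast
  moreover have "Y (fibre - S) \<inter> X \<noteq> {}" using mem[of _ "fibre - S"] S(1) \<open>S \<noteq> fibre\<close> by blast
  ultimately show False
    using conn cover disj connected_closed[of X] unfolding Y_def by (metis closed_closure)
qed

lemma shabat_edges_connected:
  assumes "S \<subseteq> shabat_edges g 0 1" "S \<noteq> {}"
    and closed: "\<And>e e' v. e \<in> S \<Longrightarrow> e' \<in> shabat_edges g 0 1 \<Longrightarrow> poly g v \<in> {0, 1} \<Longrightarrow>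
      v \<in> closure e \<Longrightarrow> v \<in> closure e' \<Longrightarrow> e' \<in> S"
  shows "S = shabat_edges g 0 1"
proof -
  define T where "T = {z \<in> fibre. edge z \<in> S}"
  have S: "S = edge ` T" using assms(1) unfolding T_def shabat_edges_eq by auto
  have "T = fibre"
  proof (rule fibre_connected)
    fix z z' assume z: "z \<in> T" "z' \<in> fibre" and eq: "black_of z = black_of z' \<or> white_of z = white_of z'"
    have zf: "z \<in> fibre" "edge z \<in> S" using z by (auto simp: T_def)
    have e': "edge z' \<in> shabat_edges g 0 1" using z(2) by (simp add: shabat_edges_eq)
    from eq have "edge z' \<in> S"
    proof
      assume "black_of z = black_of z'"
      then show ?thesis
        using closed[OF zf(2) e', of "black_of z"] black_of(1) closure_edge_iff(1) zf(1) z(2) by simp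
    next
      assume "white_of z = white_of z'"
      then show ?thesis
        using closed[OF zf(2) e', of "white_of z"] white_of(1) closure_edge_iff(2) zf(1) z(2) by simp
    qed
    then show "z' \<in> T" using z by (simp add: T_def)
  next
    show "T \<noteq> {}" using assms(2) unfolding S by blast
  qed (auto simp: T_def)
  then show ?thesis using S shabat_edges_eq by simp
qed

section \<open>The sign of a square root across a white vertex\<close>

text \<open>Points on the two edges with the same value of \<open>g\<close> have equal squares of
  \<open>S\<close>, so the quotient of the values of \<open>S\<close> is a continuous function with
  values 1 and -1, hence constant. The value 1 is impossible near \<open>u\<close>, where
  \<open>S\<close> is injective and the edges are disjoint; the value -1 persists in the limit at
  the black ends.\<close>

lemma opposite_sign_across_white:
  assumes e: "e \<in> shabat_edges g 0 1" "e' \<in> shabat_edges g 0 1" "e \<noteq> e'"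
    and u: "poly g u = 1" "u \<in> closure e" "u \<in> closure e'"
    and v: "poly g v = 0" "v \<in> closure e" "poly g v' = 0" "v' \<in> closure e'"
    and S: "\<And>y. poly g y - 1 = C * poly S y ^ 2" "poly (pderiv S) u \<noteq> 0"
  shows "poly S v' = - poly S v"
proof -
  obtain z z' where z: "z \<in> fibre" "z' \<in> fibre" "e = edge z" "e' = edge z'"
    using e by (auto simp: shabat_edges_eq)
  then have ends: "black_of z = v" "black_of z' = v'" "white_of z = u" "white_of z' = u"
    using closure_edge_iff u v by metis+
  let ?I = "open_segment (0::complex) 1"
  let ?s = "\<lambda>w. poly S (sheet z w)" and ?s' = "\<lambda>w. poly S (sheet z' w)"
  have cont: "continuous_on ?I ?s" "continuous_on ?I ?s'"
    using sheet(1) z slit_simps(3) by (auto intro!: continuous_intros intro: continuous_on_subset)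
  have sq: "?s w ^ 2 = ?s' w ^ 2" "?s' w \<noteq> 0" if "w \<in> ?I" for w
  proof -
    have w: "w \<in> slit" "w \<noteq> 1" using that slit_simps(3) by (auto simp: open_segment_01_iff)
    have *: "C * ?s w ^ 2 = w - 1" "C * ?s' w ^ 2 = w - 1"
      unfolding S(1)[symmetric] sheet(2)[OF z(1) w(1)] sheet(2)[OF z(2) w(1)] by (rule refl)+
    then have C: "C \<noteq> 0" and "?s' w \<noteq> 0" using w(2) by auto
    then show "?s' w \<noteq> 0" by simp
    have "C * ?s w ^ 2 = C * ?s' w ^ 2" unfolding * ..
    then show "?s w ^ 2 = ?s' w ^ 2" using C by (simp only: mult_cancel_left) simp
  qed
  let ?q = "\<lambda>w. ?s w / ?s' w"
  have q: "?q w = 1 \<or> ?q w = -1" if "w \<in> ?I" for w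
    using sq[OF that] by (simp add: power2_eq_iff) (auto simp: divide_simps)
  have "?q constant_on ?I"
  proof (rule continuous_finite_range_constant)
    show "connected ?I" by (simp add: convex_connected)
    show "continuous_on ?I ?q" using sq(2) by (intro continuous_on_divide cont) auto
    have "?q ` ?I \<subseteq> {1, -1}" using q by blast
    then show "finite (?q ` ?I)" by (rule finite_subset) simp
  qed
  then obtain c where c: "\<And>w. w \<in> ?I \<Longrightarrow> ?q w = c" unfolding constant_on_def by blast
  have half: "1/2 \<in> ?I" by (simp add: open_segment_01_iff)
  have lim: "(sheet x \<longlongrightarrow> white_of x) (at 1 within ?I)" "(sheet x \<longlongrightarrow> black_of x) (at 0 within ?I)" if "x \<in> fibre" for x
    using white_of(2)[OF that] black_of(2)[OF that] slit_simps(3) by (auto intro: tendsto_within_subset)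
  have "c \<noteq> 1"
  proof
    assume "c = 1"
    have "deriv (poly S) u \<noteq> 0" using S(2) by (simp add: DERIV_imp_deriv[OF poly_DERIV])
    moreover have "poly S holomorphic_on UNIV" by (intro holomorphic_intros)
    ultimately obtain r where r: "r > 0" "inj_on (poly S) (ball u r)"
      using has_complex_derivative_locally_invertible[of "poly S" UNIV u] by (metis UNIV_I open_UNIV)
    have "\<forall>\<^sub>F w in at 1 within ?I. sheet z w \<in> ball u r" "\<forall>\<^sub>F w in at 1 within ?I. sheet z' w \<in> ball u r"
      using topological_tendstoD[OF lim(1)[OF z(1)] open_ball[of u r]]
        topological_tendstoD[OF lim(1)[OF z(2)] open_ball[of u r]] ends r(1) by simp_all
    moreover have "\<forall>\<^sub>F w in at 1 within ?I. w \<in> ?I" by (simp add: eventually_at_filter)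
    ultimately have "\<forall>\<^sub>F w in at 1 within ?I. False"
    proof eventually_elim
      case (elim w)
      have "?s w = ?s' w" using c[OF elim(3)] \<open>c = 1\<close> sq(2)[OF elim(3)] by simp
      then have "sheet z w = sheet z' w" using r(2) elim(1,2) by (meson inj_onD)
      then have "z = z'" using sheet_eqD z(1,2) elim(3) slit_simps(3) by blast
      then show False using e(3) z by simp
    qed
    then show False using at_within_segment_nontrivial(2) by (simp add: eventually_False)
  qed
  then have "c = -1" using q[OF half] c[OF half] by auto
  then have eq: "?s w = - ?s' w" if "w \<in> ?I" for w
    using c[OF that] sq(2)[OF that] by (simp add: divide_eq_eq)
  have l1: "(?s \<longlongrightarrow> poly S v) (at 0 within ?I)" "(?s' \<longlongrightarrow> poly S v') (at 0 within ?I)"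
    using lim(2)[OF z(1)] lim(2)[OF z(2)] ends by (auto intro: tendsto_poly)
  have "(?s \<longlongrightarrow> - poly S v') (at 0 within ?I)"
    using tendsto_minus[OF l1(2)]
    by (rule Lim_transform_eventually) (use eq in \<open>auto simp: eventually_at_filter\<close>)
  then have "poly S v = - poly S v'"
    using l1(1) tendsto_unique at_within_segment_nontrivial(1) by blast
  then show ?thesis by simp
qed

end

section \<open>Plane trees with bivalent white vertices\<close>

text \<open>Bicolored plane trees without the condition on cycles: for the passport at hand,
  connectedness suffices for the classification.\<close>

definition connected_map :: "('v, 'e) bicolored_plane_graph \<Rightarrow> bool" where
  "connected_map G \<longleftrightarrow>
     finite (black G) \<and> finite (white G) \<and> finite (edges G) \<and> black G \<inter> white G = {} \<and>
     (\<forall>e \<in> edges G. black_end G e \<in> black G \<and> white_end G e \<in> white G) \<and>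
     (\<forall>v \<in> vertices G. cyclic_on (rot G v) (edges_at G v)) \<and> connected_graph G"

lemma bicolored_plane_tree_iff:
  "bicolored_plane_tree G \<longleftrightarrow> connected_map G \<and> (\<nexists>vs es. is_cycle G vs es)"
  by (auto simp: bicolored_plane_tree_def connected_map_def)

lemma cyclic_on_nonempty: "cyclic_on f S \<Longrightarrow> S \<noteq> {}"
  by (auto simp: cyclic_on_def)

lemma cyclic_on_in: "cyclic_on f S \<Longrightarrow> e \<in> S \<Longrightarrow> f e \<in> S"
  by (auto simp: cyclic_on_def intro: orbit.step)

lemma cyclic_on_closed_subset:
  assumes "cyclic_on f S" "A \<subseteq> S" "A \<noteq> {}" "\<And>x. x \<in> A \<Longrightarrow> f x \<in> A"
  shows "A = S"
proof -
  obtain s where s: "s \<in> S" "S = orbit f s" using assms(1) by (auto simp: cyclic_on_def)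
  obtain x where x: "x \<in> A" using assms(3) by blast
  have "y \<in> A" if "y \<in> orbit f x" for y using that by induction (use x assms(4) in auto)
  moreover have "orbit f x = orbit f s"
    using s x assms(2) by (metis orbit_swap orbit_trans subsetD subset_antisym subsetI)
  ultimately show ?thesis using s(2) assms(2) by blast
qed

lemma cyclic_on_1D: "cyclic_on f {a} \<Longrightarrow> f a = a"
  using cyclic_on_in by fastforce

lemma cyclic_on_2D:
  assumes "cyclic_on f {a, b}" "a \<noteq> b"
  shows "f a = b" "f b = a"
proof -
  have "f a \<noteq> a" using cyclic_on_closed_subset[OF assms(1), of "{a}"] assms(2) by auto
  moreover have "f b \<noteq> b" using cyclic_on_closed_subset[OF assms(1), of "{b}"] assms(2) by auto
  ultimately show "f a = b" "f b = a"
    using cyclic_on_in[OF assms(1), of a] cyclic_on_in[OF assms(1), of b] by auto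
qed

text \<open>A fixed point or a transposed pair would be a proper invariant subset; only the two
  3-cycles remain.\<close>

lemma cyclic_on_3D:
  assumes "cyclic_on f {a, b, c}" "distinct [a, b, c]"
  shows "f a = b \<and> f b = c \<and> f c = a \<or> f a = c \<and> f c = b \<and> f b = a"
proof -
  have 1: "f x \<noteq> x" if "x \<in> {a, b, c}" for x
    using cyclic_on_closed_subset[OF assms(1), of "{x}"] that assms(2) by auto
  have 2: "\<not> (f x = y \<and> f y = x)" if "x \<in> {a, b, c}" "y \<in> {a, b, c}" for x y
  proof
    assume "f x = y \<and> f y = x"
    then have "{x, y} = {a, b, c}"
      using cyclic_on_closed_subset[OF assms(1), of "{x, y}"] that by auto
    moreover have "card {x, y} \<le> 2" by (simp add: card_insert_if)
    moreover have "card {a, b, c} = 3" using assms(2) by simp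
    ultimately show False by simp
  qed
  have "f a \<in> {b, c}" "f b \<in> {a, c}" "f c \<in> {a, b}"
    using cyclic_on_in[OF assms(1)] 1 by blast+
  then show ?thesis using 2[of a b] 2[of a c] 2[of b c] by auto
qed

text \<open>A bijection of edges suffices: every vertex is an end of some edge, so it amounts to the
  class of edges that share it, and the vertex map is defined through a representative. The
  bijection starts from \<open>H\<close> because the edges of the model are list positions.\<close>

lemma plane_isomorphicI:
  fixes G :: "('v, 'e) bicolored_plane_graph" and H :: "('w, 'f) bicolored_plane_graph"
  assumes bij: "bij_betw h (edges H) (edges G)"
    and b: "\<And>e e'. e \<in> edges H \<Longrightarrow> e' \<in> edges H \<Longrightarrow>
      black_end G (h e) = black_end G (h e') \<longleftrightarrow> black_end H e = black_end H e'"
    and w: "\<And>e e'. e \<in> edges H \<Longrightarrow> e' \<in> edges H \<Longrightarrow>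
      white_end G (h e) = white_end G (h e') \<longleftrightarrow> white_end H e = white_end H e'"
    and G: "black G = black_end G ` edges G" "white G = white_end G ` edges G" "black G \<inter> white G = {}"
    and H: "black H = black_end H ` edges H" "white H = white_end H ` edges H" "black H \<inter> white H = {}"
    and rot: "\<And>e. e \<in> edges H \<Longrightarrow> rot H (black_end H e) e \<in> edges H"
      "\<And>e. e \<in> edges H \<Longrightarrow> rot H (white_end H e) e \<in> edges H"
      "\<And>e. e \<in> edges H \<Longrightarrow> rot G (black_end G (h e)) (h e) = h (rot H (black_end H e) e)"
      "\<And>e. e \<in> edges H \<Longrightarrow> rot G (white_end G (h e)) (h e) = h (rot H (white_end H e) e)"
  shows "plane_isomorphic G H"
proof -
  define \<psi> where "\<psi> = inv_into (edges H) h"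
  have \<psi>: "\<And>e. e \<in> edges H \<Longrightarrow> \<psi> (h e) = e" "bij_betw \<psi> (edges G) (edges H)"
    "\<And>e. e \<in> edges G \<Longrightarrow> \<psi> e \<in> edges H \<and> h (\<psi> e) = e"
  proof -
    show "\<psi> (h e) = e" if "e \<in> edges H" for e
      using bij that unfolding \<psi>_def by (simp add: bij_betw_def)
    show "bij_betw \<psi> (edges G) (edges H)"
      unfolding \<psi>_def by (rule bij_betw_inv_into[OF bij])
    show "\<psi> e \<in> edges H \<and> h (\<psi> e) = e" if "e \<in> edges G" for e
    proof -
      have "e \<in> h ` edges H" using bij that by (simp add: bij_betw_def)
      then show ?thesis unfolding \<psi>_def by (simp add: inv_into_into f_inv_into_f)
    qed
  qed
  define \<phi> where "\<phi> v = (if v \<in> black G then black_end H (\<psi> (SOME e. e \<in> edges G \<and> black_end G e = v))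
     else white_end H (\<psi> (SOME e. e \<in> edges G \<and> white_end G e = v)))" for v
  have \<phi>b: "\<phi> (black_end G e) = black_end H (\<psi> e)" if e: "e \<in> edges G" for e
  proof -
    obtain d where d: "(SOME e'. e' \<in> edges G \<and> black_end G e' = black_end G e) = d" by blast
    have "d \<in> edges G \<and> black_end G d = black_end G e"
      unfolding d[symmetric] by (rule someI[of _ e]) (use e in simp)
    then have "black_end H (\<psi> d) = black_end H (\<psi> e)"
      using b[of "\<psi> d" "\<psi> e"] \<psi>(3)[of d] \<psi>(3)[OF e] by simp
    moreover have "black_end G e \<in> black G" using e G(1) by simp
    ultimately show ?thesis by (simp add: \<phi>_def d)
  qed
  have \<phi>w: "\<phi> (white_end G e) = white_end H (\<psi> e)" if e: "e \<in> edges G" for e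
  proof -
    obtain d where d: "(SOME e'. e' \<in> edges G \<and> white_end G e' = white_end G e) = d" by blast
    have "d \<in> edges G \<and> white_end G d = white_end G e"
      unfolding d[symmetric] by (rule someI[of _ e]) (use e in simp)
    then have "white_end H (\<psi> d) = white_end H (\<psi> e)"
      using w[of "\<psi> d" "\<psi> e"] \<psi>(3)[of d] \<psi>(3)[OF e] by simp
    moreover have "white_end G e \<notin> black G" using e G(2,3) by blast
    ultimately show ?thesis by (simp add: \<phi>_def d)
  qed
  have im: "\<psi> ` edges G = edges H" using \<psi>(2) by (simp add: bij_betw_def)
  have bb: "bij_betw \<phi> (black G) (black H)"
  proof (rule bij_betw_imageI)
    show "inj_on \<phi> (black G)"
    proof (rule inj_onI)
      fix u v assume "u \<in> black G" "v \<in> black G" and eq: "\<phi> u = \<phi> v"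
      then obtain d e where de: "d \<in> edges G" "u = black_end G d" "e \<in> edges G" "v = black_end G e"
        using G(1) by blast
      then have "black_end H (\<psi> d) = black_end H (\<psi> e)" using eq \<phi>b by simp
      then show "u = v" using b[of "\<psi> d" "\<psi> e"] \<psi>(3)[OF de(1)] \<psi>(3)[OF de(3)] de by simp
    qed
    have "\<phi> ` black G = (\<lambda>e. \<phi> (black_end G e)) ` edges G" unfolding G(1) by (simp only: image_image)
    also have "\<dots> = (\<lambda>e. black_end H (\<psi> e)) ` edges G" using \<phi>b by (intro image_cong refl)
    also have "\<dots> = black_end H ` \<psi> ` edges G" by (simp only: image_image)
    finally show "\<phi> ` black G = black H" unfolding im H(1) .
  qed
  have bw: "bij_betw \<phi> (white G) (white H)"
  proof (rule bij_betw_imageI)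
    show "inj_on \<phi> (white G)"
    proof (rule inj_onI)
      fix u v assume "u \<in> white G" "v \<in> white G" and eq: "\<phi> u = \<phi> v"
      then obtain d e where de: "d \<in> edges G" "u = white_end G d" "e \<in> edges G" "v = white_end G e"
        using G(2) by blast
      then have "white_end H (\<psi> d) = white_end H (\<psi> e)" using eq \<phi>w by simp
      then show "u = v" using w[of "\<psi> d" "\<psi> e"] \<psi>(3)[OF de(1)] \<psi>(3)[OF de(3)] de by simp
    qed
    have "\<phi> ` white G = (\<lambda>e. \<phi> (white_end G e)) ` edges G" unfolding G(2) by (simp only: image_image)
    also have "\<dots> = (\<lambda>e. white_end H (\<psi> e)) ` edges G" using \<phi>w by (intro image_cong refl)
    also have "\<dots> = white_end H ` \<psi> ` edges G" by (simp only: image_image)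
    finally show "\<phi> ` white G = white H" unfolding im H(2) .
  qed
  have rr: "\<psi> (rot G v e) = rot H (\<phi> v) (\<psi> e)" if "e \<in> edges_at G v" for v e
  proof -
    have e: "e \<in> edges G" and v: "v = black_end G e \<or> v = white_end G e"
      using that by (auto simp: edges_at_def)
    from v show ?thesis
    proof
      assume v: "v = black_end G e"
      then have "rot G v e = h (rot H (black_end H (\<psi> e)) (\<psi> e))" using rot(3)[of "\<psi> e"] \<psi>(3)[OF e] by simp
      then show ?thesis using \<psi>(1) rot(1)[of "\<psi> e"] \<psi>(3)[OF e] \<phi>b[OF e] v by simp
    next
      assume v: "v = white_end G e"
      then have "rot G v e = h (rot H (white_end H (\<psi> e)) (\<psi> e))" using rot(4)[of "\<psi> e"] \<psi>(3)[OF e] by simp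
      then show ?thesis using \<psi>(1) rot(2)[of "\<psi> e"] \<psi>(3)[OF e] \<phi>w[OF e] v by simp
    qed
  qed
  show ?thesis
    unfolding plane_isomorphic_def
    by (intro exI[of _ \<phi>] exI[of _ \<psi>] conjI ballI bb bw rr \<psi>(2) \<phi>b[symmetric] \<phi>w[symmetric])
qed

section \<open>Two explicit trees given by tables\<close>

text \<open>Edges \<open>2 * i\<close> and \<open>2 * i + 1\<close> share the white vertex
  \<open>6 + i\<close>, where the rotation exchanges them. Only the black side needs data:
  \<open>bl\<close> lists the black ends and \<open>nx\<close> the next edge around the black
  end.\<close>

definition shape :: "nat list \<Rightarrow> nat list \<Rightarrow> (nat, nat) bicolored_plane_graph" where
  "shape bl nx =
     \<lparr> black = {0..<6}, white = {6..<11}, edges = {0..<10},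
       black_end = (\<lambda>e. bl ! e), white_end = (\<lambda>e. 6 + e div 2),
       rot = (\<lambda>v e. if v < 6 then nx ! e else if even e then Suc e else e - 1) \<rparr>"

lemma shape_simps [simp]:
  "black (shape bl nx) = {0..<6}" "white (shape bl nx) = {6..<11}" "edges (shape bl nx) = {0..<10}"
  "black_end (shape bl nx) e = bl ! e" "white_end (shape bl nx) e = 6 + e div 2"
  "rot (shape bl nx) v e = (if v < 6 then nx ! e else if even e then Suc e else e - 1)"
  by (simp_all add: shape_def)

text \<open>The tree whose trivalent vertex carries legs with 2, 2 and 1 further black vertices.\<close>

definition tree221 :: "(nat, nat) bicolored_plane_graph" where
  "tree221 = shape [0,1,1,2,0,3,3,4,0,5] [4,2,1,3,8,6,5,7,0,9]"

text \<open>Here the legs carry 3, 1 and 1 further black vertices. As in \<open>tree221\<close>, the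
  numbering grows outwards: the white vertex \<open>6 + i\<close> joins some black vertex up to
  \<open>i\<close> to the new black vertex \<open>i + 1\<close>.\<close>

definition tree311 :: "(nat, nat) bicolored_plane_graph" where
  "tree311 = shape [0,1,1,2,2,3,0,4,0,5] [6,2,1,4,3,5,8,7,0,9]"

lemma edges_at_shape:
  "edges_at (shape bl nx) v = set (filter (\<lambda>e. bl ! e = v \<or> 6 + e div 2 = v) [0..<10])"
  by (auto simp: edges_at_def)

lemma degree_shape:
  "vertex_degree (shape bl nx) v = length (filter (\<lambda>e. bl ! e = v \<or> 6 + e div 2 = v) [0..<10])"
  unfolding vertex_degree_def edges_at_shape by (rule distinct_card) simp

lemma upt_10: "[0..<10] = [0,1,2,3,4,5,6,7,8,9::nat]"
  by (simp add: upt_rec)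

lemma upt_6: "[0..<6] = [0,1,2,3,4,5::nat]"
  by (simp add: upt_rec)

lemma upt_6_11: "[6..<11] = [6,7,8,9,10::nat]"
  by (simp add: upt_rec)

lemma passport_shape:
  "passport (shape bl nx) = (mset (map (vertex_degree (shape bl nx)) [0..<6]),
     mset (map (vertex_degree (shape bl nx)) [6..<11]), 10)"
proof -
  have *: "mset_set {a..<b} = mset [a..<b]" for a b :: nat by simp
  show ?thesis unfolding passport_def shape_simps * by simp
qed

lemma degrees_trees:
  "map (vertex_degree tree221) [0..<6] = [3, 2, 1, 2, 1, 1]"
  "map (vertex_degree tree311) [0..<6] = [3, 2, 2, 1, 1, 1]"
  "map (vertex_degree tree221) [6..<11] = [2, 2, 2, 2, 2]"
  "map (vertex_degree tree311) [6..<11] = [2, 2, 2, 2, 2]"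
  unfolding tree221_def tree311_def degree_shape upt_10 upt_6 upt_6_11 by simp_all

lemma passport_trees:
  "passport tree221 = ({#3, 2, 2, 1, 1, 1#}, {#2, 2, 2, 2, 2#}, 10)"
  "passport tree311 = ({#3, 2, 2, 1, 1, 1#}, {#2, 2, 2, 2, 2#}, 10)"
proof -
  show "passport tree221 = ({#3, 2, 2, 1, 1, 1#}, {#2, 2, 2, 2, 2#}, 10)"
    using degrees_trees(1,3) unfolding tree221_def passport_shape by (simp del: upt_rec_numeral)
  show "passport tree311 = ({#3, 2, 2, 1, 1, 1#}, {#2, 2, 2, 2, 2#}, 10)"
    using degrees_trees(2,4) unfolding tree311_def passport_shape by (simp del: upt_rec_numeral)
qed

text \<open>By injectivity each vertex is the higher end of at most one edge, whereas the highest
  vertex of a cycle is the higher end of both its cycle edges.\<close>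

lemma no_cycleI:
  fixes rank :: "'v \<Rightarrow> nat"
  assumes inj: "inj_on (\<lambda>e. if rank (black_end G e) < rank (white_end G e) then white_end G e else black_end G e) (edges G)"
    and ne: "\<And>e. e \<in> edges G \<Longrightarrow> rank (black_end G e) \<noteq> rank (white_end G e)"
  shows "\<not> is_cycle G vs es"
proof
  assume "is_cycle G vs es"
  then have c: "2 \<le> length es" "length vs = length es" "distinct es" "set es \<subseteq> edges G"
    "\<And>i. i < length es \<Longrightarrow> {black_end G (es ! i), white_end G (es ! i)} = {vs ! i, vs ! (Suc i mod length es)}"
    by (auto simp: is_cycle_def)
  let ?n = "length es"
  let ?top = "\<lambda>e. if rank (black_end G e) < rank (white_end G e) then white_end G e else black_end G e"
  obtain i where i: "i < ?n" "\<And>j. j < ?n \<Longrightarrow> rank (vs ! j) \<le> rank (vs ! i)"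
  proof -
    let ?R = "(\<lambda>j. rank (vs ! j)) ` {..<?n}"
    have "0 \<in> {..<?n}" using c(1) by auto
    then have "?R \<noteq> {}" by blast
    then have "Max ?R \<in> ?R" by (intro Max_in) simp_all
    then obtain i where i: "i < ?n" "Max ?R = rank (vs ! i)" by auto
    have "rank (vs ! j) \<le> rank (vs ! i)" if "j < ?n" for j
      unfolding i(2)[symmetric] using that by (intro Max_ge) simp_all
    then show ?thesis using that i(1) by blast
  qed
  \<comment> \<open>The cyclic predecessor of \<open>i\<close>; it differs from \<open>i\<close>
    because a cycle has length at least 2.\<close>
  define j where "j = (if i = 0 then ?n - 1 else i - 1)"
  have j: "j < ?n" "Suc j mod ?n = i" "j \<noteq> i" using i(1) c(1) by (auto simp: j_def)
  have top: "?top e = v" if "e \<in> edges G" "{black_end G e, white_end G e} = {v, u}" "rank u \<le> rank v" for e u v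
    using that ne[of e] by (auto simp: doubleton_eq_iff)
  have "Suc i mod ?n < ?n" using c(1) by (intro mod_less_divisor) linarith
  then have "?top (es ! i) = vs ! i"
    using i(1) i(2)[of "Suc i mod ?n"] c(4) c(5)[OF i(1)] by (intro top[of _ _ "vs ! (Suc i mod ?n)"]) (auto intro: nth_mem)
  moreover have "?top (es ! j) = vs ! i"
    using i j c(4) c(5)[OF j(1)] by (intro top[of _ _ "vs ! j"]) (auto intro: nth_mem simp: insert_commute)
  ultimately have "es ! i = es ! j"
    using c(4) i(1) j(1) by (intro inj_onD[OF inj]) (simp_all add: subset_iff)
  then show False using c(3) i(1) j(1,3) by (simp add: nth_eq_iff_index_eq)
qed

lemma adjacency_sym: "sym (adjacency G)"
  by (auto simp: adjacency_def sym_def insert_commute)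

lemma edge_adjacent:
  assumes "e \<in> edges G"
  shows "(black_end G e, white_end G e) \<in> adjacency G" "(white_end G e, black_end G e) \<in> adjacency G"
  using assms by (auto simp: adjacency_def)

lemma cyclic_on_rotate1:
  assumes "xs \<noteq> []" "map f xs = rotate1 xs"
  shows "cyclic_on f (set xs)"
proof -
  have "f (xs ! i) = xs ! (Suc i mod length xs)" if "i < length xs" for i
    using assms(2) that by (metis nth_map nth_rotate1)
  then have "cyclic_on f ((!) xs ` {..<length xs})"
    using assms(1) by (intro cyclic_on_index) simp_all
  moreover have "(!) xs ` {..<length xs} = set xs" by (auto simp: set_conv_nth)
  ultimately show ?thesis by simp
qed

text \<open>Turns cyclicity into a condition on the tables that can be evaluated: the successors of
  the edges at a vertex, listed in increasing order of the edges, form the same list rotated by one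
  place.\<close>

lemma shape_cyclic:
  assumes "list_all (\<lambda>v. let xs = filter (\<lambda>e. bl ! e = v \<or> 6 + e div 2 = v) [0..<10] in
      xs \<noteq> [] \<and> map (\<lambda>e. if v < 6 then nx ! e else if even e then Suc e else e - 1) xs = rotate1 xs) [0..<11]"
    and "v \<in> vertices (shape bl nx)"
  shows "cyclic_on (rot (shape bl nx) v) (edges_at (shape bl nx) v)"
proof -
  have "v \<in> set [0..<11]" using assms(2) by (auto simp: vertices_def)
  note * = bspec[OF assms(1)[unfolded list_all_iff Let_def] this]
  have "rot (shape bl nx) v = (\<lambda>e. if v < 6 then nx ! e else if even e then Suc e else e - 1)"
    by (rule ext) simp
  then show ?thesis unfolding edges_at_shape using * by (intro cyclic_on_rotate1) simp_all
qed

lemma connected_graphI: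
  assumes "u \<in> vertices G" "\<And>v. v \<in> vertices G \<Longrightarrow> (u, v) \<in> (adjacency G)\<^sup>*"
  shows "connected_graph G"
  unfolding connected_graph_def
proof (intro conjI ballI)
  show "vertices G \<noteq> {}" using assms(1) by blast
  fix v w assume "v \<in> vertices G" "w \<in> vertices G"
  note vw = assms(2)[OF this(1)] assms(2)[OF this(2)]
  show "(v, w) \<in> (adjacency G)\<^sup>*"
    by (rule rtrancl_trans[OF symD[OF sym_rtrancl[OF adjacency_sym] vw(1)] vw(2)])
qed

text \<open>By induction on the numbering: the black vertex \<open>i + 1\<close> hangs, through the
  white vertex \<open>6 + i\<close>, on a black vertex already reached.\<close>

lemma shape_reachable:
  assumes "\<And>i. i < 5 \<Longrightarrow> bl ! (2 * i) \<le> i \<and> bl ! Suc (2 * i) = Suc i"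
    and "v \<in> vertices (shape bl nx)"
  shows "(0, v) \<in> (adjacency (shape bl nx))\<^sup>*"
proof -
  let ?T = "shape bl nx"
  let ?r = "\<lambda>v. (0, v) \<in> (adjacency ?T)\<^sup>*"
  have step: "?r (bl ! e) \<longleftrightarrow> ?r (6 + e div 2)" if "e < 10" for e
  proof -
    have "(bl ! e, 6 + e div 2) \<in> adjacency ?T" "(6 + e div 2, bl ! e) \<in> adjacency ?T"
      using edge_adjacent[of e ?T] that by simp_all
    then show ?thesis using rtrancl_into_rtrancl[of 0 _ "adjacency ?T"] by blast
  qed
  have w: "?r (6 + i)" if "i < 5" "\<And>j. j \<le> i \<Longrightarrow> ?r j" for i
    using step[of "2 * i"] that assms(1)[of i] by simp
  have b: "?r i" if "i < 6" for i
    using that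
  proof (induction i rule: less_induct)
    case (less i)
    show ?case
    proof (cases i)
      case (Suc k)
      have "?r (6 + k)" using less Suc by (intro w) auto
      then show ?thesis using step[of "Suc (2 * k)"] assms(1)[of k] less.prems Suc by simp
    qed simp
  qed
  show ?thesis
  proof (cases "v < 6")
    case False
    then have "?r (6 + (v - 6))" using assms(2) b by (intro w) (auto simp: vertices_def)
    then show ?thesis using False by simp
  qed (rule b)
qed

lemma trees_are_trees: "bicolored_plane_tree tree221" "bicolored_plane_tree tree311"
proof -
  have *: "bicolored_plane_tree T" if T: "T = shape bl nx"
    and bl: "\<And>e. e < 10 \<Longrightarrow> bl ! e < 6"
    and cyc: "list_all (\<lambda>v. let xs = filter (\<lambda>e. bl ! e = v \<or> 6 + e div 2 = v) [0..<10] in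
      xs \<noteq> [] \<and> map (\<lambda>e. if v < 6 then nx ! e else if even e then Suc e else e - 1) xs = rotate1 xs) [0..<11]"
    and rank: "list_all (\<lambda>e. if even e then bl ! e \<le> e div 2 else bl ! e = Suc e div 2) [0..<10]"
    for T bl nx
  proof -
    \<comment> \<open>Interleaves the colors: black \<open>i\<close> gets rank \<open>2 * i\<close>
      and white \<open>6 + i\<close> gets \<open>2 * i + 1\<close>, so the white vertex lies above
      the inner end of its even edge and below the outer end of its odd edge.\<close>
    define rk where "rk v = (if v < 6 then 2 * v else 2 * v - 11)" for v :: nat
    have rank': "if even e then bl ! e \<le> e div 2 else bl ! e = Suc e div 2" if "e < 10" for e
      using rank that by (simp add: list_all_iff)
    have top: "(if rk (bl ! e) < rk (6 + e div 2) then 6 + e div 2 else bl ! e) =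
        (if even e then 6 + e div 2 else Suc e div 2) \<and> rk (bl ! e) \<noteq> rk (6 + e div 2)" if "e < 10" for e
      using rank'[OF that] bl[OF that] by (auto simp: rk_def elim!: evenE oddE)
    have "\<not> is_cycle T vs es" for vs es
    proof (rule no_cycleI[where rank = rk])
      show "inj_on (\<lambda>e. if rk (black_end T e) < rk (white_end T e) then white_end T e else black_end T e) (edges T)"
      proof (rule inj_onI)
        fix d e assume "d \<in> edges T" "e \<in> edges T"
        then have de: "d < 10" "e < 10" using T by auto
        assume "(if rk (black_end T d) < rk (white_end T d) then white_end T d else black_end T d) =
          (if rk (black_end T e) < rk (white_end T e) then white_end T e else black_end T e)"
        then have "(if even d then 6 + d div 2 else Suc d div 2) = (if even e then 6 + e div 2 else Suc e div 2)"
          unfolding T shape_simps top[OF de(1), THEN conjunct1] top[OF de(2), THEN conjunct1] .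
        then show "d = e" using de by (auto split: if_splits elim!: evenE oddE)
      qed
      show "rk (black_end T e) \<noteq> rk (white_end T e)" if "e \<in> edges T" for e
        using top[of e] that T by simp
    qed
    moreover have "connected_map T"
      unfolding connected_map_def
    proof (intro conjI)
      show "connected_graph T"
        unfolding T
      proof (rule connected_graphI[of 0])
        show "(0, v) \<in> (adjacency (shape bl nx))\<^sup>*" if "v \<in> vertices (shape bl nx)" for v
          using that rank'[of "2 * _"] rank'[of "Suc (2 * _)"] by (intro shape_reachable) auto
      qed (simp add: vertices_def)
      show "\<forall>v\<in>vertices T. cyclic_on (rot T v) (edges_at T v)"
        unfolding T using shape_cyclic[OF cyc] by blast
    qed (use T bl in auto)
    ultimately show ?thesis by (simp add: bicolored_plane_tree_iff)
  qed
  have le: "xs ! e < 6" if "list_all (\<lambda>x. x < 6) xs" "length xs = 10" "e < 10" for xs :: "nat list" and e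
    using that by (simp add: list_all_length)
  show "bicolored_plane_tree tree221"
    by (rule *[OF tree221_def], simp, rule le, simp, simp, simp, code_simp, code_simp)
  show "bicolored_plane_tree tree311"
    by (rule *[OF tree311_def], simp, rule le, simp, simp, simp, code_simp, code_simp)
qed

text \<open>Reduces an isomorphism with a \<open>shape\<close> to equations between explicit lists.
  The rotation at a white vertex is not among them: on two edges there is only one cyclic
  order.\<close>

lemma plane_isomorphic_shapeI:
  assumes G: "connected_map G" and "\<And>v. v \<in> vertices G \<Longrightarrow> edges_at G v \<noteq> {}"
    and opp: "\<And>e. e \<in> edges G \<Longrightarrow> opp e \<noteq> e \<and> {e' \<in> edges G. white_end G e' = white_end G e} = {e, opp e}"
    and es: "length es = 10" "distinct es" "set es = edges G"
    and vs: "length vs = 6" "distinct vs" "map (black_end G) es = map (\<lambda>i. vs ! i) bl"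
    and bl: "length bl = 10" "set bl = {0..<6}" and nx: "length nx = 10" "\<forall>i\<in>set nx. i < 10"
    and sw: "map opp es = map (\<lambda>i. es ! (if even i then Suc i else i - 1)) [0..<10]"
    and rot: "map (\<lambda>e. rot G (black_end G e) e) es = map (\<lambda>i. es ! i) nx"
  shows "plane_isomorphic G (shape bl nx)"
proof (rule plane_isomorphicI)
  let ?H = "shape bl nx" and ?h = "\<lambda>i. es ! i" and ?s = "\<lambda>i. if even i then Suc i else i - (1::nat)"
  have mem: "es ! i \<in> edges G" if "i < 10" for i using es that nth_mem by metis
  have bl_nth: "black_end G (es ! i) = vs ! (bl ! i)" "bl ! i < 6" if "i < 10" for i
  proof -
    show "black_end G (es ! i) = vs ! (bl ! i)"
      using arg_cong[OF vs(3), of "\<lambda>l. l ! i"] that es(1) bl(1) by simp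
    have "bl ! i \<in> set bl" using that bl(1) by simp
    then show "bl ! i < 6" using bl(2) by simp
  qed
  have s: "?s i < 10" if "i < 10" for i using that by (auto elim!: evenE)
  have opp_nth: "opp (es ! i) = es ! ?s i" if "i < 10" for i
    using arg_cong[OF sw, of "\<lambda>l. l ! i"] that es(1) by simp
  have rot_nth: "rot G (black_end G (es ! i)) (es ! i) = es ! (nx ! i)" "nx ! i < 10" if "i < 10" for i
    using arg_cong[OF rot, of "\<lambda>l. l ! i"] that es(1) nx by simp_all
  show "bij_betw ?h (edges ?H) (edges G)"
    using es by (intro bij_betw_nth) auto
  show "black_end G (?h e) = black_end G (?h e') \<longleftrightarrow> black_end ?H e = black_end ?H e'"
    if "e \<in> edges ?H" "e' \<in> edges ?H" for e e'
    using that bl_nth vs by (simp add: nth_eq_iff_index_eq)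
  show "white_end G (?h e) = white_end G (?h e') \<longleftrightarrow> white_end ?H e = white_end ?H e'"
    if "e \<in> edges ?H" "e' \<in> edges ?H" for e e'
  proof -
    have e: "e < 10" "e' < 10" using that by auto
    have "white_end G (?h e) = white_end G (?h e') \<longleftrightarrow> ?h e' \<in> {?h e, opp (?h e)}"
    proof -
      have "?h e' \<in> {d \<in> edges G. white_end G d = white_end G (?h e)} \<longleftrightarrow> ?h e' \<in> {?h e, opp (?h e)}"
        using opp[OF mem[OF e(1)]] by (simp only:)
      then show ?thesis using mem[OF e(2)] unfolding mem_Collect_eq by metis
    qed
    also have "\<dots> \<longleftrightarrow> e' = e \<or> e' = ?s e"
      using opp_nth[OF e(1)] es e s[OF e(1)] by (simp add: nth_eq_iff_index_eq del: One_nat_def)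
    also have "\<dots> \<longleftrightarrow> e div 2 = e' div 2" by (auto elim!: evenE oddE split: if_splits)
    finally show ?thesis by simp
  qed
  have ends: "\<And>e. e \<in> edges G \<Longrightarrow> black_end G e \<in> black G" "\<And>e. e \<in> edges G \<Longrightarrow> white_end G e \<in> white G"
    and disj: "black G \<inter> white G = {}"
    using G by (auto simp: connected_map_def)
  show "black G \<inter> white G = {}" by fact
  show "black G = black_end G ` edges G"
  proof (intro equalityI subsetI)
    fix v assume v: "v \<in> black G"
    then obtain e where "e \<in> edges_at G v" using assms(2)[of v] by (auto simp: vertices_def)
    then show "v \<in> black_end G ` edges G" using v disj ends by (auto simp: edges_at_def)
  qed (use ends in auto)
  show "white G = white_end G ` edges G"
  proof (intro equalityI subsetI)
    fix v assume v: "v \<in> white G"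
    then obtain e where "e \<in> edges_at G v" using assms(2)[of v] by (auto simp: vertices_def)
    then show "v \<in> white_end G ` edges G" using v disj ends by (auto simp: edges_at_def)
  qed (use ends in auto)
  show "black ?H = black_end ?H ` edges ?H"
  proof -
    have "set bl = (\<lambda>i. bl ! i) ` {0..<10}" using bl(1) by (auto simp: set_conv_nth)
    then show ?thesis using bl(2) by simp
  qed
  show "white ?H = white_end ?H ` edges ?H"
  proof -
    have "v \<in> (\<lambda>e. 6 + e div 2) ` {0..<10}" if "v \<in> {6..<11}" for v :: nat
      using that by (intro image_eqI[of _ _ "2 * (v - 6)"]) auto
    then show ?thesis by auto
  qed
  show "black ?H \<inter> white ?H = {}" by auto
  fix e assume "e \<in> edges ?H"
  then have e: "e < 10" by simp
  have w: "\<not> white_end ?H e < 6" by simp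
  show "rot ?H (black_end ?H e) e \<in> edges ?H" using bl_nth(2)[OF e] rot_nth(2)[OF e] by simp
  show "rot ?H (white_end ?H e) e \<in> edges ?H" using s[OF e] by simp
  show "rot G (black_end G (?h e)) (?h e) = ?h (rot ?H (black_end ?H e) e)"
    using bl_nth(2)[OF e] rot_nth(1)[OF e] by simp
  have v: "white_end G (?h e) \<in> white G" using ends(2) mem[OF e] by blast
  have "edges_at G (white_end G (?h e)) = {e' \<in> edges G. white_end G e' = white_end G (?h e)}"
  proof -
    have "black_end G d \<noteq> white_end G (?h e)" if "d \<in> edges G" for d
      using ends(1)[OF that] v disj by (metis disjoint_iff)
    then show ?thesis by (auto simp: edges_at_def)
  qed
  also have "\<dots> = {?h e, opp (?h e)}" using opp[OF mem[OF e]] by blast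
  finally have star: "edges_at G (white_end G (?h e)) = {?h e, opp (?h e)}" .
  have "white_end G (?h e) \<in> vertices G" using v by (simp add: vertices_def)
  then have "cyclic_on (rot G (white_end G (?h e))) (edges_at G (white_end G (?h e)))"
    using G unfolding connected_map_def by blast
  then have "cyclic_on (rot G (white_end G (?h e))) {?h e, opp (?h e)}" unfolding star .
  then have "rot G (white_end G (?h e)) (?h e) = opp (?h e)"
    using opp[OF mem[OF e]] by (intro cyclic_on_2D(1)) auto
  then show "rot G (white_end G (?h e)) (?h e) = ?h (rot ?H (white_end ?H e) e)"
    using opp_nth[OF e] by simp
qed

section \<open>Pairings of the edges at the black vertices\<close>

lemma card_1_with: "card A = 1 \<Longrightarrow> u \<in> A \<Longrightarrow> A = {u}"
  by (metis card_1_singletonE singletonD)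

lemma card_2_with: "card A = 2 \<Longrightarrow> u \<in> A \<Longrightarrow> \<exists>v. v \<noteq> u \<and> A = {u, v}"
  by (auto simp: card_2_iff)

lemma card_3_with2:
  assumes "card A = 3" "u \<in> A" "v \<in> A" "u \<noteq> v"
  shows "\<exists>w. distinct [u, v, w] \<and> A = {u, v, w}"
proof -
  have "card (A - {u, v}) = 1" using assms card_Diff_subset[of "{u, v}" A] by simp
  then obtain w where "A - {u, v} = {w}" by (rule card_1_singletonE)
  then show ?thesis using assms(2-4) by (intro exI[of _ w]) auto
qed

lemma card_3_with3:
  assumes "card A = 3" "u \<in> A" "v \<in> A" "w \<in> A" "distinct [u, v, w]"
  shows "A = {u, v, w}"
  using assms card_3_with2[of A u v] by auto

text \<open>The combinatorics left when every white vertex has degree 2: \<open>opp\<close> pairs the two edges at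
  each white vertex.\<close>

locale edge_pairing =
  fixes E :: "'e set" and opp :: "'e \<Rightarrow> 'e" and bl :: "'e \<Rightarrow> 'v" and a p q x y z :: 'v
  assumes fin: "finite E"
    and opp: "e \<in> E \<Longrightarrow> opp e \<in> E" "e \<in> E \<Longrightarrow> opp e \<noteq> e" "e \<in> E \<Longrightarrow> opp (opp e) = e"
    and bl: "e \<in> E \<Longrightarrow> bl e \<in> {a, p, q, x, y, z}"
    and dist: "distinct [a, p, q, x, y, z]"
    and card: "card {e \<in> E. bl e = a} = 3" "card {e \<in> E. bl e = p} = 2" "card {e \<in> E. bl e = q} = 2"
      "card {e \<in> E. bl e = x} = 1" "card {e \<in> E. bl e = y} = 1" "card {e \<in> E. bl e = z} = 1"
    and conn: "S \<subseteq> E \<Longrightarrow> S \<noteq> {} \<Longrightarrow> (\<And>e. e \<in> S \<Longrightarrow> opp e \<in> S) \<Longrightarrow>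
      (\<And>e e'. e \<in> S \<Longrightarrow> e' \<in> E \<Longrightarrow> bl e' = bl e \<Longrightarrow> e' \<in> S) \<Longrightarrow> S = E"
begin

text \<open>Agreement with a \<open>shape\<close> in everything but the rotation: \<open>tbl\<close>
  is the table of black ends, and partners occupy positions \<open>2 * i\<close> and
  \<open>2 * i + 1\<close>.\<close>

definition matches :: "nat list \<Rightarrow> bool" where
  "matches tbl \<longleftrightarrow> (\<exists>es vs. length es = 10 \<and> distinct es \<and> set es = E \<and> length vs = 6 \<and> distinct vs \<and>
     map bl es = map (\<lambda>i. vs ! i) tbl \<and>
     map opp es = map (\<lambda>i. es ! (if even i then Suc i else i - 1)) [0..<10])"

lemma card_E: "card E = 10"
proof -
  have "E = (\<Union>v\<in>{a, p, q, x, y, z}. {e \<in> E. bl e = v})" using bl by blast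
  moreover have "card (\<Union>v\<in>{a, p, q, x, y, z}. {e \<in> E. bl e = v}) = (\<Sum>v\<in>{a, p, q, x, y, z}. card {e \<in> E. bl e = v})"
    using fin by (intro card_UN_disjoint) auto
  moreover have "\<dots> = 10" using dist card by simp
  ultimately show ?thesis by simp
qed

lemma matchesI:
  assumes "length es = 10" "E \<subseteq> set es" "set es \<subseteq> E" "length vs = 6" "distinct vs"
    "map bl es = map (\<lambda>i. vs ! i) tbl"
    "map opp es = map (\<lambda>i. es ! (if even i then Suc i else i - 1)) [0..<10]"
  shows "matches tbl"
proof -
  have "set es = E" using assms by blast
  then have "distinct es" using card_E assms(1) by (intro card_distinct) simp
  then show ?thesis using assms \<open>set es = E\<close> unfolding matches_def by blast
qed

text \<open>Serves to exclude ends: once the partners of all edges at \<open>v\<close> are known,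
  the partner of any other edge cannot be at \<open>v\<close>.\<close>

lemma opp_fibre: "{e \<in> E. bl e = v} = L \<Longrightarrow> e \<in> E \<Longrightarrow> bl (opp e) = v \<Longrightarrow> e \<in> opp ` L"
proof -
  assume "{e \<in> E. bl e = v} = L" "e \<in> E" "bl (opp e) = v"
  then have "opp e \<in> L" using opp(1) by blast
  moreover have "e = opp (opp e)" using opp(3) \<open>e \<in> E\<close> by simp
  ultimately show "e \<in> opp ` L" by (rule rev_image_eqI)
qed

text \<open>The form in which connectedness is applied: a set of black vertices that is closed under
  passing through white vertices and omits one of the six gives a contradiction.\<close>

lemma all_black_reached:
  assumes "e0 \<in> E" "bl e0 \<in> W" "\<And>e. e \<in> E \<Longrightarrow> bl e \<in> W \<Longrightarrow> bl (opp e) \<in> W"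
  shows "a \<in> W" "p \<in> W" "q \<in> W" "x \<in> W" "y \<in> W" "z \<in> W"
proof -
  have "{e \<in> E. bl e \<in> W} = E"
    using assms opp(1) by (intro conn) auto
  then have *: "v \<in> W" if "card {e \<in> E. bl e = v} \<noteq> 0" for v
    using that by (metis (mono_tags, lifting) card.empty empty_Collect_eq mem_Collect_eq)
  show "a \<in> W" "p \<in> W" "q \<in> W" "x \<in> W" "y \<in> W" "z \<in> W"
    by (rule *, simp add: card)+
qed

lemma vertices_distinct:
  "a \<noteq> p" "a \<noteq> q" "a \<noteq> x" "a \<noteq> y" "a \<noteq> z" "p \<noteq> q" "p \<noteq> x" "p \<noteq> y" "p \<noteq> z"
  "q \<noteq> x" "q \<noteq> y" "q \<noteq> z" "x \<noteq> y" "x \<noteq> z" "y \<noteq> z"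
  "p \<noteq> a" "q \<noteq> a" "x \<noteq> a" "y \<noteq> a" "z \<noteq> a" "q \<noteq> p" "x \<noteq> p" "y \<noteq> p" "z \<noteq> p"
  "x \<noteq> q" "y \<noteq> q" "z \<noteq> q" "y \<noteq> x" "z \<noteq> x" "z \<noteq> y"
  using dist by auto

text \<open>Two leaves joined to each other would make up a whole component.\<close>

lemma leaves_not_paired:
  assumes e: "e \<in> E" "bl e \<in> {y, z}"
  shows "bl (opp e) \<notin> {y, z}"
proof
  assume *: "bl (opp e) \<in> {y, z}"
  obtain y1 where Y: "{e \<in> E. bl e = y} = {y1}" using card(5) by (rule card_1_singletonE)
  obtain z1 where Z: "{e \<in> E. bl e = z} = {z1}" using card(6) by (rule card_1_singletonE)
  have y1: "y1 \<in> E" "bl y1 = y" using Y by blast+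
  have "opp e \<noteq> e" "opp e \<in> E" using opp e(1) by blast+
  then have "opp e = y1 \<or> opp e = z1" using * Y Z by blast
  moreover have "e = y1 \<or> e = z1" using e Y Z by blast
  ultimately have cl: "{e, opp e} = {y1, z1}" using \<open>opp e \<noteq> e\<close> by auto
  have "q \<in> {y, z}"
  proof (rule all_black_reached(3)[of y1])
    fix d assume d: "d \<in> E" "bl d \<in> {y, z}"
    then have "d \<in> {y1, z1}" using Y Z by blast
    then have "d = e \<or> d = opp e" using cl by blast
    then show "bl (opp d) \<in> {y, z}" using * e(2) opp(3)[OF e(1)] by auto
  qed (use y1 in auto)
  then show False using vertices_distinct by simp
qed

text \<open>With two legs \<open>x\<close>-\<open>p\<close> and \<open>y\<close>-\<open>q\<close>,
  the first of them attached to \<open>a\<close>, the rest is forced: the free edge at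
  \<open>q\<close> must lead to \<open>a\<close>, and the third edge at \<open>a\<close> is left for
  \<open>z\<close>.\<close>

lemma matches_of_two_legs:
  assumes x1: "x1 \<in> E" "bl x1 = x" "bl (opp x1) = p"
    and y1: "y1 \<in> E" "bl y1 = y" "bl (opp y1) = q"
    and p2: "p2 \<in> E" "bl p2 = p" "p2 \<noteq> opp x1" "bl (opp p2) = a"
  shows "matches [0,1,1,2,0,3,3,4,0,5]"
proof -
  note V = vertices_distinct
  define p1 where "p1 = opp x1"
  define q1 where "q1 = opp y1"
  define a1 where "a1 = opp p2"
  have m: "p1 \<in> E" "q1 \<in> E" "a1 \<in> E" using opp(1) x1 y1 p2 by (simp_all add: p1_def q1_def a1_def)
  have b: "bl p1 = p" "bl q1 = q" "bl a1 = a" using x1 y1 p2 by (simp_all add: p1_def q1_def a1_def)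
  have o: "opp x1 = p1" "opp p1 = x1" "opp y1 = q1" "opp q1 = y1" "opp p2 = a1" "opp a1 = p2"
    using opp(3) x1 y1 p2 by (simp_all add: p1_def q1_def a1_def)
  have X: "{e \<in> E. bl e = x} = {x1}" using x1 by (intro card_1_with[OF card(4)]) simp
  have Y: "{e \<in> E. bl e = y} = {y1}" using y1 by (intro card_1_with[OF card(5)]) simp
  obtain z1 where Z: "{e \<in> E. bl e = z} = {z1}" using card(6) by (rule card_1_singletonE)
  have P: "{e \<in> E. bl e = p} = {p1, p2}" using card_2_with[OF card(2), of p1] p2 m b o by auto
  obtain q2 where q2: "q2 \<noteq> q1" and Q: "{e \<in> E. bl e = q} = {q1, q2}"
    using card_2_with[OF card(3), of q1] m b by auto
  have q2': "q2 \<in> E" "bl q2 = q" and z1: "z1 \<in> E" "bl z1 = z" using Q Z by blast+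
  have q2a: "bl (opp q2) = a"
  proof -
    have "bl (opp q2) \<noteq> p" using opp_fibre[OF P q2'(1)] o q2' x1 b V by auto
    moreover have "bl (opp q2) \<noteq> q" using opp_fibre[OF Q q2'(1)] o q2' q2 opp(2)[OF q2'(1)] y1 V by auto
    moreover have "bl (opp q2) \<noteq> x" using opp_fibre[OF X q2'(1)] o q2' b V by auto
    moreover have "bl (opp q2) \<noteq> y" using opp_fibre[OF Y q2'(1)] o q2' q2 by auto
    moreover have "bl (opp q2) \<noteq> z"
    proof
      assume *: "bl (opp q2) = z"
      then have **: "opp q2 = z1" using Z opp(1)[OF q2'(1)] by blast
      then have ***: "opp z1 = q2" using opp(3)[OF q2'(1)] by simp
      \<comment> \<open>Joining \<open>q\<close> to the leaf \<open>z\<close> would close off these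
        three vertices.\<close>
      have "p \<in> {y, q, z}"
      proof (rule all_black_reached(2)[of y1])
        fix e assume "e \<in> E" "bl e \<in> {y, q, z}"
        then have "e \<in> {y1, q1, q2, z1}" using Y Q Z by blast
        then show "bl (opp e) \<in> {y, q, z}" using o ** *** y1 q2' b z1 by auto
      qed (use y1 in auto)
      then show False using V by simp
    qed
    ultimately show ?thesis using bl[OF opp(1)[OF q2'(1)]] by blast
  qed
  define a2 where "a2 = opp q2"
  have a2: "a2 \<in> E" "bl a2 = a" "opp q2 = a2" "opp a2 = q2" using opp(1,3)[OF q2'(1)] q2a by (simp_all add: a2_def)
  have "a1 \<noteq> a2" using o(6) a2(4) p2(2) q2'(2) V by auto
  then obtain a3 where a3: "distinct [a1, a2, a3]" and A: "{e \<in> E. bl e = a} = {a1, a2, a3}"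
    using card_3_with2[OF card(1), of a1 a2] m b a2 by auto
  have a3': "a3 \<in> E" "bl a3 = a" using A by blast+
  have "bl (opp z1) \<noteq> p" using opp_fibre[OF P z1(1)] o z1 x1 b V by auto
  moreover have "bl (opp z1) \<noteq> q" using opp_fibre[OF Q z1(1)] o z1 a2 y1 V by auto
  moreover have "bl (opp z1) \<noteq> x" using opp_fibre[OF X z1(1)] o z1 b V by auto
  moreover have "bl (opp z1) \<noteq> y" using opp_fibre[OF Y z1(1)] o z1 b V by auto
  moreover have "bl (opp z1) \<noteq> z" using opp_fibre[OF Z z1(1)] opp(2)[OF z1(1)] by auto
  ultimately have "bl (opp z1) = a" using bl[OF opp(1)[OF z1(1)]] by blast
  then have "z1 \<in> opp ` {a1, a2, a3}" by (rule opp_fibre[OF A z1(1)])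
  then have "opp a3 = z1" using o a2 p2 q2' z1 V by auto
  then have oz: "opp a3 = z1" "opp z1 = a3" using opp(3)[OF a3'(1)] by auto
  show ?thesis
  \<comment> \<open>Listed leg by leg outwards from \<open>a\<close>; each white vertex contributes
    its inner edge and then its outer edge.\<close>
  proof (rule matchesI[of "[a1, p2, p1, x1, a2, q2, q1, y1, a3, z1]" "[a, p, x, q, y, z]"])
    show "E \<subseteq> set [a1, p2, p1, x1, a2, q2, q1, y1, a3, z1]"
    proof
      fix e assume "e \<in> E"
      then show "e \<in> set [a1, p2, p1, x1, a2, q2, q1, y1, a3, z1]"
        using bl[OF \<open>e \<in> E\<close>] A P Q X Y Z by auto
    qed
  qed (use m b o a2 a3' q2' z1 x1 y1 p2 oz V in \<open>simp_all add: upt_10\<close>)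
qed

end

text \<open>The hypotheses are symmetric in vertices of equal degree; these transpositions generate
  all the relabellings used to reduce to one case.\<close>

lemma edge_pairing_swap_leaves:
  assumes "edge_pairing E opp bl a p q x y z"
  shows "edge_pairing E opp bl a p q y x z" "edge_pairing E opp bl a p q x z y" "edge_pairing E opp bl a q p x y z"
  using assms unfolding edge_pairing_def by (auto simp: insert_commute)

context edge_pairing
begin

text \<open>The second edge at \<open>p\<close> leads to \<open>a\<close> or to \<open>q\<close>. If
  it leads to \<open>a\<close>, another leaf must hang on \<open>q\<close>, which gives two legs of
  equal length. If it leads to \<open>q\<close>, connectedness sends the other edge of
  \<open>q\<close> to \<open>a\<close>, and the two remaining leaves hang directly on
  \<open>a\<close>.\<close>

lemma matches_of_leaf:
  assumes x1: "x1 \<in> E" "bl x1 = x" "bl (opp x1) = p"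
  shows "matches [0,1,1,2,0,3,3,4,0,5] \<or> matches [0,1,1,2,2,3,0,4,0,5]"
proof -
  note V = vertices_distinct
  define p1 where "p1 = opp x1"
  have p1: "p1 \<in> E" "bl p1 = p" "opp x1 = p1" "opp p1 = x1" using opp(1,3) x1 by (simp_all add: p1_def)
  have X: "{e \<in> E. bl e = x} = {x1}" using x1 by (intro card_1_with[OF card(4)]) simp
  obtain y1 where Y: "{e \<in> E. bl e = y} = {y1}" using card(5) by (rule card_1_singletonE)
  obtain z1 where Z: "{e \<in> E. bl e = z} = {z1}" using card(6) by (rule card_1_singletonE)
  have y1: "y1 \<in> E" "bl y1 = y" and z1: "z1 \<in> E" "bl z1 = z" using Y Z by blast+
  obtain p2 where p2: "p2 \<noteq> p1" and P: "{e \<in> E. bl e = p} = {p1, p2}"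
    using card_2_with[OF card(2), of p1] p1 by auto
  have p2': "p2 \<in> E" "bl p2 = p" using P by blast+
  define r where "r = opp p2"
  have r: "r \<in> E" "opp p2 = r" "opp r = p2" using opp(1,3)[OF p2'(1)] by (simp_all add: r_def)
  have "bl r \<noteq> p" using opp_fibre[OF P p2'(1)] p1 p2 p2' opp(2)[OF p2'(1)] x1 V by (auto simp: r_def)
  moreover have "bl r \<noteq> x" using opp_fibre[OF X p2'(1)] p1 p2 by (auto simp: r_def)
  \<comment> \<open>Stated for an unspecified leaf \<open>l\<close>, to be used for \<open>y\<close>
    and \<open>z\<close>: a path \<open>x\<close>-\<open>p\<close>-\<open>l\<close> would be a whole
    component.\<close>
  moreover have "bl r \<noteq> l" if L: "{e \<in> E. bl e = l} = {l1}" and l: "q \<notin> {x, p, l}" for l l1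
  proof
    assume "bl r = l"
    then have "r = l1" using L r(1) by blast
    have "q \<in> {x, p, l}"
    proof (rule all_black_reached(3)[of x1])
      fix e assume "e \<in> E" "bl e \<in> {x, p, l}"
      then have "e \<in> {x1, p1, p2, l1}" using X P L by blast
      then show "bl (opp e) \<in> {x, p, l}" using p1 p2' r \<open>r = l1\<close> \<open>bl r = l\<close> x1 by auto
    qed (use x1 in auto)
    then show False using l by blast
  qed
  from this[OF Y] this[OF Z] have "bl r \<noteq> y" "bl r \<noteq> z" using V by simp_all
  ultimately consider "bl r = a" | "bl r = q" using bl[OF r(1)] by blast
  then show ?thesis
  proof cases
    case 1
    consider "bl (opp y1) = q" | "bl (opp z1) = q" | "bl (opp y1) \<noteq> q" "bl (opp z1) \<noteq> q" by blast
    then show ?thesis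
    proof cases
      case yq: 1
      then show ?thesis
        using matches_of_two_legs[OF x1 y1 yq p2'] p2 p1(3) 1 r(2) by simp
    next
      case zq: 2
      have swap: "edge_pairing E opp bl a p q x z y"
        using edge_pairing_swap_leaves(2) edge_pairing_axioms .
      have "edge_pairing.matches E opp bl [0,1,1,2,0,3,3,4,0,5]"
        using edge_pairing.matches_of_two_legs[OF swap x1 z1 zq p2'] p2 p1(3) 1 r(2) by simp
      then show ?thesis by simp
    next
      case 3
      have no: "bl (opp y1) = a" "bl (opp z1) = a"
      proof -
        have leaf: "bl (opp e) = a" if e: "e \<in> E" "bl e \<in> {y, z}" "bl (opp e) \<noteq> q" for e
        proof -
          have "bl (opp e) \<noteq> p" using opp_fibre[OF P e(1)] p1 r e(2) x1 1 V by auto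
          moreover have "bl (opp e) \<noteq> x" using opp_fibre[OF X e(1)] p1 e(2) V by auto
          moreover have "bl (opp e) \<notin> {y, z}" by (rule leaves_not_paired[OF e(1,2)])
          ultimately show ?thesis using bl[OF opp(1)[OF e(1)]] e(3) by blast
        qed
        show "bl (opp y1) = a" using y1 3 by (intro leaf) simp_all
        show "bl (opp z1) = a" using z1 3 by (intro leaf) simp_all
      qed
      define a2 a3 where "a2 = opp y1" and "a3 = opp z1"
      have a23: "a2 \<in> E" "a3 \<in> E" "bl a2 = a" "bl a3 = a" "opp a2 = y1" "opp a3 = z1"
        using opp(1,3) y1(1) z1(1) no by (simp_all add: a2_def a3_def)
      have "a2 \<noteq> a3" "r \<noteq> a2" "r \<noteq> a3" using a23 y1 z1 r p2' V by auto
      then have A: "{e \<in> E. bl e = a} = {r, a2, a3}"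
        using a23 1 r(1) by (intro card_3_with3[OF card(1)]) simp_all
      \<comment> \<open>All edges at the other five vertices have partners away from
        \<open>q\<close>, so the edges at \<open>q\<close> could only be paired with each
        other.\<close>
      have "a \<in> {q}"
      proof (rule all_black_reached(1))
        have "card {e \<in> E. bl e = q} \<noteq> 0" by (simp add: card)
        then have "{e \<in> E. bl e = q} \<noteq> {}" by (metis card.empty)
        then show "(SOME e. e \<in> E \<and> bl e = q) \<in> E" "bl (SOME e. e \<in> E \<and> bl e = q) \<in> {q}"
          using someI_ex[of "\<lambda>e. e \<in> E \<and> bl e = q"] by auto
        fix e assume e: "e \<in> E" "bl e \<in> {q}"
        have "bl (opp e) \<noteq> a" using opp_fibre[OF A e(1)] a23 r e(2) y1 z1 p2' V by auto
        moreover have "bl (opp e) \<noteq> p" using opp_fibre[OF P e(1)] p1 r e(2) x1 1 V by auto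
        moreover have "bl (opp e) \<noteq> x" using opp_fibre[OF X e(1)] p1 e(2) V by auto
        moreover have "bl (opp e) \<noteq> y" using opp_fibre[OF Y e(1)] no e(2) V by auto
        moreover have "bl (opp e) \<noteq> z" using opp_fibre[OF Z e(1)] no e(2) V by auto
        ultimately show "bl (opp e) \<in> {q}" using bl[OF opp(1)[OF e(1)]] by blast
      qed
      then show ?thesis using V by simp
    qed
  next
    case 2
    define q1 where "q1 = r"
    have q1: "q1 \<in> E" "bl q1 = q" "opp p2 = q1" "opp q1 = p2" using r 2 by (simp_all add: q1_def)
    obtain q2 where q2: "q2 \<noteq> q1" and Q: "{e \<in> E. bl e = q} = {q1, q2}"
      using card_2_with[OF card(3), of q1] q1 by auto
    have q2': "q2 \<in> E" "bl q2 = q" using Q by blast+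
    define s where "s = opp q2"
    have s: "s \<in> E" "opp q2 = s" "opp s = q2" using opp(1,3)[OF q2'(1)] by (simp_all add: s_def)
    have "bl s \<noteq> p" using opp_fibre[OF P q2'(1)] p1 q1 q2 q2' x1 V by (auto simp: s_def)
    moreover have "bl s \<noteq> q" using opp_fibre[OF Q q2'(1)] q1 q2 q2' p2' opp(2)[OF q2'(1)] V by (auto simp: s_def)
    moreover have "bl s \<noteq> x" using opp_fibre[OF X q2'(1)] p1 q2' V by (auto simp: s_def)
    moreover have "bl s \<noteq> l" if L: "{e \<in> E. bl e = l} = {l1}" and l: "a \<notin> {x, p, q, l}" for l l1
    proof
      assume "bl s = l"
      then have "s = l1" using L s(1) by blast
      have "a \<in> {x, p, q, l}"
      proof (rule all_black_reached(1)[of x1])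
        fix e assume "e \<in> E" "bl e \<in> {x, p, q, l}"
        then have "e \<in> {x1, p1, p2, q1, q2, l1}" using X P Q L by blast
        then show "bl (opp e) \<in> {x, p, q, l}" using p1 p2' q1 q2' s \<open>s = l1\<close> \<open>bl s = l\<close> x1 by auto
      qed (use x1 in auto)
      then show False using l by blast
    qed
    from this[OF Y] this[OF Z] have "bl s \<noteq> y" "bl s \<noteq> z" using V by simp_all
    ultimately have "bl s = a" using bl[OF s(1)] by blast
    define a1 where "a1 = s"
    have a1: "a1 \<in> E" "bl a1 = a" "opp q2 = a1" "opp a1 = q2" using s \<open>bl s = a\<close> by (simp_all add: a1_def)
    have leaf: "bl (opp e) = a" if e: "e \<in> E" "bl e \<in> {y, z}" for e
    proof -
      have "bl (opp e) \<noteq> p" using opp_fibre[OF P e(1)] p1 q1 e(2) x1 V by auto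
      moreover have "bl (opp e) \<noteq> q" using opp_fibre[OF Q e(1)] q1 a1 e(2) p2' V by auto
      moreover have "bl (opp e) \<noteq> x" using opp_fibre[OF X e(1)] p1 e(2) V by auto
      moreover have "bl (opp e) \<notin> {y, z}" by (rule leaves_not_paired[OF e(1,2)])
      ultimately show ?thesis using bl[OF opp(1)[OF e(1)]] by blast
    qed
    define a2 a3 where "a2 = opp y1" and "a3 = opp z1"
    have a23: "a2 \<in> E" "a3 \<in> E" "bl a2 = a" "bl a3 = a" "opp a2 = y1" "opp a3 = z1" "opp y1 = a2" "opp z1 = a3"
      using opp(1,3) y1 z1 leaf by (simp_all add: a2_def a3_def)
    have "a2 \<noteq> a3" "a1 \<noteq> a2" "a1 \<noteq> a3" using a23 y1 z1 a1 q2' V by auto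
    then have A: "{e \<in> E. bl e = a} = {a1, a2, a3}"
      using a23 a1 by (intro card_3_with3[OF card(1)]) simp_all
    have "matches [0,1,1,2,2,3,0,4,0,5]"
    proof (rule matchesI[of "[a1, q2, q1, p2, p1, x1, a2, y1, a3, z1]" "[a, q, p, x, y, z]"])
      show "E \<subseteq> set [a1, q2, q1, p2, p1, x1, a2, y1, a3, z1]"
      proof
        fix e assume "e \<in> E"
        then show "e \<in> set [a1, q2, q1, p2, p1, x1, a2, y1, a3, z1]"
          using bl[OF \<open>e \<in> E\<close>] A P Q X Y Z by auto
      qed
    qed (use p1 p2' q1 q2' a1 a23 z1 x1 y1 V in \<open>simp_all add: upt_10\<close>)
    then show ?thesis ..
  qed
qed

text \<open>Some leaf hangs on a bivalent vertex: otherwise the three leaves use up the three edges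
  at \<open>a\<close>, and \<open>p\<close> is out of reach. By symmetry the leaf may be called
  \<open>x\<close> and the bivalent vertex \<open>p\<close>.\<close>

lemma matches_exhaust: "matches [0,1,1,2,0,3,3,4,0,5] \<or> matches [0,1,1,2,2,3,0,4,0,5]"
proof -
  note V = vertices_distinct
  obtain x1 where X: "{e \<in> E. bl e = x} = {x1}" using card(4) by (rule card_1_singletonE)
  obtain y1 where Y: "{e \<in> E. bl e = y} = {y1}" using card(5) by (rule card_1_singletonE)
  obtain z1 where Z: "{e \<in> E. bl e = z} = {z1}" using card(6) by (rule card_1_singletonE)
  have l: "x1 \<in> E" "bl x1 = x" "y1 \<in> E" "bl y1 = y" "z1 \<in> E" "bl z1 = z" using X Y Z by blast+
  have ep: "edge_pairing E opp bl a p q x y z" by (rule edge_pairing_axioms)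
  have all: "matches [0,1,1,2,0,3,3,4,0,5] \<or> matches [0,1,1,2,2,3,0,4,0,5]"
    if "edge_pairing E opp bl a p' q' x' y' z'" "u \<in> E" "bl u = x'" "bl (opp u) = p'" for p' q' x' y' z' u
    using edge_pairing.matches_of_leaf[OF that] .
  have "\<exists>u\<in>E. bl u \<in> {x, y, z} \<and> bl (opp u) \<in> {p, q}"
  proof (rule ccontr)
    assume none: "\<not> (\<exists>u\<in>E. bl u \<in> {x, y, z} \<and> bl (opp u) \<in> {p, q})"
    have unique: "d = u" if "d \<in> E" "u \<in> E" "bl d = bl u" "bl u \<in> {x, y, z}" for d u
    proof -
      have 1: "d \<in> {e \<in> E. bl e = bl u}" "u \<in> {e \<in> E. bl e = bl u}" using that by simp_all
      have "bl u = x \<or> bl u = y \<or> bl u = z" using that(4) by simp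
      then obtain c where c: "{e \<in> E. bl e = bl u} = {c}" using X Y Z by auto
      show ?thesis using 1[unfolded c] by simp
    qed
    have leaf: "bl (opp u) = a" if u: "u \<in> E" "bl u \<in> {x, y, z}" for u
    proof -
      have "bl (opp u) \<notin> {x, y, z}"
      proof
        assume *: "bl (opp u) \<in> {x, y, z}"
        have uu: "a \<in> {bl u, bl (opp u)}"
        proof (rule all_black_reached(1)[of u])
          fix d assume d: "d \<in> E" "bl d \<in> {bl u, bl (opp u)}"
          have "opp u \<in> E" using opp(1) u(1) .
          have "d \<in> {u, opp u}"
            using unique[of d u] unique[of d "opp u"] d * u \<open>opp u \<in> E\<close> by auto
          then show "bl (opp d) \<in> {bl u, bl (opp u)}" using opp(3)[OF u(1)] by auto
        qed (use u in auto)
        then show False using * u(2) V by auto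
      qed
      then show ?thesis using none u bl[OF opp(1)[OF u(1)]] by blast
    qed
    define W where "W = {a, x, y, z}"
    have *: "opp x1 \<noteq> opp y1" "opp x1 \<noteq> opp z1" "opp y1 \<noteq> opp z1"
    proof -
      have "x1 \<noteq> y1" "x1 \<noteq> z1" "y1 \<noteq> z1" using l V by auto
      then show "opp x1 \<noteq> opp y1" "opp x1 \<noteq> opp z1" "opp y1 \<noteq> opp z1"
        using opp(3)[OF l(1)] opp(3)[OF l(3)] opp(3)[OF l(5)] by metis+
    qed
    have la: "bl (opp x1) = a" "bl (opp y1) = a" "bl (opp z1) = a" using leaf l by auto
    have A: "{e \<in> E. bl e = a} = {opp x1, opp y1, opp z1}"
    proof -
      have m: "opp x1 \<in> {e \<in> E. bl e = a}" "opp y1 \<in> {e \<in> E. bl e = a}" "opp z1 \<in> {e \<in> E. bl e = a}"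
        using la opp(1) l by simp_all
      then show ?thesis using * by (intro card_3_with3[OF card(1)]) simp_all
    qed
    have "p \<in> W"
    proof (rule all_black_reached(2)[of x1])
      fix e assume e: "e \<in> E" "bl e \<in> W"
      then have "e \<in> {opp x1, opp y1, opp z1, x1, y1, z1}" using A X Y Z unfolding W_def by blast
      then show "bl (opp e) \<in> W" using la l opp(3) unfolding W_def by auto
    qed (use l W_def in auto)
    then show False using V by (simp add: W_def)
  qed
  then obtain u where u: "u \<in> E" "bl u \<in> {x, y, z}" "bl (opp u) \<in> {p, q}" by blast
  note sw = edge_pairing_swap_leaves
  have ep': "edge_pairing E opp bl a q p x y z" by (rule sw(3)[OF ep])
  from u(3) have "bl (opp u) = p \<or> bl (opp u) = q" by simp
  then show ?thesis
  proof
    assume pu: "bl (opp u) = p"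
    from u(2) consider "bl u = x" | "bl u = y" | "bl u = z" by blast
    then show ?thesis
    proof cases
      case 1 show ?thesis by (rule all[OF ep u(1) 1 pu])
    next
      case 2 show ?thesis by (rule all[OF sw(1)[OF ep] u(1) 2 pu])
    next
      case 3 show ?thesis by (rule all[OF sw(1)[OF sw(2)[OF ep]] u(1) 3 pu])
    qed
  next
    assume qu: "bl (opp u) = q"
    from u(2) consider "bl u = x" | "bl u = y" | "bl u = z" by blast
    then show ?thesis
    proof cases
      case 1 show ?thesis by (rule all[OF ep' u(1) 1 qu])
    next
      case 2 show ?thesis by (rule all[OF sw(1)[OF ep'] u(1) 2 qu])
    next
      case 3 show ?thesis by (rule all[OF sw(1)[OF sw(2)[OF ep']] u(1) 3 qu])
    qed
  qed
qed

end

section \<open>From the passport and connectedness to one of the two trees\<close>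

text \<open>Allows the vertices to be named in the order of a prescribed list of degrees, although a
  passport holds only a multiset.\<close>

lemma image_mset_eq_mset_list:
  assumes "finite B" "image_mset f (mset_set B) = mset ns"
  shows "\<exists>vs. distinct vs \<and> set vs = B \<and> map f vs = ns"
  using assms
proof (induction ns arbitrary: B)
  case Nil
  then show ?case by (intro exI[of _ "[]"]) (simp add: mset_set_empty_iff)
next
  case (Cons n ns)
  then have "n \<in># image_mset f (mset_set B)" by simp
  then obtain v where v: "v \<in> B" "f v = n" using Cons.prems(1) by auto
  have "image_mset f (mset_set (B - {v})) = mset ns"
    using Cons.prems v by (simp add: mset_set.remove)
  then obtain vs where "distinct vs" "set vs = B - {v}" "map f vs = ns"
    using Cons.IH[of "B - {v}"] Cons.prems(1) by auto
  then show ?case using v by (intro exI[of _ "v # vs"]) auto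
qed

lemma edges_at_end:
  assumes "connected_map G"
  shows "v \<in> black G \<Longrightarrow> edges_at G v = {e \<in> edges G. black_end G e = v}"
    and "v \<in> white G \<Longrightarrow> edges_at G v = {e \<in> edges G. white_end G e = v}"
  using assms unfolding connected_map_def edges_at_def by blast+

text \<open>Along a path from the black end of an edge in \<open>S\<close>, every vertex met is an
  end of an edge in \<open>S\<close>: the next edge of the path shares a vertex with such an edge,
  and a closure condition puts it in \<open>S\<close> too.\<close>

lemma connected_map_edges_closed:
  assumes G: "connected_map G" and S: "S \<subseteq> edges G" "S \<noteq> {}"
    and b: "\<And>e e'. e \<in> S \<Longrightarrow> e' \<in> edges G \<Longrightarrow> black_end G e' = black_end G e \<Longrightarrow> e' \<in> S"
    and w: "\<And>e e'. e \<in> S \<Longrightarrow> e' \<in> edges G \<Longrightarrow> white_end G e' = white_end G e \<Longrightarrow> e' \<in> S"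
  shows "S = edges G"
proof
  show "edges G \<subseteq> S"
  proof
    fix e assume e: "e \<in> edges G"
    obtain d where d: "d \<in> S" using S by blast
    have ends: "black_end G c \<in> black G" "white_end G c \<in> white G" if "c \<in> edges G" for c
      using G that by (auto simp: connected_map_def)
    have disj: "black_end G c \<noteq> white_end G c'" if "c \<in> edges G" "c' \<in> edges G" for c c'
      using G that unfolding connected_map_def by (metis disjoint_iff)
    have "(black_end G d, black_end G e) \<in> (adjacency G)\<^sup>*"
      using G ends[of d] ends[of e] d e S(1) unfolding connected_map_def connected_graph_def vertices_def by blast
    then have "\<exists>c\<in>S. black_end G e = black_end G c \<or> black_end G e = white_end G c"
    proof (induction rule: rtrancl_induct)
      case base
      then show ?case using d by blast
    next
      case (step u v)
      then obtain c c' where c: "c \<in> S" "u = black_end G c \<or> u = white_end G c"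
        and c': "c' \<in> edges G" "{u, v} = {black_end G c', white_end G c'}"
        by (auto simp: adjacency_def)
      have "c \<in> edges G" using c(1) S(1) by blast
      have "u = black_end G c' \<or> u = white_end G c'" "v = black_end G c' \<or> v = white_end G c'"
        using c'(2) by (auto simp: doubleton_eq_iff)
      then have "c' \<in> S"
        using b[OF c(1) c'(1)] w[OF c(1) c'(1)] c(2) disj[OF c'(1) \<open>c \<in> edges G\<close>]
          disj[OF \<open>c \<in> edges G\<close> c'(1)] by metis
      then show ?case using \<open>v = black_end G c' \<or> v = white_end G c'\<close> by blast
    qed
    then obtain c where c: "c \<in> S" "black_end G e = black_end G c \<or> black_end G e = white_end G c" by blast
    then have "black_end G e = black_end G c" using disj[OF e] S(1) by blast
    then show "e \<in> S" using b[OF c(1) e] by blast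
  qed
qed (rule S(1))

lemma list_of_length_10:
  assumes "length es = 10"
  shows "\<exists>e0 e1 e2 e3 e4 e5 e6 e7 e8 e9. es = [e0,e1,e2,e3,e4,e5,e6,e7,e8,e9]"
  using assms by (auto simp: length_Suc_conv numeral_eq_Suc)

lemma list_of_length_6:
  assumes "length vs = 6"
  shows "\<exists>v0 v1 v2 v3 v4 v5. vs = [v0,v1,v2,v3,v4,v5]"
  using assms by (auto simp: length_Suc_conv numeral_eq_Suc)

text \<open>The pairing determines everything except the rotation at the trivalent vertex, since one
  or two edges have a single cyclic order. Each of the two pairings admits a relabelling that
  exchanges the two cyclic orders of the three edges there.\<close>

theorem two_trees:
  assumes G: "connected_map G"
    and pass: "passport G = ({#3, 2, 2, 1, 1, 1#}, {#2, 2, 2, 2, 2#}, 10)"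
  shows "plane_isomorphic G tree221 \<or> plane_isomorphic G tree311"
proof -
  let ?E = "edges G"
  have fin: "finite (black G)" "finite (white G)" "finite ?E"
    and ends: "\<And>e. e \<in> ?E \<Longrightarrow> black_end G e \<in> black G" "\<And>e. e \<in> ?E \<Longrightarrow> white_end G e \<in> white G"
    and cyc: "\<And>v. v \<in> vertices G \<Longrightarrow> cyclic_on (rot G v) (edges_at G v)"
    using G unfolding connected_map_def by blast+
  have pb: "image_mset (vertex_degree G) (mset_set (black G)) = mset [3, 2, 2, 1, 1, 1]"
    and pw: "image_mset (vertex_degree G) (mset_set (white G)) = {#2, 2, 2, 2, 2#}"
    using pass unfolding passport_def prod.inject by simp_all
  obtain bs where bs': "distinct bs" "set bs = black G" "map (vertex_degree G) bs = [3, 2, 2, 1, 1, 1]"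
    using image_mset_eq_mset_list[OF fin(1) pb] by (elim exE conjE)
  have "length bs = 6" using arg_cong[OF bs'(3), where f = length] by simp
  from list_of_length_6[OF this]
  obtain a p q x y z where abs: "bs = [a, p, q, x, y, z]" by blast
  have bs: "distinct [a, p, q, x, y, z]" "{a, p, q, x, y, z} = black G"
    "vertex_degree G a = 3" "vertex_degree G p = 2" "vertex_degree G q = 2" "vertex_degree G x = 1"
    "vertex_degree G y = 1" "vertex_degree G z = 1"
    using bs' unfolding abs by simp_all
  have deg: "card {e \<in> ?E. black_end G e = v} = vertex_degree G v" if "v \<in> black G" for v
    using edges_at_end(1)[OF G that] by (simp add: vertex_degree_def)
  have degw: "card {e' \<in> ?E. white_end G e' = white_end G e} = 2" if "e \<in> ?E" for e
  proof -
    have "vertex_degree G (white_end G e) \<in># image_mset (vertex_degree G) (mset_set (white G))"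
      using ends(2)[OF that] fin(2) by simp
    then have "vertex_degree G (white_end G e) = 2" unfolding pw by auto
    then show ?thesis using edges_at_end(2)[OF G ends(2)[OF that]] by (simp add: vertex_degree_def)
  qed
  have "\<exists>e'. e' \<noteq> e \<and> {e' \<in> ?E. white_end G e' = white_end G e} = {e, e'}" if "e \<in> ?E" for e
    using card_2_with[OF degw[OF that], of e] that by simp
  then obtain opp where opp_pair: "\<And>e. e \<in> ?E \<Longrightarrow> opp e \<noteq> e \<and> {e' \<in> ?E. white_end G e' = white_end G e} = {e, opp e}"
    by metis
  have opp_in: "opp e \<in> ?E" "white_end G (opp e) = white_end G e" if "e \<in> ?E" for e
  proof -
    have "opp e \<in> {e' \<in> ?E. white_end G e' = white_end G e}" using opp_pair[OF that] by blast
    then show "opp e \<in> ?E" "white_end G (opp e) = white_end G e" by simp_all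
  qed
  have opp_opp: "opp (opp e) = e" if "e \<in> ?E" for e
  proof -
    have "{e, opp e} = {opp e, opp (opp e)}"
      using opp_pair[OF that] opp_pair[OF opp_in(1)[OF that]] opp_in(2)[OF that] by simp
    then show ?thesis using opp_pair[OF that] by (auto simp: doubleton_eq_iff)
  qed
  have inB: "a \<in> black G" "p \<in> black G" "q \<in> black G" "x \<in> black G" "y \<in> black G" "z \<in> black G"
    unfolding bs(2)[symmetric] by simp_all
  interpret edge_pairing ?E opp "black_end G" a p q x y z
  proof
    show "black_end G e \<in> {a, p, q, x, y, z}" if "e \<in> ?E" for e using ends(1)[OF that] bs(2) by simp
    show "S = ?E" if "S \<subseteq> ?E" "S \<noteq> {}" "\<And>e. e \<in> S \<Longrightarrow> opp e \<in> S"
      "\<And>e e'. e \<in> S \<Longrightarrow> e' \<in> ?E \<Longrightarrow> black_end G e' = black_end G e \<Longrightarrow> e' \<in> S" for S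
    proof (rule connected_map_edges_closed[OF G that(1,2)])
      fix e e' assume *: "e \<in> S" "e' \<in> ?E" "white_end G e' = white_end G e"
      then have "e' \<in> {e, opp e}" using opp_pair[of e] that(1) by blast
      then show "e' \<in> S" using *(1) that(3) by blast
    qed (use that(4) in blast)
    show "card {e \<in> ?E. black_end G e = a} = 3" "card {e \<in> ?E. black_end G e = p} = 2"
      "card {e \<in> ?E. black_end G e = q} = 2" "card {e \<in> ?E. black_end G e = x} = 1"
      "card {e \<in> ?E. black_end G e = y} = 1" "card {e \<in> ?E. black_end G e = z} = 1"
      by (simp_all only: deg inB bs(3-))
    show "finite ?E" "distinct [a, p, q, x, y, z]" by fact+
    fix e assume e: "e \<in> ?E"
    show "opp e \<in> ?E" "opp (opp e) = e" using opp_in(1)[OF e] opp_opp[OF e] .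
    show "opp e \<noteq> e" using opp_pair[OF e] by blast
  qed
  have black_cyclic: "cyclic_on (rot G v) {e \<in> ?E. black_end G e = v}" if "v \<in> black G" for v
  proof -
    have "v \<in> vertices G" using that by (simp add: vertices_def)
    from cyc[OF this] show ?thesis unfolding edges_at_end(1)[OF G that] .
  qed
  have nonempty: "edges_at G v \<noteq> {}" if "v \<in> vertices G" for v
    using cyclic_on_nonempty[OF cyc[OF that]] .
  have iso: "plane_isomorphic G (shape tbl nx)"
    if "length es = 10" "distinct es" "set es = ?E" "length vs = 6" "distinct vs"
      "map (black_end G) es = map (\<lambda>i. vs ! i) tbl" "length tbl = 10" "set tbl = {0..<6}"
      "length nx = 10" "\<forall>i\<in>set nx. i < 10"
      "map opp es = map (\<lambda>i. es ! (if even i then Suc i else i - 1)) [0..<10]"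
      "map (\<lambda>e. rot G (black_end G e) e) es = map (\<lambda>i. es ! i) nx" for es vs tbl nx
    by (rule plane_isomorphic_shapeI[OF G nonempty opp_pair that])
  have upt6: "{0..<6} = {0, 1, 2, 3, 4, 5::nat}" using upt_6 by (metis set_upt list.simps(15) list.set(1))
  from matches_exhaust show ?thesis
  proof
    assume "matches [0,1,1,2,0,3,3,4,0,5]"
    then obtain es vs where m: "length es = 10" "distinct es" "set es = ?E" "length vs = 6" "distinct vs"
      "map (black_end G) es = map (\<lambda>i. vs ! i) [0,1,1,2,0,3,3,4,0,5]"
      "map opp es = map (\<lambda>i. es ! (if even i then Suc i else i - 1)) [0..<10]"
      unfolding matches_def by (elim exE conjE)
    obtain e0 e1 e2 e3 e4 e5 e6 e7 e8 e9 where es: "es = [e0,e1,e2,e3,e4,e5,e6,e7,e8,e9]"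
      using list_of_length_10[OF m(1)] by blast
    obtain v0 v1 v2 v3 v4 v5 where vs: "vs = [v0,v1,v2,v3,v4,v5]"
      using list_of_length_6[OF m(4)] by blast
    have b: "black_end G e0 = v0" "black_end G e1 = v1" "black_end G e2 = v1" "black_end G e3 = v2"
      "black_end G e4 = v0" "black_end G e5 = v3" "black_end G e6 = v3" "black_end G e7 = v4"
      "black_end G e8 = v0" "black_end G e9 = v5"
      using m(6) unfolding es vs by simp_all
    have o: "opp e0 = e1" "opp e1 = e0" "opp e2 = e3" "opp e3 = e2" "opp e4 = e5" "opp e5 = e4"
      "opp e6 = e7" "opp e7 = e6" "opp e8 = e9" "opp e9 = e8"
      using m(7) unfolding es upt_10 by simp_all
    have E: "?E = {e0,e1,e2,e3,e4,e5,e6,e7,e8,e9}" using m(3) unfolding es by simp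
    have D: "distinct [e0,e1,e2,e3,e4,e5,e6,e7,e8,e9]" using m(2) unfolding es .
    have V: "distinct [v0,v1,v2,v3,v4,v5]" using m(5) unfolding vs .
    have vB: "v0 \<in> black G" "v1 \<in> black G" "v2 \<in> black G" "v3 \<in> black G" "v4 \<in> black G" "v5 \<in> black G"
      using ends(1) b E by auto
    have F: "{e \<in> ?E. black_end G e = v0} = {e0, e4, e8}" "{e \<in> ?E. black_end G e = v1} = {e1, e2}"
      "{e \<in> ?E. black_end G e = v2} = {e3}" "{e \<in> ?E. black_end G e = v3} = {e5, e6}"
      "{e \<in> ?E. black_end G e = v4} = {e7}" "{e \<in> ?E. black_end G e = v5} = {e9}"
      unfolding E using b V by auto
    note C = black_cyclic[OF vB(1), unfolded F(1)] black_cyclic[OF vB(2), unfolded F(2)]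
      black_cyclic[OF vB(3), unfolded F(3)] black_cyclic[OF vB(4), unfolded F(4)]
      black_cyclic[OF vB(5), unfolded F(5)] black_cyclic[OF vB(6), unfolded F(6)]
    have r: "rot G v1 e1 = e2" "rot G v1 e2 = e1" "rot G v2 e3 = e3" "rot G v3 e5 = e6" "rot G v3 e6 = e5"
      "rot G v4 e7 = e7" "rot G v5 e9 = e9"
      using cyclic_on_2D[OF C(2)] cyclic_on_2D[OF C(4)] C(3,5,6)[THEN cyclic_on_1D] D by simp_all
    have "plane_isomorphic G tree221"
    proof (cases "rot G v0 e0 = e4")
      case True
      then have r0: "rot G v0 e0 = e4" "rot G v0 e4 = e8" "rot G v0 e8 = e0"
        using cyclic_on_3D[OF C(1)] D by auto
      show ?thesis
        unfolding tree221_def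
        by (rule iso[OF m(1,2,3,4,5,6) _ _ _ _ m(7)])
          (simp_all add: es b r r0 upt6 insert_commute)
    next
      case False
      then have r0: "rot G v0 e4 = e0" "rot G v0 e0 = e8" "rot G v0 e8 = e4"
        using cyclic_on_3D[OF C(1)] D by auto
      show ?thesis
        unfolding tree221_def
      \<comment> \<open>The opposite cyclic order is undone by exchanging the two long legs.\<close>
      proof (rule iso[of "[e4,e5,e6,e7,e0,e1,e2,e3,e8,e9]" "[v0,v3,v4,v1,v2,v5]"])
        show "set [e4,e5,e6,e7,e0,e1,e2,e3,e8,e9] = ?E" unfolding E by auto
        show "distinct [e4,e5,e6,e7,e0,e1,e2,e3,e8,e9]" using D by auto
        show "distinct [v0,v3,v4,v1,v2,v5]" using V by auto
      qed (simp_all add: b r r0 o upt6 upt_10 insert_commute)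
    qed
    then show ?thesis ..
  next
    assume "matches [0,1,1,2,2,3,0,4,0,5]"
    then obtain es vs where m: "length es = 10" "distinct es" "set es = ?E" "length vs = 6" "distinct vs"
      "map (black_end G) es = map (\<lambda>i. vs ! i) [0,1,1,2,2,3,0,4,0,5]"
      "map opp es = map (\<lambda>i. es ! (if even i then Suc i else i - 1)) [0..<10]"
      unfolding matches_def by (elim exE conjE)
    obtain e0 e1 e2 e3 e4 e5 e6 e7 e8 e9 where es: "es = [e0,e1,e2,e3,e4,e5,e6,e7,e8,e9]"
      using list_of_length_10[OF m(1)] by blast
    obtain v0 v1 v2 v3 v4 v5 where vs: "vs = [v0,v1,v2,v3,v4,v5]"
      using list_of_length_6[OF m(4)] by blast
    have b: "black_end G e0 = v0" "black_end G e1 = v1" "black_end G e2 = v1" "black_end G e3 = v2"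
      "black_end G e4 = v2" "black_end G e5 = v3" "black_end G e6 = v0" "black_end G e7 = v4"
      "black_end G e8 = v0" "black_end G e9 = v5"
      using m(6) unfolding es vs by simp_all
    have o: "opp e0 = e1" "opp e1 = e0" "opp e2 = e3" "opp e3 = e2" "opp e4 = e5" "opp e5 = e4"
      "opp e6 = e7" "opp e7 = e6" "opp e8 = e9" "opp e9 = e8"
      using m(7) unfolding es upt_10 by simp_all
    have E: "?E = {e0,e1,e2,e3,e4,e5,e6,e7,e8,e9}" using m(3) unfolding es by simp
    have D: "distinct [e0,e1,e2,e3,e4,e5,e6,e7,e8,e9]" using m(2) unfolding es .
    have V: "distinct [v0,v1,v2,v3,v4,v5]" using m(5) unfolding vs .
    have vB: "v0 \<in> black G" "v1 \<in> black G" "v2 \<in> black G" "v3 \<in> black G" "v4 \<in> black G" "v5 \<in> black G"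
      using ends(1) b E by auto
    have F: "{e \<in> ?E. black_end G e = v0} = {e0, e6, e8}" "{e \<in> ?E. black_end G e = v1} = {e1, e2}"
      "{e \<in> ?E. black_end G e = v2} = {e3, e4}" "{e \<in> ?E. black_end G e = v3} = {e5}"
      "{e \<in> ?E. black_end G e = v4} = {e7}" "{e \<in> ?E. black_end G e = v5} = {e9}"
      unfolding E using b V by auto
    note C = black_cyclic[OF vB(1), unfolded F(1)] black_cyclic[OF vB(2), unfolded F(2)]
      black_cyclic[OF vB(3), unfolded F(3)] black_cyclic[OF vB(4), unfolded F(4)]
      black_cyclic[OF vB(5), unfolded F(5)] black_cyclic[OF vB(6), unfolded F(6)]
    have r: "rot G v1 e1 = e2" "rot G v1 e2 = e1" "rot G v2 e3 = e4" "rot G v2 e4 = e3" "rot G v3 e5 = e5"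
      "rot G v4 e7 = e7" "rot G v5 e9 = e9"
      using cyclic_on_2D[OF C(2)] cyclic_on_2D[OF C(3)] C(4,5,6)[THEN cyclic_on_1D] D by simp_all
    have "plane_isomorphic G tree311"
    proof (cases "rot G v0 e0 = e6")
      case True
      then have r0: "rot G v0 e0 = e6" "rot G v0 e6 = e8" "rot G v0 e8 = e0"
        using cyclic_on_3D[OF C(1)] D by auto
      show ?thesis
        unfolding tree311_def
        by (rule iso[OF m(1,2,3,4,5,6) _ _ _ _ m(7)])
          (simp_all add: es b r r0 upt6 insert_commute)
    next
      case False
      then have r0: "rot G v0 e6 = e0" "rot G v0 e0 = e8" "rot G v0 e8 = e6"
        using cyclic_on_3D[OF C(1)] D by auto
      show ?thesis
        unfolding tree311_def
      \<comment> \<open>Here the two legs that consist of a single leaf are exchanged.\<close>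
      proof (rule iso[of "[e0,e1,e2,e3,e4,e5,e8,e9,e6,e7]" "[v0,v1,v2,v3,v5,v4]"])
        show "set [e0,e1,e2,e3,e4,e5,e8,e9,e6,e7] = ?E" unfolding E by auto
        show "distinct [e0,e1,e2,e3,e4,e5,e8,e9,e6,e7]" using D by auto
        show "distinct [v0,v1,v2,v3,v5,v4]" using V by auto
      qed (simp_all add: b r r0 o upt6 upt_10 insert_commute)
    qed
    then show ?thesis ..
  qed
qed

section \<open>The tree of a Shabat polynomial\<close>

definition normalized :: "complex poly \<Rightarrow> complex \<Rightarrow> complex \<Rightarrow> complex poly" where
  "normalized f c1 c2 = smult (1 / (c2 - c1)) (f - [:c1:])"

lemma poly_normalized:
  assumes "c1 \<noteq> c2"
  shows "poly (normalized f c1 c2) z = (poly f z - c1) / (c2 - c1)"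
    and "poly (normalized f c1 c2) z = 0 \<longleftrightarrow> poly f z = c1"
    and "poly (normalized f c1 c2) z = 1 \<longleftrightarrow> poly f z = c2"
  using assms by (auto simp: normalized_def)

lemma order_normalized:
  assumes "c1 \<noteq> c2"
  shows "order v (normalized f c1 c2) = order v (f - [:c1:])"
    and "order v (normalized f c1 c2 - [:1:]) = order v (f - [:c2:])"
proof -
  show "order v (normalized f c1 c2) = order v (f - [:c1:])"
    using assms by (simp add: normalized_def order_smult)
  have "normalized f c1 c2 - [:1:] = smult (1 / (c2 - c1)) (f - [:c2:])"
    using assms by (intro poly_ext) (simp add: normalized_def divide_simps)
  then show "order v (normalized f c1 c2 - [:1:]) = order v (f - [:c2:])"
    using assms by (simp add: order_smult)
qed

lemma degree_diff_const:
  fixes f :: "complex poly"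
  assumes "degree f > 0"
  shows "degree (f - [:c:]) = degree f" "f - [:c:] \<noteq> 0"
proof -
  show d: "degree (f - [:c:]) = degree f"
    using assms degree_add_eq_left[of "- [:c:]" f] by (simp only: diff_conv_add_uminus) simp
  show "f - [:c:] \<noteq> 0" using assms d by (metis degree_0 less_irrefl)
qed

lemma belyi_poly_normalized:
  assumes "is_shabat f c1 c2"
  shows "belyi_poly (normalized f c1 c2)"
proof
  have f: "degree f > 0" "c1 \<noteq> c2" "\<And>z. poly (pderiv f) z = 0 \<Longrightarrow> poly f z \<in> {c1, c2}"
    using assms by (auto simp: is_shabat_def)
  show "0 < degree (normalized f c1 c2)"
    using f(1,2) degree_diff_const(1)[OF f(1)] by (simp add: normalized_def)
  fix z assume "poly (pderiv (normalized f c1 c2)) z = 0"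
  then have "poly (pderiv f) z = 0" using f(2) by (simp add: normalized_def pderiv_smult pderiv_diff)
  then have "poly f z = c1 \<or> poly f z = c2" using f(3)[of z] by simp
  then show "poly (normalized f c1 c2) z \<in> {0, 1}"
    using poly_normalized(2,3)[OF f(2), of f z] by auto
qed

lemma shabat_edges_normalized:
  assumes "c1 \<noteq> c2"
  shows "shabat_edges f c1 c2 = shabat_edges (normalized f c1 c2) 0 1"
proof -
  have "poly f z \<in> open_segment c1 c2 \<longleftrightarrow> poly (normalized f c1 c2) z \<in> open_segment 0 1" for z
  proof -
    have "poly f z = (1 - u) *\<^sub>R c1 + u *\<^sub>R c2 \<longleftrightarrow> poly (normalized f c1 c2) z = (1 - u) *\<^sub>R 0 + u *\<^sub>R 1" for u :: real
    proof -
      have "poly (normalized f c1 c2) z = of_real u \<longleftrightarrow> poly f z - c1 = of_real u * (c2 - c1)"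
        unfolding poly_normalized(1)[OF assms] using assms by (simp add: divide_eq_eq)
      also have "\<dots> \<longleftrightarrow> poly f z = (1 - of_real u) * c1 + of_real u * c2"
        by (auto simp: algebra_simps)
      finally show ?thesis by (simp add: scaleR_conv_of_real)
    qed
    then show ?thesis using assms by (simp add: in_segment)
  qed
  then show ?thesis by (simp add: shabat_edges_def)
qed

lemma shabat_tree_sel [simp]:
  "black (shabat_tree f c1 c2) = {z. poly f z = c1}"
  "white (shabat_tree f c1 c2) = {z. poly f z = c2}"
  "edges (shabat_tree f c1 c2) = shabat_edges f c1 c2"
  "rot (shabat_tree f c1 c2) v e = arg_min_on (turn v e) {e' \<in> shabat_edges f c1 c2. v \<in> closure e'}"
  by (simp_all add: shabat_tree_def)

context
  fixes f :: "complex poly" and c1 c2 :: complex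
  assumes f: "is_shabat f c1 c2"
begin

lemma shabat_basic: "degree f > 0" "c1 \<noteq> c2"
  using f by (auto simp: is_shabat_def)

lemma shabat_tree_ends:
  assumes "e \<in> shabat_edges f c1 c2"
  shows "poly f v = c1 \<Longrightarrow> v \<in> closure e \<longleftrightarrow> black_end (shabat_tree f c1 c2) e = v"
    and "poly f v = c2 \<Longrightarrow> v \<in> closure e \<longleftrightarrow> white_end (shabat_tree f c1 c2) e = v"
    and "poly f (black_end (shabat_tree f c1 c2) e) = c1"
    and "poly f (white_end (shabat_tree f c1 c2) e) = c2"
proof -
  note n = poly_normalized(2,3)[OF shabat_basic(2), of f]
  have e: "e \<in> shabat_edges (normalized f c1 c2) 0 1"
    using assms shabat_edges_normalized[OF shabat_basic(2)] by simp
  have b: "\<exists>!v. poly f v = c1 \<and> v \<in> closure e" and w: "\<exists>!v. poly f v = c2 \<and> v \<in> closure e"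
    using belyi_poly.edge_ends[OF belyi_poly_normalized[OF f] e] unfolding n .
  have b': "poly f (black_end (shabat_tree f c1 c2) e) = c1 \<and> black_end (shabat_tree f c1 c2) e \<in> closure e"
    using theI'[OF b] by (simp add: shabat_tree_def)
  have w': "poly f (white_end (shabat_tree f c1 c2) e) = c2 \<and> white_end (shabat_tree f c1 c2) e \<in> closure e"
    using theI'[OF w] by (simp add: shabat_tree_def)
  show "poly f (black_end (shabat_tree f c1 c2) e) = c1" "poly f (white_end (shabat_tree f c1 c2) e) = c2"
    using b' w' by blast+
  show "v \<in> closure e \<longleftrightarrow> black_end (shabat_tree f c1 c2) e = v" if "poly f v = c1"
    using b b' that by blast
  show "v \<in> closure e \<longleftrightarrow> white_end (shabat_tree f c1 c2) e = v" if "poly f v = c2"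
    using w w' that by blast
qed

lemma shabat_tree_edges_at:
  assumes "v \<in> vertices (shabat_tree f c1 c2)"
  shows "edges_at (shabat_tree f c1 c2) v = {e \<in> shabat_edges f c1 c2. v \<in> closure e}"
proof -
  have "v \<in> closure e \<longleftrightarrow> black_end (shabat_tree f c1 c2) e = v \<or> white_end (shabat_tree f c1 c2) e = v"
    if e: "e \<in> shabat_edges f c1 c2" for e
  proof (cases "poly f v = c1")
    case True
    then have "white_end (shabat_tree f c1 c2) e \<noteq> v" using shabat_tree_ends(4)[OF e] shabat_basic by auto
    then show ?thesis using shabat_tree_ends(1)[OF e True] by simp
  next
    case False
    then have v: "poly f v = c2" using assms by (simp add: vertices_def)
    have "black_end (shabat_tree f c1 c2) e \<noteq> v" using shabat_tree_ends(3)[OF e] False by auto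
    then show ?thesis using shabat_tree_ends(2)[OF e v] by simp
  qed
  then show ?thesis by (auto simp: edges_at_def)
qed

lemma shabat_tree_black:
  assumes "poly f v = c1"
  shows "vertex_degree (shabat_tree f c1 c2) v = order v (f - [:c1:])"
    and "cyclic_on (rot (shabat_tree f c1 c2) v) (edges_at (shabat_tree f c1 c2) v)"
proof -
  let ?E = "{e \<in> shabat_edges f c1 c2. v \<in> closure e}"
  have at: "edges_at (shabat_tree f c1 c2) v = ?E"
    using assms by (intro shabat_tree_edges_at) (simp add: vertices_def)
  have "poly (normalized f c1 c2) v = 0" using assms poly_normalized(2)[OF shabat_basic(2)] by simp
  note * = belyi_poly.black_edges[OF belyi_poly_normalized[OF f] this, folded shabat_edges_normalized[OF shabat_basic(2)]]
  show "vertex_degree (shabat_tree f c1 c2) v = order v (f - [:c1:])"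
    unfolding vertex_degree_def at using *(1) order_normalized(1)[OF shabat_basic(2)] by simp
  have "rot (shabat_tree f c1 c2) v = (\<lambda>e. arg_min_on (turn v e) ?E)" by (rule ext) simp
  then show "cyclic_on (rot (shabat_tree f c1 c2) v) (edges_at (shabat_tree f c1 c2) v)"
    unfolding at using *(2) by simp
qed

lemma shabat_tree_white:
  assumes "poly f v = c2"
  shows "vertex_degree (shabat_tree f c1 c2) v = order v (f - [:c2:])"
    and "cyclic_on (rot (shabat_tree f c1 c2) v) (edges_at (shabat_tree f c1 c2) v)"
proof -
  let ?E = "{e \<in> shabat_edges f c1 c2. v \<in> closure e}"
  have at: "edges_at (shabat_tree f c1 c2) v = ?E"
    using assms by (intro shabat_tree_edges_at) (simp add: vertices_def)
  have "poly (normalized f c1 c2) v = 1" using assms poly_normalized(3)[OF shabat_basic(2)] by simp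
  note * = belyi_poly.white_edges[OF belyi_poly_normalized[OF f] this, folded shabat_edges_normalized[OF shabat_basic(2)]]
  show "vertex_degree (shabat_tree f c1 c2) v = order v (f - [:c2:])"
    unfolding vertex_degree_def at using *(1) order_normalized(2)[OF shabat_basic(2)] by simp
  have "rot (shabat_tree f c1 c2) v = (\<lambda>e. arg_min_on (turn v e) ?E)" by (rule ext) simp
  then show "cyclic_on (rot (shabat_tree f c1 c2) v) (edges_at (shabat_tree f c1 c2) v)"
    unfolding at using *(2) by simp
qed

lemma shabat_tree_edges: "card (shabat_edges f c1 c2) = degree f" "finite (shabat_edges f c1 c2)"
proof -
  have "card (shabat_edges f c1 c2) = degree (normalized f c1 c2)"
    using belyi_poly.card_shabat_edges[OF belyi_poly_normalized[OF f]]
      shabat_edges_normalized[OF shabat_basic(2)] by simp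
  also have "\<dots> = degree f"
    using shabat_basic degree_diff_const(1)[OF shabat_basic(1)] by (simp add: normalized_def)
  finally show "card (shabat_edges f c1 c2) = degree f" .
  then show "finite (shabat_edges f c1 c2)" using shabat_basic(1) by (intro card_ge_0_finite) simp
qed

lemma finite_poly_fibre: "finite {z. poly f z = c}"
  using poly_roots_finite[OF degree_diff_const(2)[OF shabat_basic(1)], of c] by simp

lemma shabat_tree_connected: "connected_graph (shabat_tree f c1 c2)"
proof -
  let ?T = "shabat_tree f c1 c2" and ?E = "shabat_edges f c1 c2"
  have at: "\<exists>e\<in>?E. black_end ?T e = v \<or> white_end ?T e = v" if "v \<in> vertices ?T" for v
  proof -
    have "cyclic_on (rot ?T v) (edges_at ?T v)"
      using that shabat_tree_black(2) shabat_tree_white(2) by (auto simp: vertices_def)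
    then have "edges_at ?T v \<noteq> {}" by (rule cyclic_on_nonempty)
    then show ?thesis by (auto simp: edges_at_def)
  qed
  have "?E \<noteq> {}" using shabat_tree_edges(1) shabat_basic(1) by (metis card.empty less_irrefl)
  then obtain e0 where e0: "e0 \<in> ?E" by blast
  define u where "u = black_end ?T e0"
  have u: "u \<in> vertices ?T" using shabat_tree_ends(3)[OF e0] by (simp add: u_def vertices_def)
  \<comment> \<open>Closed under sharing a vertex: edges at a common black vertex have the same
    black end, and passing through a common white vertex takes two steps of adjacency.\<close>
  define S where "S = {e \<in> ?E. (u, black_end ?T e) \<in> (adjacency ?T)\<^sup>*}"
  have adj: "(black_end ?T e, white_end ?T e) \<in> adjacency ?T" "(white_end ?T e, black_end ?T e) \<in> adjacency ?T"
    if "e \<in> ?E" for e using edge_adjacent[of e ?T] that by simp_all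
  have "S = ?E"
    unfolding shabat_edges_normalized[OF shabat_basic(2)]
  proof (rule belyi_poly.shabat_edges_connected[OF belyi_poly_normalized[OF f]],
      unfold shabat_edges_normalized[OF shabat_basic(2), symmetric])
    show "S \<subseteq> ?E" by (auto simp: S_def)
    show "S \<noteq> {}" using e0 by (auto simp: S_def u_def)
    fix e e' v assume e: "e \<in> S" "e' \<in> ?E" and v: "poly (normalized f c1 c2) v \<in> {0, 1}"
      and cl: "v \<in> closure e" "v \<in> closure e'"
    have eE: "e \<in> ?E" and r: "(u, black_end ?T e) \<in> (adjacency ?T)\<^sup>*" using e(1) by (auto simp: S_def)
    from v have "poly f v = c1 \<or> poly f v = c2" using poly_normalized(2,3)[OF shabat_basic(2), of f v] by auto
    then have "(u, black_end ?T e') \<in> (adjacency ?T)\<^sup>*"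
    proof
      assume "poly f v = c1"
      then have "black_end ?T e' = black_end ?T e"
        using shabat_tree_ends(1)[OF eE] shabat_tree_ends(1)[OF e(2)] cl by simp
      then show ?thesis using r by simp
    next
      assume "poly f v = c2"
      then have "white_end ?T e' = white_end ?T e"
        using shabat_tree_ends(2)[OF eE] shabat_tree_ends(2)[OF e(2)] cl by simp
      then show ?thesis
        using rtrancl_into_rtrancl[OF rtrancl_into_rtrancl[OF r adj(1)[OF eE]], of "black_end ?T e'"]
          adj(2)[OF e(2)] by simp
    qed
    then show "e' \<in> S" using e(2) by (simp add: S_def)
  qed
  then have reach: "(u, black_end ?T e) \<in> (adjacency ?T)\<^sup>*" if "e \<in> ?E" for e
    using that unfolding S_def by blast
  show ?thesis
  proof (rule connected_graphI[OF u])
    fix v assume "v \<in> vertices ?T"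
    then obtain e where e: "e \<in> ?E" "black_end ?T e = v \<or> white_end ?T e = v" using at by blast
    then show "(u, v) \<in> (adjacency ?T)\<^sup>*"
      using reach[OF e(1)] rtrancl_into_rtrancl[OF reach[OF e(1)] adj(1)[OF e(1)]] by auto
  qed
qed

lemma shabat_tree_connected_map: "connected_map (shabat_tree f c1 c2)"
  unfolding connected_map_def
proof (intro conjI ballI)
  fix v assume "v \<in> vertices (shabat_tree f c1 c2)"
  then have "poly f v = c1 \<or> poly f v = c2" by (simp add: vertices_def)
  then show "cyclic_on (rot (shabat_tree f c1 c2) v) (edges_at (shabat_tree f c1 c2) v)"
    using shabat_tree_black(2) shabat_tree_white(2) by blast
next
  show "connected_graph (shabat_tree f c1 c2)" by (rule shabat_tree_connected)
qed (use shabat_basic finite_poly_fibre shabat_tree_edges(2) shabat_tree_ends(3,4) in auto)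

end

section \<open>Passports in terms of multiplicities, and their invariance under isomorphism\<close>

definition ramification :: "complex poly \<Rightarrow> complex \<Rightarrow> nat multiset" where
  "ramification f c = image_mset (\<lambda>v. order v (f - [:c:])) (mset_set {z. poly f z = c})"

lemma passport_shabat_tree:
  assumes "is_shabat f c1 c2"
  shows "passport (shabat_tree f c1 c2) = (ramification f c1, ramification f c2, degree f)"
proof -
  have "image_mset (vertex_degree (shabat_tree f c1 c2)) (mset_set {z. poly f z = c1}) = ramification f c1"
    unfolding ramification_def
    using finite_poly_fibre[OF assms] shabat_tree_black(1)[OF assms] by (intro image_mset_cong) simp
  moreover have "image_mset (vertex_degree (shabat_tree f c1 c2)) (mset_set {z. poly f z = c2}) = ramification f c2"
    unfolding ramification_def
    using finite_poly_fibre[OF assms] shabat_tree_white(1)[OF assms] by (intro image_mset_cong) simp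
  ultimately show ?thesis using shabat_tree_edges(1)[OF assms] by (simp add: passport_def)
qed

lemma isomorphism_degree:
  assumes G: "connected_map G" and H: "connected_map H"
    and \<phi>: "bij_betw \<phi> (black G) (black H)" "bij_betw \<phi> (white G) (white H)"
    and \<psi>: "bij_betw \<psi> (edges G) (edges H)"
    and ends: "\<And>e. e \<in> edges G \<Longrightarrow> black_end H (\<psi> e) = \<phi> (black_end G e) \<and> white_end H (\<psi> e) = \<phi> (white_end G e)"
  shows "v \<in> black G \<Longrightarrow> vertex_degree H (\<phi> v) = vertex_degree G v"
    and "v \<in> white G \<Longrightarrow> vertex_degree H (\<phi> v) = vertex_degree G v"
proof -
  have im: "\<psi> ` edges G = edges H" and inj: "inj_on \<psi> (edges G)" using \<psi> by (auto simp: bij_betw_def)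
  have in_G: "black_end G e \<in> black G" "white_end G e \<in> white G" if "e \<in> edges G" for e
    using G that by (auto simp: connected_map_def)
  show "vertex_degree H (\<phi> v) = vertex_degree G v" if v: "v \<in> black G"
  proof -
    have \<phi>v: "\<phi> v \<in> black H" using \<phi>(1) v by (auto simp: bij_betw_def)
    have "black_end H (\<psi> e) = \<phi> v \<longleftrightarrow> black_end G e = v" if "e \<in> edges G" for e
      using ends[OF that] \<phi>(1) v in_G(1)[OF that] by (metis bij_betw_def inj_on_eq_iff)
    then have "{e \<in> edges H. black_end H e = \<phi> v} = \<psi> ` {e \<in> edges G. black_end G e = v}"
      unfolding im[symmetric] by blast
    then show ?thesis
      unfolding vertex_degree_def edges_at_end(1)[OF G v] edges_at_end(1)[OF H \<phi>v]
      using card_image[OF inj_on_subset[OF inj, of "{e \<in> edges G. black_end G e = v}"]] by auto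
  qed
  show "vertex_degree H (\<phi> v) = vertex_degree G v" if v: "v \<in> white G"
  proof -
    have \<phi>v: "\<phi> v \<in> white H" using \<phi>(2) v by (auto simp: bij_betw_def)
    have "white_end H (\<psi> e) = \<phi> v \<longleftrightarrow> white_end G e = v" if "e \<in> edges G" for e
      using ends[OF that] \<phi>(2) v in_G(2)[OF that] by (metis bij_betw_def inj_on_eq_iff)
    then have "{e \<in> edges H. white_end H e = \<phi> v} = \<psi> ` {e \<in> edges G. white_end G e = v}"
      unfolding im[symmetric] by blast
    then show ?thesis
      unfolding vertex_degree_def edges_at_end(2)[OF G v] edges_at_end(2)[OF H \<phi>v]
      using card_image[OF inj_on_subset[OF inj, of "{e \<in> edges G. white_end G e = v}"]] by auto
  qed
qed

lemma passport_isomorphic: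
  assumes G: "connected_map G" and H: "connected_map H" and iso: "plane_isomorphic G H"
  shows "passport G = passport H"
proof -
  obtain \<phi> \<psi> where *: "bij_betw \<phi> (black G) (black H)" "bij_betw \<phi> (white G) (white H)"
    "bij_betw \<psi> (edges G) (edges H)"
    "\<And>e. e \<in> edges G \<Longrightarrow> black_end H (\<psi> e) = \<phi> (black_end G e) \<and> white_end H (\<psi> e) = \<phi> (white_end G e)"
    using iso unfolding plane_isomorphic_def by blast
  note deg = isomorphism_degree[OF G H *]
  have fin: "finite (black G)" "finite (white G)" using G by (auto simp: connected_map_def)
  have m: "image_mset (vertex_degree G) (mset_set A) = image_mset (vertex_degree H) (mset_set B)"
    if "bij_betw \<phi> A B" "finite A" "\<And>v. v \<in> A \<Longrightarrow> vertex_degree H (\<phi> v) = vertex_degree G v" for A B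
  proof -
    have "mset_set B = image_mset \<phi> (mset_set A)"
      using that(1) by (simp add: bij_betw_def image_mset_mset_set)
    then have "image_mset (vertex_degree H) (mset_set B) = image_mset (\<lambda>v. vertex_degree H (\<phi> v)) (mset_set A)"
      by (simp add: image_mset.compositionality comp_def)
    also have "\<dots> = image_mset (vertex_degree G) (mset_set A)"
      using that(2,3) by (intro image_mset_cong) simp
    finally show ?thesis ..
  qed
  show ?thesis
    unfolding passport_def using m[OF *(1) fin(1) deg(1)] m[OF *(2) fin(2) deg(2)] bij_betw_same_card[OF *(3)]
    by simp
qed

text \<open>Every root of \<open>f - [:c2:]\<close> is double and this polynomial is a multiple of
  \<open>S^2\<close>, so \<open>S\<close> has simple roots at the white vertices. That is the local
  injectivity behind the change of sign.\<close>

lemma shabat_tree_opposite_sign: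
  assumes f: "is_shabat f c1 c2"
    and e: "e \<in> shabat_edges f c1 c2" "e' \<in> shabat_edges f c1 c2" "e \<noteq> e'"
    and w: "white_end (shabat_tree f c1 c2) e = white_end (shabat_tree f c1 c2) e'"
    and S: "f - [:c2:] = smult C (S ^ 2)" "ramification f c2 = {#2, 2, 2, 2, 2#}"
  shows "poly S (black_end (shabat_tree f c1 c2) e') = - poly S (black_end (shabat_tree f c1 c2) e)"
proof -
  let ?T = "shabat_tree f c1 c2"
  define u where "u = white_end ?T e"
  have ne: "c1 \<noteq> c2" using shabat_basic[OF f] by simp
  have u: "poly f u = c2" "u \<in> closure e" "u \<in> closure e'"
    using shabat_tree_ends(2,4)[OF f e(1)] shabat_tree_ends(2,4)[OF f e(2)] w by (auto simp: u_def)
  have b: "poly f (black_end ?T e) = c1" "black_end ?T e \<in> closure e"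
    "poly f (black_end ?T e') = c1" "black_end ?T e' \<in> closure e'"
    using shabat_tree_ends(1,3)[OF f e(1)] shabat_tree_ends(1,3)[OF f e(2)] by auto
  have nz: "f - [:c2:] \<noteq> 0" using degree_diff_const(2)[OF shabat_basic(1)[OF f]] .
  then have CS: "C \<noteq> 0" "S \<noteq> 0" using S(1) by auto
  have "order u (f - [:c2:]) \<in># ramification f c2"
    unfolding ramification_def using u(1) finite_poly_fibre[OF f] by simp
  then have "order u (f - [:c2:]) = 2" unfolding S(2) by auto
  moreover have "order u (f - [:c2:]) = order u S + order u S"
    unfolding S(1) power2_eq_square using CS by (simp add: order_smult order_mult)
  ultimately have "order u S = 1" by simp
  moreover have "pderiv S \<noteq> 0"
  proof
    assume "pderiv S = 0"
    then obtain k where "S = [:k:]" by (metis degree_eq_zeroE pderiv_eq_0_iff)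
    moreover have "k \<noteq> 0" using \<open>S = [:k:]\<close> CS(2) by auto
    ultimately have "order u S = 0" by (intro order_0I) simp
    then show False using \<open>order u S = 1\<close> by simp
  qed
  ultimately have "order u (pderiv S) = 0" using order_pderiv[of S u] CS(2) order_root[of S u] by simp
  then have S': "poly (pderiv S) u \<noteq> 0" using \<open>pderiv S \<noteq> 0\<close> order_root by blast
  have sq: "poly (normalized f c1 c2) y - 1 = C / (c2 - c1) * poly S y ^ 2" for y
  proof -
    have "poly f y - c2 = C * poly S y ^ 2" using arg_cong[OF S(1), of "\<lambda>p. poly p y"] by simp
    then show ?thesis unfolding poly_normalized(1)[OF ne] using ne by (simp add: field_simps)
  qed
  show ?thesis
    by (rule belyi_poly.opposite_sign_across_white[OF belyi_poly_normalized[OF f] _ _ e(3), where u = u and C = "C / (c2 - c1)"])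
      (use e u b S' sq in \<open>simp_all add: shabat_edges_normalized[OF ne, symmetric] poly_normalized(2,3)[OF ne]\<close>)
qed

section \<open>Classification of the polynomials\<close>

lemma order_pcompose_linear:
  fixes h :: "complex poly"
  assumes "h \<noteq> 0" "a \<noteq> 0"
  shows "order z (pcompose h [:b, a:]) = order (a * z + b) h"
proof -
  let ?y = "a * z + b"
  obtain k where k: "h = [:- ?y, 1:] ^ order ?y h * k" "\<not> [:- ?y, 1:] dvd k"
    using order_decomp[OF assms(1)] by blast
  have "poly k ?y \<noteq> 0" using k(2) by (simp add: poly_eq_0_iff_dvd)
  then have kz: "poly (pcompose k [:b, a:]) z \<noteq> 0" by (simp add: poly_pcompose algebra_simps)
  then have k0: "pcompose k [:b, a:] \<noteq> 0" by auto
  have "pcompose h [:b, a:] = smult (a ^ order ?y h) ([:- z, 1:] ^ order ?y h) * pcompose k [:b, a:]"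
  proof (rule poly_ext)
    fix x
    have "a * x + b - ?y = a * (x - z)" by (simp add: algebra_simps)
    moreover have "poly h (a * x + b) = (a * x + b - ?y) ^ order ?y h * poly k (a * x + b)"
      by (subst k(1)) (simp add: poly_power)
    ultimately show "poly (pcompose h [:b, a:]) x =
        poly (smult (a ^ order ?y h) ([:- z, 1:] ^ order ?y h) * pcompose k [:b, a:]) x"
      by (simp add: poly_pcompose poly_power power_mult_distrib add.commute mult.commute[of x a])
  qed
  also have "order z \<dots> = order ?y h + order z (pcompose k [:b, a:])"
    using assms(2) k0 by (simp add: order_mult order_smult order_power_n_n)
  also have "order z (pcompose k [:b, a:]) = 0" using kz by (rule order_0I)
  finally show ?thesis by simp
qed

lemma shabat_equivalent_poly:
  assumes "shabat_equivalent (f, c11, c12) (g, c21, c22)"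
  obtains A B a b where "A \<noteq> 0" "a \<noteq> 0" "g = smult A (pcompose f [:b, a:]) + [:B:]"
    "c21 = A * c11 + B" "c22 = A * c12 + B"
proof -
  obtain A B a b where *: "A \<noteq> 0" "a \<noteq> 0" "\<forall>x. poly g x = A * poly f (a * x + b) + B"
    "c21 = A * c11 + B" "c22 = A * c12 + B"
    using assms unfolding shabat_equivalent_def by auto
  have "g = smult A (pcompose f [:b, a:]) + [:B:]"
    using *(3) by (intro poly_ext) (simp add: poly_pcompose add.commute mult.commute)
  then show ?thesis using that * by blast
qed

lemma ramification_affine:
  fixes f :: "complex poly"
  assumes "degree f > 0" "A \<noteq> 0" "a \<noteq> 0"
    and g: "g = smult A (pcompose f [:b, a:]) + [:B:]"
  shows "poly g z = A * c + B \<longleftrightarrow> poly f (a * z + b) = c"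
    and "order z (g - [:A * c + B:]) = order (a * z + b) (f - [:c:])"
    and "ramification g (A * c + B) = ramification f c"
proof -
  show 1: "poly g z = A * c + B \<longleftrightarrow> poly f (a * z + b) = c" for z
    unfolding g using assms(2) by (simp add: poly_pcompose algebra_simps)
  have "g - [:A * c + B:] = smult A (pcompose (f - [:c:]) [:b, a:])"
    unfolding g by (simp add: pcompose_diff smult_diff_right)
  then show 2: "order z (g - [:A * c + B:]) = order (a * z + b) (f - [:c:])" for z
    using assms degree_diff_const(2)[OF assms(1)] by (simp add: order_smult order_pcompose_linear)
  let ?L = "\<lambda>z. a * z + b"
  have "bij_betw ?L {z. poly g z = A * c + B} {z. poly f z = c}"
    by (rule bij_betwI[where g = "\<lambda>y. (y - b) / a"]) (use assms(3) 1 in \<open>auto simp: field_simps\<close>)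
  then have "mset_set {z. poly f z = c} = image_mset ?L (mset_set {z. poly g z = A * c + B})"
    by (simp add: bij_betw_def image_mset_mset_set)
  then show "ramification g (A * c + B) = ramification f c"
    unfolding ramification_def 2 by (simp add: image_mset.compositionality comp_def)
qed

lemma shabat_equivalent_shabat:
  assumes f: "is_shabat f c11 c12" and eq: "shabat_equivalent (f, c11, c12) (g, c21, c22)"
  shows "is_shabat g c21 c22" "ramification g c21 = ramification f c11" "ramification g c22 = ramification f c12"
    "degree g = degree f"
proof -
  obtain A B a b where *: "A \<noteq> 0" "a \<noteq> 0" "g = smult A (pcompose f [:b, a:]) + [:B:]"
    "c21 = A * c11 + B" "c22 = A * c12 + B"
    using shabat_equivalent_poly[OF eq] .
  have deg: "degree f > 0" and ne: "c11 \<noteq> c12" using shabat_basic[OF f] by auto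
  show "ramification g c21 = ramification f c11" "ramification g c22 = ramification f c12"
    unfolding *(4,5) by (rule ramification_affine(3)[OF deg *(1-3)])+
  have dL: "degree (smult A (pcompose f [:b, a:])) = degree f"
    using *(1,2) by (simp add: degree_pcompose)
  show dg: "degree g = degree f"
    unfolding *(3) using dL degree_add_eq_left[of "[:B:]" "smult A (pcompose f [:b, a:])"] deg by simp
  show "is_shabat g c21 c22"
    unfolding is_shabat_def
  proof (intro conjI allI impI)
    show "0 < degree g" using dg deg by simp
    show "c21 \<noteq> c22" using *(1,4,5) ne by simp
    fix z assume "poly (pderiv g) z = 0"
    then have "poly (pderiv f) (a * z + b) = 0"
      using *(1,2) unfolding *(3)
      by (simp add: pderiv_add pderiv_smult pderiv_pcompose poly_pcompose pderiv_pCons algebra_simps)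
    then have "poly f (a * z + b) \<in> {c11, c12}" using f unfolding is_shabat_def by blast
    then show "poly g z \<in> {c21, c22}"
      using ramification_affine(1)[OF deg *(1-3), of z] unfolding *(4,5) by auto
  qed
qed

text \<open>For \<open>f = C S\<^sup>2 + w\<close> the ramification over \<open>b \<noteq> w\<close> is that of \<open>S'\<close>, because \<open>S\<close> does not
  vanish there.\<close>

locale square_shabat =
  fixes f S :: "complex poly" and C w b a p q :: complex
  assumes f: "f - [:w:] = smult C (S ^ 2)" and C: "C \<noteq> 0" and bw: "b \<noteq> w"
    and degS: "degree S = 5"
    and dS: "pderiv S = smult 5 ([:-a, 1:] ^ 2 * [:-p, 1:] * [:-q, 1:])"
    and apq: "distinct [a, p, q]"
    and val: "poly f a = b" "poly f p = b" "poly f q = b"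
begin

lemma poly_f: "poly f z = C * poly S z ^ 2 + w"
  using arg_cong[OF f, of "\<lambda>p. poly p z"] by (simp add: algebra_simps)

lemma S_nz: "S \<noteq> 0" using degS by auto

lemma degree_f: "degree f = 10"
proof -
  have "degree (smult C (S ^ 2)) = 10" using C degS S_nz by (simp add: degree_power_eq)
  then have "degree (f - [:w:]) = 10" using f by simp
  then show ?thesis using degree_add_eq_left[of "[:w:]" "f - [:w:]"] by simp
qed

lemma pderiv_f: "pderiv f = smult (2 * C) (S * pderiv S)"
proof -
  have "pderiv f = pderiv (f - [:w:])" by (simp add: pderiv_diff)
  also have "\<dots> = smult (2 * C) (S * pderiv S)"
    unfolding f power2_eq_square
    by (intro poly_ext) (simp add: pderiv_smult pderiv_mult algebra_simps)
  finally show ?thesis .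
qed

lemma order_dS: "order z (pderiv S) = (if z = a then 2 else if z = p \<or> z = q then 1 else 0)"
proof -
  have lin: "order z [:-c, 1:] = (if z = c then 1 else 0)" for c :: complex
    using order_power_n_n[of c 1] order_0I[of "[:-c, 1:]" z] by auto
  have nz: "[:-a, 1:] ^ 2 * [:-p, 1:] * [:-q, 1:] \<noteq> 0" by (simp del: mult_pCons_left mult_pCons_right)
  have "order z (pderiv S) = order z ([:-a, 1:] ^ 2) + order z [:-p, 1:] + order z [:-q, 1:]"
    unfolding dS using nz by (simp add: order_smult order_mult del: mult_pCons_left mult_pCons_right)
  also have "order z ([:-a, 1:] ^ 2) = order z [:-a, 1:] + order z [:-a, 1:]"
    unfolding power2_eq_square by (intro order_mult) simp
  finally show ?thesis unfolding lin using apq by auto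
qed

lemma dS_nz: "pderiv S \<noteq> 0"
  unfolding dS by (simp del: mult_pCons_left mult_pCons_right)

lemma order_b:
  assumes "poly f z = b"
  shows "order z (f - [:b:]) = (if z = a then 3 else if z = p \<or> z = q then 2 else 1)"
proof -
  have "poly S z \<noteq> 0" using assms bw poly_f[of z] by auto
  then have "order z S = 0" by (rule order_0I)
  then have o: "order z (pderiv f) = order z (pderiv S)"
    unfolding pderiv_f using C S_nz dS_nz by (simp add: order_smult order_mult)
  have "pderiv (f - [:b:]) = pderiv f" by (simp add: pderiv_diff)
  moreover have "pderiv f \<noteq> 0" unfolding pderiv_f using C S_nz dS_nz by simp
  moreover have "f - [:b:] \<noteq> 0" using degree_diff_const(2)[of f b] degree_f by simp
  ultimately have "order z (f - [:b:]) = Suc (order z (pderiv f))"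
    using order_pderiv[of "f - [:b:]" z] assms by simp
  then show ?thesis unfolding o order_dS by simp
qed

text \<open>Of ten roots counted with multiplicity, \<open>a\<close>, \<open>p\<close> and
  \<open>q\<close> take seven; every other root over \<open>b\<close> is simple, so there are three
  of them.\<close>

lemma ramification_b: "ramification f b = {#3, 2, 2, 1, 1, 1#}"
proof -
  define U where "U = {z. poly f z = b}"
  have nz: "f - [:b:] \<noteq> 0" using degree_diff_const(2)[of f b] degree_f by simp
  have fin: "finite U" using poly_roots_finite[OF nz] by (simp add: U_def)
  define V where "V = U - {a, p, q}"
  have UV: "U = insert a (insert p (insert q V))" using val by (auto simp: U_def V_def)
  have V: "finite V" "a \<notin> V" "p \<notin> V" "q \<notin> V" using fin by (auto simp: V_def)
  let ?o = "\<lambda>z. order z (f - [:b:])"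
  have o: "?o a = 3" "?o p = 2" "?o q = 2" using order_b val apq by auto
  have oV: "?o z = 1" if "z \<in> V" for z using order_b[of z] that by (auto simp: V_def U_def)
  have "(\<Sum>z\<in>U. ?o z) = 10"
    using sum_order_eq_degree[OF nz] degree_diff_const(1)[of f b] degree_f by (simp add: U_def)
  moreover have "(\<Sum>z\<in>U. ?o z) = 7 + (\<Sum>z\<in>V. ?o z)"
    unfolding UV using V apq o by simp
  moreover have "(\<Sum>z\<in>V. ?o z) = card V" using oV by simp
  ultimately have "card V = 3" by simp
  have "ramification f b = image_mset ?o (mset_set U)" by (simp add: ramification_def U_def)
  also have "\<dots> = {#3, 2, 2#} + image_mset ?o (mset_set V)"
    unfolding UV using V apq o by simp
  also have "image_mset ?o (mset_set V) = image_mset (\<lambda>_. 1) (mset_set V)"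
    using V(1) oV by (intro image_mset_cong) simp
  also have "\<dots> = {#1, 1, 1#}" using \<open>card V = 3\<close> by (simp add: image_mset_const_eq numeral_3_eq_3)
  finally show ?thesis by simp
qed

text \<open>The roots of the derivative of \<open>S\<close> all lie over \<open>b\<close>, so no
  root of \<open>S\<close> is among them and each is simple.\<close>

lemma order_w:
  assumes "poly f z = w"
  shows "order z (f - [:w:]) = 2"
proof -
  have Sz: "poly S z = 0" using assms poly_f[of z] C by simp
  have "z \<notin> {a, p, q}" using assms val bw by auto
  then have "order z (pderiv S) = 0" using order_dS by simp
  then have "order z S = 1" using order_pderiv[of S z] Sz S_nz by simp
  then show ?thesis
    unfolding f power2_eq_square using C S_nz by (simp add: order_smult order_mult)
qed

lemma ramification_w: "ramification f w = {#2, 2, 2, 2, 2#}"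
proof -
  define U where "U = {z. poly f z = w}"
  have nz: "f - [:w:] \<noteq> 0" using degree_diff_const(2)[of f w] degree_f by simp
  have fin: "finite U" using poly_roots_finite[OF nz] by (simp add: U_def)
  have "(\<Sum>z\<in>U. order z (f - [:w:])) = 10"
    using sum_order_eq_degree[OF nz] degree_diff_const(1)[of f w] degree_f by (simp add: U_def)
  moreover have "(\<Sum>z\<in>U. order z (f - [:w:])) = 2 * card U" using order_w by (simp add: U_def)
  ultimately have "card U = 5" by simp
  have "ramification f w = image_mset (\<lambda>_. 2) (mset_set U)"
    unfolding ramification_def U_def[symmetric]
    using fin order_w by (intro image_mset_cong) (simp add: U_def)
  then show ?thesis using \<open>card U = 5\<close> by (simp add: image_mset_const_eq numeral_eq_Suc)
qed

lemma shabat: "is_shabat f b w"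
  unfolding is_shabat_def
proof (intro conjI allI impI)
  show "degree f > 0" using degree_f by simp
  fix z assume "poly (pderiv f) z = 0"
  then have "poly S z = 0 \<or> z = a \<or> z = p \<or> z = q" unfolding pderiv_f using C by (auto simp: dS)
  then show "poly f z \<in> {b, w}" using poly_f[of z] val by auto
qed (rule bw)

end

context square_shabat
begin

text \<open>Integration in the variable \<open>t = z - a\<close>: with \<open>P = p - a\<close> and
  \<open>Q = q - a\<close>, the derivative \<open>5 t^2 (t - P) (t - Q)\<close> has the primitive
  \<open>t^5 - 5/4 (P + Q) t^4 + 5/3 P Q t^3\<close>.\<close>

lemma S_formula:
  "poly S z = poly S a + (z - a) ^ 5 - 5 / 4 * ((p - a) + (q - a)) * (z - a) ^ 4
     + 5 / 3 * ((p - a) * (q - a)) * (z - a) ^ 3"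
proof -
  let ?G = "\<lambda>z. poly S z - ((z - a) ^ 5 - 5 / 4 * ((p - a) + (q - a)) * (z - a) ^ 4
     + 5 / 3 * ((p - a) * (q - a)) * (z - a) ^ 3)"
  have "(?G has_field_derivative 0) (at z within UNIV)" for z
  proof -
    have "poly (pderiv S) z = 5 * ((z - a) ^ 2 * (z - p) * (z - q))"
      unfolding dS by (simp add: poly_power algebra_simps)
    also have "\<dots> = 5 * (z - a) ^ 4 - 5 / 4 * ((p - a) + (q - a)) * (4 * (z - a) ^ 3)
      + 5 / 3 * ((p - a) * (q - a)) * (3 * (z - a) ^ 2)"
      by (simp add: field_simps) algebra
    finally have d: "poly (pderiv S) z = \<dots>" .
    show ?thesis
      by (rule derivative_eq_intros refl poly_DERIV | simp add: d)+
  qed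
  then obtain c where c: "\<And>z. ?G z = c"
    using has_field_derivative_zero_constant[of UNIV ?G] by auto
  have "?G z = ?G a" by (simp only: c)
  then show ?thesis by (simp add: algebra_simps)
qed

lemma square_at_critical:
  assumes "poly f v = b"
  shows "poly S v = poly S a \<or> poly S v = - poly S a"
proof -
  have "C * poly S v ^ 2 + w = C * poly S a ^ 2 + w" using assms val(1) poly_f by metis
  then show ?thesis using C by (simp add: power2_eq_iff)
qed

lemma S_a_nz: "poly S a \<noteq> 0"
  using poly_f[of a] val(1) bw by auto

lemma S_at_p: "poly S p = poly S a + (p - a) ^ 4 * (5 * (q - a) - 3 * (p - a)) / 12"
proof -
  define P Q where "P = p - a" and "Q = q - a"
  show ?thesis
    unfolding S_formula[of p] P_def[symmetric] Q_def[symmetric] by (simp add: field_simps) algebra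
qed

lemma swap: "square_shabat f S C w b a q p"
proof
  show "pderiv S = smult 5 ([:-a, 1:] ^ 2 * [:-q, 1:] * [:-p, 1:])"
    unfolding dS by (simp only: mult.assoc mult.commute[of "[:-p, 1:]" "[:-q, 1:]"])
qed (use f C bw degS apq val in auto)

lemma S_at_q: "poly S q = poly S a + (q - a) ^ 4 * (5 * (p - a) - 3 * (q - a)) / 12"
  using square_shabat.S_at_p[OF swap] .

text \<open>Equal values at \<open>p\<close> and \<open>a\<close> force \<open>5 Q = 3 P\<close>.
  The value at \<open>q\<close> then differs from that at \<open>a\<close>, so it is the opposite
  one, which fixes \<open>s\<close>. All is determined up to the scale \<open>Q\<close>; scale 1
  gives the composition \<open>F\<close>.\<close>

lemma equivalent_same_sign:
  assumes same: "poly S p = poly S a"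
    and F: "\<And>x. poly F x = (x ^ 3 * (x - 5 / 3) ^ 2) * (x ^ 3 * (x - 5 / 3) ^ 2 - 4 / 9)"
  shows "shabat_equivalent (F, 0, - (4 / 81)) (f, b, w)"
proof -
  define P Q s where "P = p - a" and "Q = q - a" and "s = poly S a"
  have nz: "P \<noteq> 0" "Q \<noteq> 0" "P \<noteq> Q" using apq by (auto simp: P_def Q_def)
  have "P ^ 4 * (5 * Q - 3 * P) = 0" using S_at_p same by (simp add: P_def Q_def)
  then have P: "P = 5 / 3 * Q" using nz by (simp add: field_simps)
  have Sq: "poly S q = s + Q ^ 5 * (4 / 9)"
  proof -
    have "poly S q = s + Q ^ 4 * (5 * P - 3 * Q) / 12" using S_at_q by (simp add: P_def Q_def s_def)
    also have "\<dots> = s + Q ^ 5 * (4 / 9)" unfolding P by (simp add: field_simps) algebra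
    finally show ?thesis .
  qed
  then have "poly S q \<noteq> s" using nz by simp
  then have "poly S q = - s" using square_at_critical[OF val(3)] by (simp add: s_def)
  then have s: "s = - (2 / 9) * Q ^ 5" using Sq by (simp add: field_simps) algebra
  \<comment> \<open>With \<open>r = y^3 (y - 5/3)^2\<close>, completing the square gives
    \<open>F = (r - 2/9)^2 - 4/81\<close>, while \<open>S = Q^5 (r - 2/9)\<close>; comparison with
    \<open>f = C S^2 + w\<close> yields these values.\<close>
  define A B where "A = C * Q ^ 10" and "B = w + 4 / 81 * (C * Q ^ 10)"
  have eq: "poly f x = A * poly F (1 / Q * x + - a / Q) + B" for x
  proof -
    define y where "y = (x - a) / Q"
    have y: "1 / Q * x + - a / Q = y" using nz by (simp add: y_def diff_divide_distrib)
    have t: "x - a = Q * y" using nz by (simp add: y_def)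
    have "poly S x = Q ^ 5 * (y ^ 3 * (y - 5 / 3) ^ 2 - 2 / 9)"
      unfolding S_formula[of x] s_def[symmetric] P_def[symmetric] Q_def[symmetric] t P s
      by (simp add: field_simps) algebra
    then have "poly f x = C * (Q ^ 5 * (y ^ 3 * (y - 5 / 3) ^ 2 - 2 / 9)) ^ 2 + w"
      unfolding poly_f by simp
    also have "\<dots> = A * poly F y + B"
      unfolding F A_def B_def by algebra
    finally show ?thesis unfolding y .
  qed
  have "A \<noteq> 0" using C nz by (simp add: A_def)
  moreover have "b = A * 0 + B"
  proof -
    have "b = C * s ^ 2 + w" using val(1) poly_f[of a] by (simp add: s_def)
    also have "\<dots> = A * 0 + B" unfolding s A_def B_def by algebra
    finally show ?thesis .
  qed
  moreover have "w = A * - (4 / 81) + B" by (simp add: A_def B_def)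
  moreover have "1 / Q \<noteq> 0" using nz by simp
  ultimately show ?thesis unfolding shabat_equivalent_def using eq by blast
qed

lemma equivalent_opposite_sign:
  assumes opp: "poly S p = - poly S a" "poly S q = - poly S a"
    and F: "\<And>x. poly F x = (x ^ 3 * (x ^ 2 + 5 / 3 * x + 40 / 9)) * (x ^ 3 * (x ^ 2 + 5 / 3 * x + 40 / 9) - 64 / 9)"
  shows "shabat_equivalent (F, 0, - (1024 / 81)) (f, b, w)"
proof -
  define P Q s where "P = p - a" and "Q = q - a" and "s = poly S a"
  have nz: "P \<noteq> 0" "Q \<noteq> 0" "P \<noteq> Q" using apq by (auto simp: P_def Q_def)
  have sp: "- s = s + P ^ 4 * (5 * Q - 3 * P) / 12" using S_at_p opp by (simp add: P_def Q_def s_def)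
  have sq: "- s = s + Q ^ 4 * (5 * P - 3 * Q) / 12" using S_at_q opp by (simp add: P_def Q_def s_def)
  have "P ^ 4 * (5 * Q - 3 * P) = Q ^ 4 * (5 * P - 3 * Q)" using sp sq by simp
  \<comment> \<open>The difference of the two quintic conditions factors; distinctness of
    \<open>p\<close> and \<open>q\<close> leaves the symmetric quadratic.\<close>
  then have "(P - Q) ^ 3 * (3 * P ^ 2 + 4 * P * Q + 3 * Q ^ 2) = 0" by algebra
  then have quad: "3 * P ^ 2 + 4 * P * Q + 3 * Q ^ 2 = 0" using nz by simp
  \<comment> \<open>The quadratic says \<open>3 (P + Q)^2 = 2 P Q\<close>, so one scale
    \<open>k\<close> determines both sum and product. Working with these avoids the square root of
    -5 that enters the ratio of \<open>P\<close> and \<open>Q\<close>; the factor is chosen so that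
    \<open>k = 1\<close> gives \<open>F\<close>.\<close>
  define k where "k = - (3 / 4) * (P + Q)"
  have sum: "P + Q = - (4 / 3) * k" by (simp add: k_def)
  have prod: "P * Q = 8 / 3 * k ^ 2" unfolding k_def using quad by (simp add: field_simps power2_eq_square) algebra
  have k: "k \<noteq> 0" using prod nz by auto
  have Psq: "P ^ 2 = - (4 / 3) * k * P - 8 / 3 * k ^ 2"
  proof -
    have "P ^ 2 = (P + Q) * P - P * Q" by (simp add: algebra_simps power2_eq_square)
    then show ?thesis unfolding sum prod .
  qed
  have s: "s = - (32 / 9) * k ^ 5"
  proof -
    have Q: "Q = - (4 / 3) * k - P" using sum by (simp add: algebra_simps)
    have "P ^ 4 * (5 * Q - 3 * P) = 256 / 3 * k ^ 5"
      using Psq unfolding Q by (simp add: field_simps) algebra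
    then show ?thesis using sp by (simp add: field_simps) algebra
  qed
  \<comment> \<open>With \<open>r\<close> the inner quintic at \<open>y\<close>,
    \<open>F = (r - 32/9)^2 - 1024/81\<close> and \<open>S = k^5 (r - 32/9)\<close>.\<close>
  define A B where "A = C * k ^ 10" and "B = w + 1024 / 81 * (C * k ^ 10)"
  have eq: "poly f x = A * poly F (1 / k * x + - a / k) + B" for x
  proof -
    define y where "y = (x - a) / k"
    have y: "1 / k * x + - a / k = y" using k by (simp add: y_def diff_divide_distrib)
    have t: "x - a = k * y" using k by (simp add: y_def)
    have "poly S x = k ^ 5 * (y ^ 3 * (y ^ 2 + 5 / 3 * y + 40 / 9) - 32 / 9)"
      unfolding S_formula[of x] s_def[symmetric] P_def[symmetric] Q_def[symmetric] t sum prod s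
      by (simp add: field_simps) algebra
    then have "poly f x = C * (k ^ 5 * (y ^ 3 * (y ^ 2 + 5 / 3 * y + 40 / 9) - 32 / 9)) ^ 2 + w"
      unfolding poly_f by simp
    also have "\<dots> = A * poly F y + B"
      unfolding F A_def B_def by algebra
    finally show ?thesis unfolding y .
  qed
  have "A \<noteq> 0" using C k by (simp add: A_def)
  moreover have "b = A * 0 + B"
  proof -
    have "b = C * s ^ 2 + w" using val(1) poly_f[of a] by (simp add: s_def)
    also have "\<dots> = A * 0 + B" unfolding s A_def B_def by algebra
    finally show ?thesis .
  qed
  moreover have "w = A * - (1024 / 81) + B" by (simp add: A_def B_def)
  moreover have "1 / k \<noteq> 0" using k by simp
  ultimately show ?thesis unfolding shabat_equivalent_def using eq by blast
qed

end

text \<open>\<open>S\<close> is the monic polynomial with simple roots at the five white vertices,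
  each a double root of \<open>f - [:w:]\<close>. At a point over \<open>b\<close> the factor
  \<open>S\<close> does not vanish, so the derivative of \<open>S\<close> has order one less than
  \<open>f - [:b:]\<close>; the orders 2, 1, 1 at \<open>a\<close>, \<open>p\<close>,
  \<open>q\<close> exhaust its degree 4.\<close>

lemma square_shabat_of_ramification:
  assumes sh: "is_shabat f b w" and deg: "degree f = 10"
    and rb: "ramification f b = {#3, 2, 2, 1, 1, 1#}" and rw: "ramification f w = {#2, 2, 2, 2, 2#}"
  obtains S C a p q where "square_shabat f S C w b a p q"
proof -
  have nzb: "f - [:b:] \<noteq> 0" and nzw: "f - [:w:] \<noteq> 0" using degree_diff_const(2)[of f] deg by simp_all
  define C where "C = lead_coeff (f - [:w:])"
  define U where "U = {z. poly f z = w}"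
  define S where "S = (\<Prod>z\<in>U. [:-z, 1:])"
  have finU: "finite U" unfolding U_def by (rule finite_poly_fibre[OF sh])
  have "order z (f - [:w:]) = 2" if "z \<in> U" for z
  proof -
    have "order z (f - [:w:]) \<in># ramification f w"
      unfolding ramification_def U_def[symmetric] using that finU by simp
    then show ?thesis unfolding rw by auto
  qed
  then have "(\<Prod>z\<in>U. [:-z, 1:] ^ order z (f - [:w:])) = S ^ 2"
    unfolding S_def prod_power_distrib by (intro prod.cong) auto
  then have f: "f - [:w:] = smult C (S ^ 2)"
    using complex_poly_decompose[of "f - [:w:]"] by (simp add: C_def U_def)
  have C: "C \<noteq> 0" unfolding C_def using nzw leading_coeff_0_iff by blast
  have S0: "S \<noteq> 0" using f nzw by auto
  have "degree (f - [:w:]) = 10" using degree_diff_const(1)[of f w] deg by simp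
  then have degS: "degree S = 5" unfolding f using C S0 by (simp add: degree_power_eq)
  have monic: "lead_coeff S = 1" unfolding S_def lead_coeff_prod by simp
  have bw: "b \<noteq> w" using shabat_basic(2)[OF sh] .
  have pf: "poly f z = C * poly S z ^ 2 + w" for z
    using arg_cong[OF f, of "\<lambda>p. poly p z"] by (simp add: algebra_simps)
  have finB: "finite {z. poly f z = b}" by (rule finite_poly_fibre[OF sh])
  have "image_mset (\<lambda>v. order v (f - [:b:])) (mset_set {z. poly f z = b}) = mset [3, 2, 2, 1, 1, 1]"
    using rb unfolding ramification_def by simp
  from image_mset_eq_mset_list[OF finB this]
  obtain vs where vs: "distinct vs" "set vs = {z. poly f z = b}" "map (\<lambda>v. order v (f - [:b:])) vs = [3, 2, 2, 1, 1, 1]"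
    by (elim exE conjE)
  have "length vs = 6" using arg_cong[OF vs(3), where f = length] by simp
  from list_of_length_6[OF this] obtain a p q x y z where abs: "vs = [a, p, q, x, y, z]"
    by (elim exE)
  have apq: "distinct [a, p, q]" using vs(1) unfolding abs by simp
  have val: "poly f a = b" "poly f p = b" "poly f q = b"
    using vs(2) unfolding abs by auto
  have o: "order a (f - [:b:]) = 3" "order p (f - [:b:]) = 2" "order q (f - [:b:]) = 2"
    using vs(3) unfolding abs by simp_all
  have dS5: "coeff (pderiv S) 4 = 5"
    using monic degS by (simp add: coeff_pderiv eval_nat_numeral)
  have dS0: "pderiv S \<noteq> 0" using dS5 by auto
  have degdS: "degree (pderiv S) = 4" using degS by (simp add: degree_pderiv)
  have pdf: "pderiv (f - [:b:]) = smult (2 * C) (S * pderiv S)"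
  proof -
    have "pderiv (f - [:b:]) = pderiv (f - [:w:])" by (simp add: pderiv_diff)
    also have "\<dots> = smult (2 * C) (S * pderiv S)"
      unfolding f power2_eq_square by (intro poly_ext) (simp add: pderiv_smult pderiv_mult algebra_simps)
    finally show ?thesis .
  qed
  have od: "order v (f - [:b:]) = Suc (order v (pderiv S))" if v: "poly f v = b" for v
  proof -
    have "poly S v \<noteq> 0" using pf[of v] v bw by auto
    then have "order v S = 0" by (rule order_0I)
    then have "order v (pderiv (f - [:b:])) = order v (pderiv S)"
      unfolding pdf using C S0 dS0 by (simp add: order_smult order_mult)
    then show ?thesis using order_pderiv[of "f - [:b:]" v] nzb v by simp
  qed
  have oS: "order a (pderiv S) = 2" "order p (pderiv S) = 1" "order q (pderiv S) = 1"
    using od[OF val(1)] od[OF val(2)] od[OF val(3)] o by simp_all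
  define W where "W = {z. poly (pderiv S) z = 0} - {a, p, q}"
  have finW: "finite W" using poly_roots_finite[OF dS0] by (simp add: W_def)
  have "a \<in> {z. poly (pderiv S) z = 0}" "p \<in> {z. poly (pderiv S) z = 0}" "q \<in> {z. poly (pderiv S) z = 0}"
    using oS order_root[of "pderiv S"] by auto
  then have roots: "{z. poly (pderiv S) z = 0} = insert a (insert p (insert q W))" by (auto simp: W_def)
  have W: "a \<notin> W" "p \<notin> W" "q \<notin> W" by (auto simp: W_def)
  have "(\<Sum>z\<in>W. order z (pderiv S)) = 0"
    using sum_order_eq_degree[OF dS0] W finW apq oS unfolding roots degdS by simp
  then have W0: "order z (pderiv S) = 0" if "z \<in> W" for z using that finW by simp
  have "W = {}"
  proof (rule ccontr)
    assume "W \<noteq> {}"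
    then obtain z where z: "z \<in> W" by blast
    then have "poly (pderiv S) z = 0" by (simp add: W_def)
    then show False using W0[OF z] order_root[of "pderiv S" z] dS0 by simp
  qed
  then have "pderiv S = smult (lead_coeff (pderiv S)) (\<Prod>z\<in>{a, p, q}. [:-z, 1:] ^ order z (pderiv S))"
    using complex_poly_decompose[of "pderiv S"] unfolding roots by simp
  also have "\<dots> = smult 5 ([:-a, 1:] ^ 2 * [:-p, 1:] * [:-q, 1:])"
    using apq oS dS5 degdS by (simp add: mult.assoc del: mult_pCons_left mult_pCons_right)
  finally have dS: "pderiv S = smult 5 ([:-a, 1:] ^ 2 * [:-p, 1:] * [:-q, 1:])" .
  show thesis
    by (rule that, unfold_locales) (fact f C bw degS dS apq val)+
qed

lemma shabat_uniqueness:
  assumes "is_shabat f b w" "degree f = 10"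
    and "ramification f b = {#3, 2, 2, 1, 1, 1#}" "ramification f w = {#2, 2, 2, 2, 2#}"
    and F1: "\<And>x. poly F1 x = (x ^ 3 * (x ^ 2 + 5 / 3 * x + 40 / 9)) * (x ^ 3 * (x ^ 2 + 5 / 3 * x + 40 / 9) - 64 / 9)"
    and F2: "\<And>x. poly F2 x = (x ^ 3 * (x - 5 / 3) ^ 2) * (x ^ 3 * (x - 5 / 3) ^ 2 - 4 / 9)"
  shows "shabat_equivalent (F1, 0, - (1024 / 81)) (f, b, w) \<or> shabat_equivalent (F2, 0, - (4 / 81)) (f, b, w)"
proof -
  obtain S C a p q where "square_shabat f S C w b a p q"
    using square_shabat_of_ramification[OF assms(1-4)] .
  then interpret square_shabat f S C w b a p q .
  consider "poly S p = poly S a" | "poly S q = poly S a" | "poly S p = - poly S a" "poly S q = - poly S a"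
    using square_at_critical[OF val(2)] square_at_critical[OF val(3)] by blast
  then show ?thesis
  proof cases
    case 1
    then show ?thesis using equivalent_same_sign[OF _ F2] by blast
  next
    case 2
    then show ?thesis using square_shabat.equivalent_same_sign[OF swap _ F2] by blast
  next
    case 3
    then show ?thesis using equivalent_opposite_sign[OF _ _ F1] by blast
  qed
qed

section \<open>Telling the two trees apart, and the final classification\<close>

text \<open>Carries the sign rule over to an abstract tree: \<open>v\<close> places its black
  vertices in the plane with their degrees as multiplicities, so contradictions can be read off from
  the tables of \<open>tree221\<close> and \<open>tree311\<close>.\<close>

lemma isomorphic_opposite_sign:
  assumes f: "is_shabat f c1 c2" and H: "connected_map H"
    and iso: "plane_isomorphic (shabat_tree f c1 c2) H"
    and S: "f - [:c2:] = smult C (S ^ 2)" "ramification f c2 = {#2, 2, 2, 2, 2#}"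
  obtains v where "inj_on v (black H)"
    "\<And>i. i \<in> black H \<Longrightarrow> poly f (v i) = c1 \<and> order (v i) (f - [:c1:]) = vertex_degree H i"
    "\<And>d e. d \<in> edges H \<Longrightarrow> e \<in> edges H \<Longrightarrow> d \<noteq> e \<Longrightarrow> white_end H d = white_end H e \<Longrightarrow>
      poly S (v (black_end H e)) = - poly S (v (black_end H d))"
proof -
  let ?G = "shabat_tree f c1 c2"
  have G: "connected_map ?G" by (rule shabat_tree_connected_map[OF f])
  obtain \<phi> \<psi> where iso': "bij_betw \<phi> (black ?G) (black H)" "bij_betw \<phi> (white ?G) (white H)"
    "bij_betw \<psi> (edges ?G) (edges H)"
    "\<And>e. e \<in> edges ?G \<Longrightarrow> black_end H (\<psi> e) = \<phi> (black_end ?G e) \<and> white_end H (\<psi> e) = \<phi> (white_end ?G e)"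
    using iso unfolding plane_isomorphic_def by blast
  define v where "v = inv_into (black ?G) \<phi>"
  have v: "v i \<in> black ?G" "\<phi> (v i) = i" if "i \<in> black H" for i
  proof -
    have "i \<in> \<phi> ` black ?G" using iso'(1) that unfolding bij_betw_def by blast
    then show "v i \<in> black ?G" "\<phi> (v i) = i" unfolding v_def by (rule inv_into_into, rule f_inv_into_f)
  qed
  have v\<phi>: "v (\<phi> u) = u" if "u \<in> black ?G" for u
    using iso'(1) that unfolding v_def bij_betw_def by simp
  have ends: "black_end ?G e \<in> black ?G" "white_end ?G e \<in> white ?G" if "e \<in> edges ?G" for e
    using G that unfolding connected_map_def by blast+
  have inj: "inj_on v (black H)" using v(2) by (rule inj_on_inverseI)
  have deg: "poly f (v i) = c1 \<and> order (v i) (f - [:c1:]) = vertex_degree H i" if "i \<in> black H" for i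
  proof -
    have "poly f (v i) = c1" using v(1)[OF that] by simp
    moreover have "vertex_degree H i = vertex_degree ?G (v i)"
      using isomorphism_degree(1)[OF G H iso' v(1)[OF that]] v(2)[OF that] by simp
    ultimately show ?thesis using shabat_tree_black(1)[OF f] by simp
  qed
  have opp: "poly S (v (black_end H e)) = - poly S (v (black_end H d))"
    if de: "d \<in> edges H" "e \<in> edges H" "d \<noteq> e" "white_end H d = white_end H e" for d e
  proof -
    have "\<psi> ` edges ?G = edges H" using iso'(3) by (simp add: bij_betw_def)
    then obtain d' e' where d': "d' \<in> edges ?G" "d = \<psi> d'" and e': "e' \<in> edges ?G" "e = \<psi> e'"
      using de(1,2) by blast
    have "\<phi> (white_end ?G d') = \<phi> (white_end ?G e')" using iso'(4)[OF d'(1)] iso'(4)[OF e'(1)] d'(2) e'(2) de(4) by simp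
    then have w: "white_end ?G d' = white_end ?G e'"
      using inj_onD[OF bij_betw_imp_inj_on[OF iso'(2)]] ends(2)[OF d'(1)] ends(2)[OF e'(1)] by blast
    have "poly S (black_end ?G e') = - poly S (black_end ?G d')"
      by (rule shabat_tree_opposite_sign[OF f _ _ _ w S]) (use d' e' de(3) in auto)
    then show ?thesis
      using iso'(4)[OF d'(1)] iso'(4)[OF e'(1)] d' e' v\<phi>[OF ends(1)[OF d'(1)]] v\<phi>[OF ends(1)[OF e'(1)]] by simp
  qed
  show ?thesis by (rule that[OF inj deg opp])
qed

lemma plane_isomorphic_trans:
  assumes "plane_isomorphic G H" "plane_isomorphic H K"
  shows "plane_isomorphic G K"
proof -
  obtain \<phi> \<psi> where 1: "bij_betw \<phi> (black G) (black H)" "bij_betw \<phi> (white G) (white H)"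
    "bij_betw \<psi> (edges G) (edges H)"
    "\<And>e. e \<in> edges G \<Longrightarrow> black_end H (\<psi> e) = \<phi> (black_end G e) \<and> white_end H (\<psi> e) = \<phi> (white_end G e)"
    "\<And>v e. v \<in> vertices G \<Longrightarrow> e \<in> edges_at G v \<Longrightarrow> \<psi> (rot G v e) = rot H (\<phi> v) (\<psi> e)"
    using assms(1) unfolding plane_isomorphic_def by blast
  obtain \<phi>' \<psi>' where 2: "bij_betw \<phi>' (black H) (black K)" "bij_betw \<phi>' (white H) (white K)"
    "bij_betw \<psi>' (edges H) (edges K)"
    "\<And>e. e \<in> edges H \<Longrightarrow> black_end K (\<psi>' e) = \<phi>' (black_end H e) \<and> white_end K (\<psi>' e) = \<phi>' (white_end H e)"
    "\<And>v e. v \<in> vertices H \<Longrightarrow> e \<in> edges_at H v \<Longrightarrow> \<psi>' (rot H v e) = rot K (\<phi>' v) (\<psi>' e)"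
    using assms(2) unfolding plane_isomorphic_def by blast
  have \<psi>: "\<psi> e \<in> edges H" if "e \<in> edges G" for e using 1(3) that by (rule bij_betw_apply)
  have at: "\<psi> e \<in> edges_at H (\<phi> v)" if "e \<in> edges_at G v" for e v
    using that \<psi>[of e] 1(4)[of e] by (auto simp: edges_at_def)
  have vert: "\<phi> v \<in> vertices H" if "v \<in> vertices G" for v
    using that bij_betw_apply[OF 1(1)] bij_betw_apply[OF 1(2)] by (auto simp: vertices_def)
  have r: "(\<psi>' \<circ> \<psi>) (rot G v e) = rot K ((\<phi>' \<circ> \<phi>) v) ((\<psi>' \<circ> \<psi>) e)"
    if "v \<in> vertices G" "e \<in> edges_at G v" for v e
    unfolding comp_def 1(5)[OF that] by (rule 2(5)[OF vert[OF that(1)] at[OF that(2)]])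
  have e: "black_end K ((\<psi>' \<circ> \<psi>) e) = (\<phi>' \<circ> \<phi>) (black_end G e)" "white_end K ((\<psi>' \<circ> \<psi>) e) = (\<phi>' \<circ> \<phi>) (white_end G e)"
    if "e \<in> edges G" for e
    using 1(4)[OF that] 2(4)[OF \<psi>[OF that]] by simp_all
  show ?thesis
    unfolding plane_isomorphic_def
    by (intro exI[of _ "\<phi>' \<circ> \<phi>"] exI[of _ "\<psi>' \<circ> \<psi>"] conjI ballI bij_betw_trans[OF 1(1) 2(1)]
        bij_betw_trans[OF 1(2) 2(2)] bij_betw_trans[OF 1(3) 2(3)] e r)
qed

lemma passport_of_isomorphic_shabat_tree:
  assumes "is_shabat f b w" "bicolored_plane_tree T" "plane_isomorphic (shabat_tree f b w) T"
  shows "passport T = (ramification f b, ramification f w, degree f)"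
  using passport_isomorphic[OF shabat_tree_connected_map[OF assms(1)] _ assms(3)] assms(2)
    passport_shabat_tree[OF assms(1)] by (simp add: bicolored_plane_tree_iff)

lemma tree_of_ramification:
  assumes "is_shabat f b w" "degree f = 10"
    and "ramification f b = {#3, 2, 2, 1, 1, 1#}" "ramification f w = {#2, 2, 2, 2, 2#}"
  shows "plane_isomorphic (shabat_tree f b w) tree221 \<or> plane_isomorphic (shabat_tree f b w) tree311"
  using two_trees[OF shabat_tree_connected_map[OF assms(1)]] passport_shabat_tree[OF assms(1)] assms(2-4)
  by simp

lemma square_pcompose:
  fixes f S :: "complex poly"
  assumes "F - [:c:] = smult C (S ^ 2)" "f = smult A (pcompose F [:b, a:]) + [:B:]"
  shows "f - [:A * c + B:] = smult (A * C) (pcompose S [:b, a:] ^ 2)"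
proof (rule poly_ext)
  fix x
  have "poly F (b + x * a) - c = C * poly S (b + x * a) ^ 2"
    using arg_cong[OF assms(1), of "\<lambda>p. poly p (b + x * a)"] by simp
  then have "poly F (b + x * a) = c + C * poly S (b + x * a) ^ 2" by (simp add: algebra_simps)
  then show "poly (f - [:A * c + B:]) x = poly (smult (A * C) (pcompose S [:b, a:] ^ 2)) x"
    unfolding assms(2) by (simp add: poly_pcompose algebra_simps)
qed

lemma (in square_shabat) degree_of_order:
  assumes "poly f y = b"
  shows "order y (f - [:b:]) = 3 \<Longrightarrow> y = a" and "order y (f - [:b:]) = 2 \<Longrightarrow> y = p \<or> y = q"
  using order_b[OF assms] by (auto split: if_splits)

text \<open>In \<open>tree311\<close> the trivalent vertex and the second vertex of its long leg are two steps apart, so \<open>S\<close>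
  would agree there.\<close>

lemma (in square_shabat) not_tree311:
  assumes opp: "poly S p = - poly S a" "poly S q = - poly S a"
    and eq: "shabat_equivalent (f, b, w) (g, b', w')"
  shows "\<not> plane_isomorphic (shabat_tree g b' w') tree311"
proof
  assume iso: "plane_isomorphic (shabat_tree g b' w') tree311"
  obtain A B \<alpha> \<beta> where *: "A \<noteq> 0" "\<alpha> \<noteq> 0" "g = smult A (pcompose f [:\<beta>, \<alpha>:]) + [:B:]"
    "b' = A * b + B" "w' = A * w + B"
    using shabat_equivalent_poly[OF eq] .
  note sh = shabat_equivalent_shabat[OF shabat eq]
  let ?S = "pcompose S [:\<beta>, \<alpha>:]" and ?L = "\<lambda>z. \<alpha> * z + \<beta>"
  have sq: "g - [:w':] = smult (A * C) (?S ^ 2)"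
    unfolding *(5) by (rule square_pcompose[OF f *(3)])
  have T: "connected_map tree311" using trees_are_trees(2) by (simp add: bicolored_plane_tree_iff)
  obtain v where v: "inj_on v (black tree311)"
    "\<And>i. i \<in> black tree311 \<Longrightarrow> poly g (v i) = b' \<and> order (v i) (g - [:b':]) = vertex_degree tree311 i"
    "\<And>d e. d \<in> edges tree311 \<Longrightarrow> e \<in> edges tree311 \<Longrightarrow> d \<noteq> e \<Longrightarrow> white_end tree311 d = white_end tree311 e \<Longrightarrow>
      poly ?S (v (black_end tree311 e)) = - poly ?S (v (black_end tree311 d))"
    using isomorphic_opposite_sign[OF sh(1) T iso sq] sh(3) ramification_w by metis
  have deg: "vertex_degree tree311 0 = 3" "vertex_degree tree311 2 = 2"
    using degrees_trees(2) by (simp_all add: upt_6)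
  have degf: "degree f > 0" using degree_f by simp
  have lift: "poly f (?L z) = b" "order (?L z) (f - [:b:]) = order z (g - [:b':])" if "poly g z = b'" for z
    using ramification_affine(1,2)[OF degf *(1-3)] that unfolding *(4) by auto
  have "?L (v 0) = a"
    using v(2)[of 0] deg(1) lift[of "v 0"] by (intro degree_of_order(1)) (simp_all add: tree311_def)
  moreover have "?L (v 2) = p \<or> ?L (v 2) = q"
    using v(2)[of 2] deg(2) lift[of "v 2"] by (intro degree_of_order(2)) (simp_all add: tree311_def)
  \<comment> \<open>Edges 0, 1 and edges 2, 3 are the pairs at the first two white vertices of the
    long leg; two changes of sign cancel.\<close>
  moreover have "poly ?S (v 1) = - poly ?S (v 0)" "poly ?S (v 2) = - poly ?S (v 1)"
    using v(3)[of 0 1] v(3)[of 2 3] by (simp_all add: tree311_def)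
  ultimately have "poly S a = - poly S a"
    using opp by (auto simp: poly_pcompose algebra_simps)
  then show False using S_a_nz by simp
qed

text \<open>In \<open>tree221\<close> both bivalent vertices are neighbours of the trivalent one, so \<open>S\<close>
  would agree there.\<close>

lemma (in square_shabat) not_tree221:
  assumes same: "poly S p = poly S a"
    and eq: "shabat_equivalent (f, b, w) (g, b', w')"
  shows "\<not> plane_isomorphic (shabat_tree g b' w') tree221"
proof
  assume iso: "plane_isomorphic (shabat_tree g b' w') tree221"
  obtain A B \<alpha> \<beta> where *: "A \<noteq> 0" "\<alpha> \<noteq> 0" "g = smult A (pcompose f [:\<beta>, \<alpha>:]) + [:B:]"
    "b' = A * b + B" "w' = A * w + B"
    using shabat_equivalent_poly[OF eq] .
  note sh = shabat_equivalent_shabat[OF shabat eq]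
  let ?S = "pcompose S [:\<beta>, \<alpha>:]" and ?L = "\<lambda>z. \<alpha> * z + \<beta>"
  have sq: "g - [:w':] = smult (A * C) (?S ^ 2)"
    unfolding *(5) by (rule square_pcompose[OF f *(3)])
  have T: "connected_map tree221" using trees_are_trees(1) by (simp add: bicolored_plane_tree_iff)
  obtain v where v: "inj_on v (black tree221)"
    "\<And>i. i \<in> black tree221 \<Longrightarrow> poly g (v i) = b' \<and> order (v i) (g - [:b':]) = vertex_degree tree221 i"
    "\<And>d e. d \<in> edges tree221 \<Longrightarrow> e \<in> edges tree221 \<Longrightarrow> d \<noteq> e \<Longrightarrow> white_end tree221 d = white_end tree221 e \<Longrightarrow>
      poly ?S (v (black_end tree221 e)) = - poly ?S (v (black_end tree221 d))"
    using isomorphic_opposite_sign[OF sh(1) T iso sq] sh(3) ramification_w by metis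
  have deg: "vertex_degree tree221 0 = 3" "vertex_degree tree221 1 = 2" "vertex_degree tree221 3 = 2"
    using degrees_trees(1) by (simp_all add: upt_6)
  have degf: "degree f > 0" using degree_f by simp
  have lift: "poly f (?L z) = b" "order (?L z) (f - [:b:]) = order z (g - [:b':])" if "poly g z = b'" for z
    using ramification_affine(1,2)[OF degf *(1-3)] that unfolding *(4) by auto
  have 0: "?L (v 0) = a"
    using v(2)[of 0] deg(1) lift[of "v 0"] by (intro degree_of_order(1)) (simp_all add: tree221_def)
  have 1: "?L (v 1) = p \<or> ?L (v 1) = q"
    using v(2)[of 1] deg(2) lift[of "v 1"] by (intro degree_of_order(2)) (simp_all add: tree221_def)
  have 3: "?L (v 3) = p \<or> ?L (v 3) = q"
    using v(2)[of 3] deg(3) lift[of "v 3"] by (intro degree_of_order(2)) (simp_all add: tree221_def)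
  have "poly ?S (v 1) = - poly ?S (v 0)" "poly ?S (v 3) = - poly ?S (v 0)"
    using v(3)[of 0 1] v(3)[of 4 5] by (simp_all add: tree221_def)
  then have "poly S (?L (v 1)) = - poly S a" "poly S (?L (v 3)) = - poly S a"
    unfolding 0[symmetric] by (simp_all add: poly_pcompose algebra_simps)
  \<comment> \<open>Since \<open>S\<close> has the same value at \<open>p\<close> as at
    \<open>a\<close>, both bivalent vertices would have to be \<open>q\<close>.\<close>
  then have "?L (v 1) \<noteq> p" "?L (v 3) \<noteq> p" using same S_a_nz by auto
  then have "?L (v 1) = ?L (v 3)" using 1 3 by simp
  then have "v 1 = v 3" using *(2) by simp
  then show False using v(1) by (auto simp: tree221_def inj_on_eq_iff)
qed

theorem lemma9p2:
  fixes x Q1 P Q2 R :: "complex poly"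
    and \<pi> :: "nat multiset \<times> nat multiset \<times> nat"
  assumes "x = [:0, 1:]"
    and "Q1 = x * (x - [:64 / 9:])"
    and "P = x ^ 3 * (x ^ 2 + smult (5 / 3) x + [:40 / 9:])"
    and "Q2 = x * (x - [:4 / 9:])"
    and "R = x ^ 3 * (x - [:5 / 3:]) ^ 2"
    and "\<pi> = ({#3, 2, 2, 1, 1, 1#}, {#2, 2, 2, 2, 2#}, 10)"
  shows "\<exists>(T1 :: (nat, nat) bicolored_plane_graph) (T2 :: (nat, nat) bicolored_plane_graph) c2 d2.
    bicolored_plane_tree T1 \<and> passport T1 = \<pi> \<and>
    bicolored_plane_tree T2 \<and> passport T2 = \<pi> \<and>
    \<not> plane_isomorphic T1 T2 \<and>
    (\<forall>T :: ('v, 'e) bicolored_plane_graph. bicolored_plane_tree T \<and> passport T = \<pi> \<longrightarrow>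
       plane_isomorphic T T1 \<or> plane_isomorphic T T2) \<and>
    is_shabat_polynomial_of T1 (pcompose Q1 P) 0 c2 \<and>
    is_shabat_polynomial_of T2 (pcompose Q2 R) 0 d2 \<and>
    (\<forall>f b w. is_shabat_polynomial_of T1 f b w \<longleftrightarrow>
       shabat_equivalent (pcompose Q1 P, 0, c2) (f, b, w)) \<and>
    (\<forall>f b w. is_shabat_polynomial_of T2 f b w \<longleftrightarrow>
       shabat_equivalent (pcompose Q2 R, 0, d2) (f, b, w))"
proof -
  define F1 F2 where "F1 = pcompose Q1 P" and "F2 = pcompose Q2 R"
  have polyP: "poly P y = y ^ 3 * (y ^ 2 + 5 / 3 * y + 40 / 9)" for y
    unfolding assms(1,3) by (simp add: poly_power power2_eq_square algebra_simps)
  have polyR: "poly R y = y ^ 3 * (y - 5 / 3) ^ 2" for y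
    unfolding assms(1,5) by (simp add: poly_power)
  have F1_P: "poly F1 y = poly P y * (poly P y - 64 / 9)" for y
    unfolding F1_def assms(2) poly_pcompose assms(1) by simp
  have F2_R: "poly F2 y = poly R y * (poly R y - 4 / 9)" for y
    unfolding F2_def assms(4) poly_pcompose assms(1) by simp
  have F1: "poly F1 y = (y ^ 3 * (y ^ 2 + 5 / 3 * y + 40 / 9)) * (y ^ 3 * (y ^ 2 + 5 / 3 * y + 40 / 9) - 64 / 9)" for y
    unfolding polyP[symmetric] by (rule F1_P)
  have F2: "poly F2 y = (y ^ 3 * (y - 5 / 3) ^ 2) * (y ^ 3 * (y - 5 / 3) ^ 2 - 4 / 9)" for y
    unfolding polyR[symmetric] by (rule F2_R)
  \<comment> \<open>Half the difference of the roots of \<open>y^2 + 4/3 y + 8/3\<close>, the factor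
    of the derivative of \<open>P\<close> besides \<open>5 y^2\<close>; its square is 4/9 -
    8/3.\<close>
  define i where "i = 2 / 3 * complex_of_real (sqrt 5) * \<i>"
  have i: "i ^ 2 = - (20 / 9)"
  proof -
    have "complex_of_real (sqrt 5) ^ 2 = 5" by (simp flip: of_real_power)
    then show ?thesis unfolding i_def by (simp add: power_mult_distrib power_divide)
  qed
  have i0: "i \<noteq> 0" using i by auto
  define p q where "p = - (2 / 3) + i" and "q = - (2 / 3) - i"
  have pq: "p ^ 2 = - (4 / 3) * p - 8 / 3" "q ^ 2 = - (4 / 3) * q - 8 / 3"
    using i unfolding p_def q_def by algebra+
  \<comment> \<open>Reduction modulo the quadratic leaves a constant: both nonzero critical points
    of \<open>P\<close> have the value 64/9, the nonzero root of \<open>Q1\<close>.\<close>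
  have Ppq: "y ^ 3 * (y ^ 2 + 5 / 3 * y + 40 / 9) = 64 / 9" if "y ^ 2 = - (4 / 3) * y - 8 / 3" for y :: complex
    using that by algebra
  have P_expand: "P = [:0, 0, 0, 40 / 9, 5 / 3, 1:]"
    unfolding assms(1,3) by (simp add: eval_nat_numeral)
  have R_expand: "R = [:0, 0, 0, 25 / 9, - (10 / 3), 1:]"
    unfolding assms(1,5) by (simp add: eval_nat_numeral)
  \<comment> \<open>Completing the square in \<open>Q1\<close> shifts \<open>P\<close> by the
    midpoint 32/9 of its critical values 0 and 64/9, which therefore become opposite.\<close>
  interpret I: square_shabat F1 "P - [:32 / 9:]" 1 "- (1024 / 81)" 0 0 p q
  proof
    show "F1 - [:- (1024 / 81):] = smult 1 ((P - [:32 / 9:]) ^ 2)"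
      by (rule poly_ext) (simp add: F1_P power2_eq_square algebra_simps)
    show "degree (P - [:32 / 9:]) = 5" unfolding P_expand by simp
    show "pderiv (P - [:32 / 9:]) = smult 5 ([:- 0, 1:] ^ 2 * [:- p, 1:] * [:- q, 1:])"
    proof (rule poly_ext)
      fix y
      have "(y - p) * (y - q) = y ^ 2 + 4 / 3 * y + 8 / 3" using i unfolding p_def q_def by algebra
      then show "poly (pderiv (P - [:32 / 9:])) y = poly (smult 5 ([:- 0, 1:] ^ 2 * [:- p, 1:] * [:- q, 1:])) y"
        unfolding P_expand by (simp add: pderiv_pCons poly_power algebra_simps power2_eq_square)
    qed
    have "p \<noteq> 0" "q \<noteq> 0" using pq by auto
    moreover have "p - q = 2 * i" by (simp add: p_def q_def)
    ultimately show "distinct [0, p, q]" using i0 by auto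
    show "poly F1 p = 0" "poly F1 q = 0" unfolding F1 Ppq[OF pq(1)] Ppq[OF pq(2)] by simp_all
    show "poly F1 0 = 0" unfolding F1 by simp
  qed simp_all
  \<comment> \<open>\<open>R\<close> vanishes at its critical points 0 and 5/3 and equals 4/9 at the
    third one, 1; the shift is again the midpoint of the critical values.\<close>
  interpret J: square_shabat F2 "R - [:2 / 9:]" 1 "- (4 / 81)" 0 0 "5 / 3" 1
  proof
    show "F2 - [:- (4 / 81):] = smult 1 ((R - [:2 / 9:]) ^ 2)"
      by (rule poly_ext) (simp add: F2_R power2_eq_square algebra_simps)
    show "degree (R - [:2 / 9:]) = 5" unfolding R_expand by simp
    show "pderiv (R - [:2 / 9:]) = smult 5 ([:- 0, 1:] ^ 2 * [:- (5 / 3), 1:] * [:- 1, 1:])"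
      unfolding R_expand by (simp add: pderiv_pCons eval_nat_numeral)
    show "poly F2 0 = 0" "poly F2 (5 / 3) = 0" "poly F2 1 = 0" unfolding F2 by (simp_all add: power2_eq_square)
  qed simp_all
  have "poly P p = 64 / 9" "poly P q = 64 / 9" "poly P 0 = 0"
    unfolding polyP Ppq[OF pq(1)] Ppq[OF pq(2)] by simp_all
  then have signs: "poly (P - [:32 / 9:]) p = - poly (P - [:32 / 9:]) 0"
    "poly (P - [:32 / 9:]) q = - poly (P - [:32 / 9:]) 0" by simp_all
  have not311: "\<not> plane_isomorphic (shabat_tree f b w) tree311" if "shabat_equivalent (F1, 0, - (1024 / 81)) (f, b, w)" for f b w
    by (rule I.not_tree311[OF signs that])
  have not221: "\<not> plane_isomorphic (shabat_tree f b w) tree221" if "shabat_equivalent (F2, 0, - (4 / 81)) (f, b, w)" for f b w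
    using that by (rule J.not_tree221[rotated]) (simp add: polyR)
  have refl: "shabat_equivalent (F, b, w) (F, b, w)" for F b w
    unfolding shabat_equivalent_def prod.case
    by (rule exI[of _ 1], rule exI[of _ 0], rule exI[of _ 1], rule exI[of _ 0]) simp
  \<comment> \<open>Equivalence preserves the ramification, so the tree of \<open>f\<close> is one
    of the two; excluding \<open>tree311\<close> decides.\<close>
  have class1: "is_shabat_polynomial_of tree221 f b w" if "shabat_equivalent (F1, 0, - (1024 / 81)) (f, b, w)" for f b w
    unfolding is_shabat_polynomial_of_def
    using tree_of_ramification shabat_equivalent_shabat[OF I.shabat that] I.ramification_b I.ramification_w I.degree_f
      not311[OF that] by metis
  have class2: "is_shabat_polynomial_of tree311 f b w" if "shabat_equivalent (F2, 0, - (4 / 81)) (f, b, w)" for f b w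
    unfolding is_shabat_polynomial_of_def
    using tree_of_ramification shabat_equivalent_shabat[OF J.shabat that] J.ramification_b J.ramification_w J.degree_f
      not221[OF that] by metis
  have uniq: "shabat_equivalent (F1, 0, - (1024 / 81)) (f, b, w) \<or> shabat_equivalent (F2, 0, - (4 / 81)) (f, b, w)"
    if "is_shabat_polynomial_of T f b w" "bicolored_plane_tree T"
      "passport T = ({#3, 2, 2, 1, 1, 1#}, {#2, 2, 2, 2, 2#}, 10)" for T :: "(nat, nat) bicolored_plane_graph" and f b w
  proof -
    have sh: "is_shabat f b w" and iso: "plane_isomorphic (shabat_tree f b w) T"
      using that(1) by (auto simp: is_shabat_polynomial_of_def)
    have "(ramification f b, ramification f w, degree f) = ({#3, 2, 2, 1, 1, 1#}, {#2, 2, 2, 2, 2#}, 10)"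
      using passport_of_isomorphic_shabat_tree[OF sh that(2) iso] that(3) by simp
    then show ?thesis by (intro shabat_uniqueness[OF sh _ _ _ F1 F2]) simp_all
  qed
  \<comment> \<open>For the forward direction, \<open>uniq\<close> leaves the classes of
    \<open>F1\<close> and \<open>F2\<close>, and \<open>not221\<close> excludes the second.\<close>
  have iff1: "is_shabat_polynomial_of tree221 f b w \<longleftrightarrow> shabat_equivalent (F1, 0, - (1024 / 81)) (f, b, w)" for f b w
    using class1 uniq[OF _ trees_are_trees(1) passport_trees(1)] not221
    unfolding is_shabat_polynomial_of_def by blast
  have iff2: "is_shabat_polynomial_of tree311 f b w \<longleftrightarrow> shabat_equivalent (F2, 0, - (4 / 81)) (f, b, w)" for f b w
    using class2 uniq[OF _ trees_are_trees(2) passport_trees(2)] not311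
    unfolding is_shabat_polynomial_of_def by blast
  have "plane_isomorphic (shabat_tree F1 0 (- (1024 / 81))) tree221"
    using class1[OF refl] by (simp add: is_shabat_polynomial_of_def)
  \<comment> \<open>An isomorphism would carry the tree of \<open>F1\<close>, which is
    \<open>tree221\<close>, to \<open>tree311\<close>, which the sign of \<open>S\<close>
    forbids.\<close>
  then have noniso: "\<not> plane_isomorphic tree221 tree311"
    using not311[OF refl] plane_isomorphic_trans by blast
  have two: "plane_isomorphic T tree221 \<or> plane_isomorphic T tree311"
    if "bicolored_plane_tree T" "passport T = \<pi>" for T :: "('v, 'e) bicolored_plane_graph"
    using two_trees[of T] that assms(6) by (simp add: bicolored_plane_tree_iff)
  show ?thesis
    unfolding F1_def[symmetric] F2_def[symmetric]
    by (intro exI[of _ tree221] exI[of _ tree311] exI[of _ "- (1024 / 81)"] exI[of _ "- (4 / 81)"])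
      (use trees_are_trees passport_trees assms(6) noniso two iff1 iff2 refl in blast)
qed

end
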